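(* Let $d,m,k\in\mathbb{N}$, $d\ge2$, and let $\Omega\subset\mathbb{R}^d$ be an open, bounded Lipschitz domain. Let $E_\epsilon^{\mathcal{B}}(\chi;F)$ be the energy (see context) associated with the $m$-th order divergence $\mathcal{B}(D)=\mathrm{div}^m$ acting on $\mathbb{R}^k\otimes\mathrm{Sym}(\mathbb{R}^d;m)$-valued fields. Let $A,B\in\mathbb{R}^k\otimes\mathrm{Sym}(\mathbb{R}^d;m)$ satisfy $A-B=v\otimes e_1^{\odot l_1}\odot e_2^{\odot l_2}\odot\cdots\odot e_d^{\odot l_d}$ for some $v\in\mathbb{R}^k\setminus\{0\}$ and integers $l_j\ge0$ with $\sum_{j=1}^dl_j=m$, and let $F_\lambda:=\lambda A+(1-\lambda)B$ for some $\lambda\in(0,1)$. Set $L:=m-\min_{j\in\{1,\dots,d\}}l_j\le m$. Then there exist $C>0$ (depending on $d,m,\Omega,v$) and $\epsilon_0>0$ (depending on $d,m,\Omega,v,\lambda$) such that for any $\epsilon\in(0,\epsilon_0)$ $$C\min\{1-\lambda,\lambda\}^2\,\epsilon^{\frac{2L}{2L+1}}\le\inf_{\chi\in BV(\Omega;\{A,B\})}E_\epsilon^{\mathcal{B}}(\chi;F_\lambda).$$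
   Context: $\mathrm{Sym}(\mathbb{R}^d;m)\subset(\mathbb{R}^d)^{\otimes m}$ denotes symmetric $m$-tensors, $e_1,\dots,e_d$ the canonical basis of $\mathbb{R}^d$, $v^1\odot\dots\odot v^m:=\frac1{m!}\sum_{\tau\in\mathfrak{S}_m}v^{\tau(1)}\otimes\dots\otimes v^{\tau(m)}$, and $e_k^{\odot j}$ the symmetric product of $j$ copies of $e_k$ (factors with exponent $0$ are omitted). The $m$-th order divergence is $$[\mathrm{div}^mu]_j:=\sum_{1\le i_1\le\dots\le i_m\le d}\partial^m_{i_1\dots i_m}u_{j\,i_1\dots i_m},\qquad j\in\{1,\dots,k\},$$ extended to distributions by duality. For $F\in\mathbb{R}^k\otimes\mathrm{Sym}(\mathbb{R}^d;m)$ let $$\mathcal{D}_F:=\{u\in L^2_{loc}(\mathbb{R}^d;\mathbb{R}^k\otimes\mathrm{Sym}(\mathbb{R}^d;m)):\ \mathrm{div}^mu=0\text{ in }\mathcal{D}'(\mathbb{R}^d),\ u=F\text{ in }\mathbb{R}^d\setminus\overline\Omega\},$$ and for $\epsilon>0$ and $\chi\in BV(\Omega;\{A,B\})$ ($BV$ functions with values in $\{A,B\}$) let $$E_\epsilon^{\mathcal{B}}(\chi;F):=\inf_{u\in\mathcal{D}_F}\int_\Omega|u-\chi|^2\,dx+\epsilon\int_\Omega|\nabla\chi|,$$ where $\int_\Omega|\nabla\chi|$ is the total variation of the distributional gradient of $\chi$ in $\Omega$. *)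

theory Defs
  imports "HOL-Analysis.Analysis"
begin

text \<open>The dimension \<open>d\<close>, the order \<open>m\<close> and the number of rows \<open>k\<close> are the cardinalities of finite
  index types. An \<open>m\<close>-tensor over \<open>\<real>\<^sup>d\<close> is its family of components \<open>T\<^bsub>i\<^esub>\<close>, where the multi-index
  \<open>(i\<^sub>1, \<dots>, i\<^sub>m)\<close> is a map \<open>i :: 'm \<Rightarrow> 'd\<close>. The Euclidean norm and inner product of these vector
  types are the Frobenius ones. The linear orders on \<open>'d\<close> and \<open>'m\<close> number the basis vectors of
  \<open>\<real>\<^sup>d\<close> and the slots of a tensor.\<close>

type_synonym ('m, 'd) tens = "real ^ ('m \<Rightarrow> 'd)"
type_synonym ('m, 'd, 'k) tens_rows = "(real ^ ('m \<Rightarrow> 'd)) ^ 'k"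


section \<open>Symmetric tensors\<close>

definition sym_tensors :: "('m::finite, 'd::finite) tens set" where
  "sym_tensors = {T. \<forall>p. p permutes (UNIV :: 'm set) \<longrightarrow> (\<forall>i. T $ (i \<circ> p) = T $ i)}"

definition sym_rows :: "('m::finite, 'd::finite, 'k::finite) tens_rows set" where
  "sym_rows = {T. \<forall>j. T $ j \<in> sym_tensors}"

definition tensor_prod :: "('m::finite \<Rightarrow> real ^ 'd) \<Rightarrow> ('m, 'd::finite) tens" where
  "tensor_prod w = (\<chi> i. \<Prod>a\<in>UNIV. w a $ i a)"

definition sym_prod :: "('m::finite \<Rightarrow> real ^ 'd) \<Rightarrow> ('m, 'd::finite) tens" where
  "sym_prod w = (1 / fact CARD('m)) *\<^sub>R
     (\<Sum>\<tau> | \<tau> permutes (UNIV :: 'm set). tensor_prod (w \<circ> \<tau>))"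

text \<open>The list consisting of \<open>l\<^sub>1\<close> copies of \<open>e\<^sub>1\<close>, then \<open>l\<^sub>2\<close> copies of \<open>e\<^sub>2\<close>, and so on.\<close>

definition basis_factors :: "('d::{finite,linorder} \<Rightarrow> nat) \<Rightarrow> (real ^ 'd::{finite,linorder}) list" where
  "basis_factors l =
     concat (map (\<lambda>j. replicate (l j) (axis j 1)) (sorted_list_of_set (UNIV :: 'd set)))"

text \<open>\<open>e\<^sub>1\<^bsup>\<odot>l\<^sub>1\<^esup> \<odot> \<dots> \<odot> e\<^sub>d\<^bsup>\<odot>l\<^sub>d\<^esup>\<close>; only meaningful if the \<open>l\<^sub>j\<close> sum to \<open>m\<close>. The number \<open>card {..<a}\<close> is
  the position of the slot \<open>a\<close>, counted from \<open>0\<close>.\<close>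

definition basis_sym_prod ::
  "('d::{finite,linorder} \<Rightarrow> nat) \<Rightarrow> ('m::{finite,linorder}, 'd) tens" where
  "basis_sym_prod l = sym_prod (\<lambda>a :: 'm. basis_factors l ! card {..<a})"

definition row_tensor ::
  "real ^ 'k \<Rightarrow> ('m::finite, 'd::finite) tens \<Rightarrow> ('m, 'd, 'k::finite) tens_rows" where
  "row_tensor v T = (\<chi> j. v $ j *\<^sub>R T)"


section \<open>Test functions\<close>

definition partial ::
  "'d::finite \<Rightarrow> (real ^ 'd \<Rightarrow> 'a::real_normed_vector) \<Rightarrow> real ^ 'd \<Rightarrow> 'a" where
  "partial i f x = frechet_derivative f (at x) (axis i 1)"

definition iter_partial ::
  "'d::finite list \<Rightarrow> (real ^ 'd \<Rightarrow> 'a::real_normed_vector) \<Rightarrow> real ^ 'd \<Rightarrow> 'a" where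
  "iter_partial is f = foldr partial is f"

text \<open>Smooth functions with compact support contained in \<open>U\<close>. Differentiability of all iterated
  partial derivatives also makes them continuous.\<close>

definition test_functions ::
  "(real ^ 'd::finite) set \<Rightarrow> (real ^ 'd \<Rightarrow> 'a::real_normed_vector) set" where
  "test_functions U = {\<phi>. (\<forall>is x. iter_partial is \<phi> differentiable (at x)) \<and>
     compact (closure {x. \<phi> x \<noteq> 0}) \<and> closure {x. \<phi> x \<noteq> 0} \<subseteq> U}"


section \<open>The divergence of order \<open>m\<close>\<close>

definition L2_loc :: "(real ^ 'd::finite \<Rightarrow> 'a::euclidean_space) set" where
  "L2_loc = {u. u \<in> borel_measurable lebesgue \<and>
     (\<forall>K. compact K \<longrightarrow> set_integrable lebesgue K (\<lambda>x. (norm (u x))\<^sup>2))}"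

text \<open>The distribution \<open>[div\<^sup>m u]\<^sub>j\<close> applied to \<open>\<phi>\<close>. The multi-indices with \<open>i\<^sub>1 \<le> \<dots> \<le> i\<^sub>m\<close> are the
  monotone maps, each counted once and without a multinomial weight.\<close>

definition div_m_distr ::
  "(real ^ 'd::{finite,linorder} \<Rightarrow> ('m::{finite,linorder}, 'd, 'k) tens_rows) \<Rightarrow> 'k::finite \<Rightarrow>
   (real ^ 'd::{finite,linorder} \<Rightarrow> real) \<Rightarrow> real" where
  "div_m_distr u j \<phi> = (- 1) ^ CARD('m) *
     (\<Sum>i | mono (i :: 'm \<Rightarrow> 'd). \<integral>x. u x $ j $ i *
        iter_partial (map i (sorted_list_of_set (UNIV :: 'm set))) \<phi> x \<partial>lebesgue)"

definition div_m_free ::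
  "(real ^ 'd::{finite,linorder} \<Rightarrow> ('m::{finite,linorder}, 'd, 'k::finite) tens_rows) \<Rightarrow> bool"
  where "div_m_free u \<longleftrightarrow> (\<forall>j. \<forall>\<phi>\<in>test_functions UNIV. div_m_distr u j \<phi> = 0)"

definition admissible ::
  "(real ^ 'd::{finite,linorder}) set \<Rightarrow> ('m, 'd, 'k) tens_rows \<Rightarrow>
   (real ^ 'd::{finite,linorder} \<Rightarrow> ('m::{finite,linorder}, 'd, 'k::finite) tens_rows) set"
  where
  "admissible \<Omega> F = {u. u \<in> L2_loc \<and> (\<forall>x. u x \<in> sym_rows) \<and> div_m_free u \<and>
     (AE x in lebesgue. x \<notin> closure \<Omega> \<longrightarrow> u x = F)}"


section \<open>Functions of bounded variation\<close>

definition total_variation ::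
  "(real ^ 'd::finite) set \<Rightarrow> (real ^ 'd \<Rightarrow> 'a::euclidean_space) \<Rightarrow> ennreal" where
  "total_variation \<Omega> f =
     (SUP \<phi> \<in> {\<phi> :: real ^ 'd \<Rightarrow> 'a ^ 'd. \<phi> \<in> test_functions \<Omega> \<and> (\<forall>x. norm (\<phi> x) \<le> 1)}.
        ennreal (\<integral>x\<in>\<Omega>. (\<Sum>i\<in>UNIV. f x \<bullet> partial i (\<lambda>y. \<phi> y $ i) x) \<partial>lebesgue))"

definition BV_two_valued ::
  "(real ^ 'd::finite) set \<Rightarrow> 'a \<Rightarrow> 'a \<Rightarrow> (real ^ 'd \<Rightarrow> 'a::euclidean_space) set" where
  "BV_two_valued \<Omega> A B = {X. set_integrable lebesgue \<Omega> X \<and> total_variation \<Omega> X < \<infinity> \<and>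
     (\<forall>x\<in>\<Omega>. X x \<in> {A, B})}"


section \<open>The energy\<close>

text \<open>The phase indicator is called \<open>X\<close>; only its values on \<open>\<Omega>\<close> matter.\<close>

definition energy ::
  "real \<Rightarrow> (real ^ 'd::{finite,linorder}) set \<Rightarrow>
   (real ^ 'd::{finite,linorder} \<Rightarrow> ('m::{finite,linorder}, 'd, 'k::finite) tens_rows) \<Rightarrow>
   ('m, 'd, 'k) tens_rows \<Rightarrow> ennreal" where
  "energy \<epsilon> \<Omega> X F =
     (INF u \<in> admissible \<Omega> F. \<integral>\<^sup>+x\<in>\<Omega>. ennreal ((norm (u x - X x))\<^sup>2) \<partial>lebesgue) +
     ennreal \<epsilon> * total_variation \<Omega> X"


section \<open>Lipschitz domains\<close>

text \<open>A nonempty connected open set which, near each of its boundary points, is the region above a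
  Lipschitz graph over the hyperplane orthogonal to some unit vector \<open>n\<close>.\<close>

definition lipschitz_domain :: "(real ^ 'd::finite) set \<Rightarrow> bool" where
  "lipschitz_domain \<Omega> \<longleftrightarrow> open \<Omega> \<and> connected \<Omega> \<and> \<Omega> \<noteq> {} \<and>
     (\<forall>p\<in>frontier \<Omega>. \<exists>r>0. \<exists>n K (\<gamma> :: real ^ 'd \<Rightarrow> real).
        norm n = 1 \<and> K-lipschitz_on {y. y \<bullet> n = 0} \<gamma> \<and>
        \<Omega> \<inter> ball p r = {x \<in> ball p r. \<gamma> (x - (x \<bullet> n) *\<^sub>R n) < x \<bullet> n})"

end

theory Submission
  imports Defs "HOL-Computational_Algebra.Polynomial"
begin

text \<open>
  On \<open>\<Omega>\<close> write \<open>X = B + f (A - B)\<close> with \<open>f\<close> taking the values \<open>0\<close> and \<open>1\<close>, and let \<open>g = f - lam\<close> on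
  \<open>\<Omega>\<close> and \<open>g = 0\<close> elsewhere, so that \<open>X - F = g (A - B)\<close> and \<open>\<bar>g\<bar> \<ge> min lam (1 - lam)\<close> on \<open>\<Omega>\<close>. Let \<open>V\<close> be
  the total variation of \<open>X\<close> and \<open>W\<close> the elastic energy of an admissible field \<open>u\<close>. The core of the
  proof is the interpolation inequality (\<open>elastic_energy_estimate\<close>)
  \<open>min lam (1 - lam) \<le> C (V / \<mu> + \<mu>\<^sup>L \<surd>W)\<close> for all large \<open>\<mu>\<close>. The choice \<open>\<mu> = \<epsilon> powr (- 1 / (2 L + 1))\<close>
  balances the two terms and gives the scaling \<open>\<epsilon> powr (2 L / (2 L + 1))\<close>.

  The inequality comes from a duality argument. In a row where \<open>v\<close> does not vanish, exactly one component of
  \<open>A - B\<close> at a monotone multi-index is nonzero, namely the one at the multi-index \<open>k\<close> in which each \<open>j\<close>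
  occurs \<open>l j\<close> times. Testing \<open>div\<^sup>m u = 0\<close> with \<open>\<phi>\<close> therefore bounds the integral of \<open>g \<partial>\<^sup>l\<phi>\<close> by a constant
  times \<open>\<surd>W\<close> times the supremum on \<open>\<Omega>\<close> of the derivatives of \<open>\<phi>\<close> of order \<open>m\<close>; the constant field \<open>F\<close>
  contributes nothing, and the boundary of \<open>\<Omega>\<close> is a null set.

  The test function (\<open>ex_potential\<close>) solves \<open>\<partial>\<^sup>l\<phi> = a * \<rho>\<close> on \<open>\<Omega>\<close>, where \<open>\<rho>\<close> is a mollifier of width about
  \<open>1 / \<mu>\<close> and \<open>a\<close> is the sign of \<open>g\<close> on a fixed ball in \<open>\<Omega>\<close>: it is obtained by integrating \<open>l j\<close> times in
  the direction \<open>j\<close>. Then \<open>\<partial>\<^sup>\<alpha>\<phi>\<close> with \<open>\<bar>\<alpha>\<bar> = m\<close> differentiates \<open>a * \<rho>\<close> only in the directions with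
  \<open>\<alpha> j \<ge> l j\<close>, \<open>\<alpha> j - l j\<close> times, and these exponents sum up to at most \<open>m - Min (range l) = L\<close>
  (\<open>sum_monus_le\<close>). Hence \<open>\<partial>\<^sup>\<alpha>\<phi>\<close> is bounded by a multiple of \<open>\<mu>\<^sup>L\<close>.

  For the reverse bound, the integral of \<open>g (a * \<rho>)\<close> is, up to the total mass of \<open>\<rho>\<close>, an average over \<open>\<bar>z\<bar> \<le> d / \<mu>\<close>,
  with \<open>d\<close> the dimension, of the correlations of \<open>g\<close> with the translates of \<open>a\<close> by \<open>z\<close>. At \<open>z = 0\<close> the correlation is the integral of \<open>\<bar>g\<bar>\<close> over the
  ball, and a translation by \<open>z\<close> with \<open>\<bar>z\<bar>\<close> small changes it by at most
  \<open>\<bar>z\<bar> V / \<bar>A - B\<bar>\<close> (\<open>phase_correlation_ge\<close>).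
\<close>

section \<open>Kernels in one variable\<close>

text \<open>A smooth function of one variable, given as \<open>D 0\<close> together with its successive derivatives
  \<open>D 1\<close>, \<open>D 2\<close>, \<dots>.\<close>
definition derivative_chain :: "(nat \<Rightarrow> real \<Rightarrow> real) \<Rightarrow> bool" where
  "derivative_chain D \<longleftrightarrow> (\<forall>n t. (D n has_real_derivative D (Suc n) t) (at t))"

lemma derivative_chain_deriv: "derivative_chain D \<Longrightarrow> (D n has_real_derivative D (Suc n) t) (at t)"
  by (simp add: derivative_chain_def)

lemma derivative_chain_continuous: "derivative_chain D \<Longrightarrow> continuous_on S (D n)"
  by (meson DERIV_continuous_on derivative_chain_deriv DERIV_subset subset_UNIV)

text \<open>The function \<open>p(t) (1 - t\<^sup>2)\<^sup>-\<^sup>k exp (- 1 / (1 - t\<^sup>2))\<close> on \<open>(-1, 1)\<close>, extended by zero. This family is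
  closed under differentiation, and \<open>exp_bump_step\<close> computes the parameters of the derivative.\<close>
definition exp_bump :: "real poly \<times> nat \<Rightarrow> real \<Rightarrow> real" where
  "exp_bump = (\<lambda>(p, k) t. if \<bar>t\<bar> < 1
     then poly p t * inverse (1 - t\<^sup>2) ^ k * exp (- inverse (1 - t\<^sup>2)) else 0)"

definition exp_bump_step :: "real poly \<times> nat \<Rightarrow> real poly \<times> nat" where
  "exp_bump_step = (\<lambda>(p, k). (pderiv p * [:1, 0, -1:]^2
       + smult (2 * real k) ([:0, 1:] * p * [:1, 0, -1:]) - smult 2 ([:0, 1:] * p), k + 2))"

lemma power_le_fact_exp:
  fixes x :: real
  assumes "0 \<le> x"
  shows "x ^ n \<le> fact n * exp x"
proof -
  have "(\<Sum>i\<in>{n}. x ^ i /\<^sub>R fact i) \<le> exp x"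
    unfolding exp_def using assms
    by (intro sum_le_suminf summable_exp_generic) auto
  then show ?thesis by (simp add: divide_simps mult.commute)
qed

text \<open>The exponential beats the pole of \<open>(1 - t\<^sup>2)\<^sup>-\<^sup>k\<close>, so the function vanishes quadratically at each
  \<open>t\<close> outside \<open>(-1, 1)\<close>; this is the differentiability at the endpoints.\<close>
lemma exp_bump_quadratic:
  assumes "1 \<le> \<bar>t\<bar>"
  obtains C where "\<And>s. \<bar>exp_bump pk s\<bar> \<le> C * (s - t)\<^sup>2"
proof -
  obtain p k where pk: "pk = (p, k)" by force
  have "compact (poly p ` {-1..1})"
    by (intro compact_continuous_image continuous_intros) auto
  then obtain M where M: "\<And>s. s \<in> {-1..1} \<Longrightarrow> \<bar>poly p s\<bar> \<le> M"
    by (metis (no_types, lifting) bounded_iff compact_imp_bounded image_eqI real_norm_def)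
  have M0: "0 \<le> M" using M[of 0] by auto
  show thesis
  proof (rule that[of "M * fact (k + 2) * 4"])
    fix s
    show "\<bar>exp_bump pk s\<bar> \<le> M * fact (k + 2) * 4 * (s - t)\<^sup>2"
    proof (cases "\<bar>s\<bar> < 1")
      case True
      define q where "q = 1 - s\<^sup>2"
      have q: "0 < q" using True by (simp add: q_def abs_square_less_1)
      have "1 / q ^ (k + 2) \<le> fact (k + 2) * exp (1 / q)"
        using power_le_fact_exp[of "1 / q" "k + 2"] q by (simp add: power_one_over)
      then have "inverse q ^ k * exp (- inverse q) \<le> fact (k + 2) * q\<^sup>2"
        using q by (simp add: field_simps exp_minus power_add power2_eq_square)
      moreover have "q \<le> 2 * \<bar>s - t\<bar>"
      proof -
        have "q = (1 - \<bar>s\<bar>) * (1 + \<bar>s\<bar>)"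
          by (simp add: q_def algebra_simps power2_eq_square)
        also have "\<dots> \<le> (1 - \<bar>s\<bar>) * 2"
          using True by (intro mult_left_mono) auto
        also have "\<dots> \<le> 2 * \<bar>s - t\<bar>" using assms abs_triangle_ineq[of s "t - s"] abs_minus_commute[of s t] by simp
        finally show ?thesis .
      qed
      then have "q\<^sup>2 \<le> 4 * (s - t)\<^sup>2"
        using q power_mono[of q "2 * \<bar>s - t\<bar>" 2] by (simp add: power_mult_distrib)
      ultimately have e: "inverse q ^ k * exp (- inverse q) \<le> fact (k + 2) * (4 * (s - t)\<^sup>2)"
        by (meson fact_ge_zero mult_left_mono order_trans)
      have "\<bar>exp_bump pk s\<bar> = \<bar>poly p s\<bar> * (inverse q ^ k * exp (- inverse q))"
        using True q by (simp add: exp_bump_def pk q_def abs_mult power_abs)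
      also have "\<dots> \<le> M * (fact (k + 2) * (4 * (s - t)\<^sup>2))"
        using M[of s] True q M0 by (intro mult_mono[OF _ e]) (auto simp: abs_less_iff)
      finally show ?thesis by (simp add: mult.assoc)
    next
      case False
      then show ?thesis using M0 by (simp add: exp_bump_def pk)
    qed
  qed
qed

lemma DERIV_zero_if_quadratic:
  fixes f :: "real \<Rightarrow> real"
  assumes "\<And>s. \<bar>f s\<bar> \<le> C * (s - t)\<^sup>2"
  shows "(f has_real_derivative 0) (at t)"
proof -
  have f0: "f t = 0" using assms[of t] by simp
  have "((\<lambda>s. (f s - f t) / (s - t)) \<longlongrightarrow> 0) (at t)"
  proof (rule Lim_null_comparison)
    have "norm ((f s - f t) / (s - t)) \<le> C * \<bar>s - t\<bar>" for s
    proof (cases "s = t")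
      case False
      have "(s - t)\<^sup>2 = \<bar>s - t\<bar> * \<bar>s - t\<bar>" by (simp add: power2_eq_square)
      then show ?thesis using False assms[of s] f0 by (simp add: divide_le_eq mult.assoc)
    qed simp
    then show "\<forall>\<^sub>F s in at t. norm ((f s - f t) / (s - t)) \<le> C * \<bar>s - t\<bar>" by simp
    show "((\<lambda>s. C * \<bar>s - t\<bar>) \<longlongrightarrow> 0) (at t)"
      by (auto intro!: tendsto_eq_intros)
  qed
  then show ?thesis by (simp add: has_field_derivative_iff)
qed

lemma exp_bump_DERIV: "(exp_bump pk has_real_derivative exp_bump (exp_bump_step pk) t) (at t)"
proof (cases "\<bar>t\<bar> < 1")
  case True
  obtain p k where pk: "pk = (p, k)" by force
  define q where "q = 1 - t\<^sup>2"
  have q: "0 < q" using True by (simp add: q_def abs_square_less_1)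
  define r E where "r = inverse q" and "E = exp (- r)"
  have r: "((\<lambda>t. inverse (1 - t\<^sup>2)) has_real_derivative 2 * t * r\<^sup>2) (at t)"
    using q unfolding r_def q_def
    by (auto intro!: derivative_eq_intros simp: power2_eq_square)
  have rk: "((\<lambda>t. inverse (1 - t\<^sup>2) ^ k) has_real_derivative real k * (2 * t * r ^ (k + 1))) (at t)"
    by (rule DERIV_cong[OF DERIV_power[OF r]])
       (cases k; simp add: r_def q_def power2_eq_square mult_ac)
  have E: "((\<lambda>t. exp (- inverse (1 - t\<^sup>2))) has_real_derivative E * - (2 * t * r\<^sup>2)) (at t)"
    by (rule DERIV_cong[OF DERIV_chain2[OF DERIV_exp DERIV_minus[OF r]]])
       (simp add: r_def q_def E_def)
  have "q * r = 1" using q by (simp add: r_def)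
  moreover have "q * r ^ (k + 2) = (q * r) * r ^ (k + 1)" "q\<^sup>2 * r ^ (k + 2) = (q * r)\<^sup>2 * r ^ k"
    by (simp_all add: power_mult_distrib power_add power2_eq_square)
  ultimately have q1: "q * r ^ (k + 2) = r ^ (k + 1)" and q2: "q\<^sup>2 * r ^ (k + 2) = r ^ k"
    by simp_all
  have "exp_bump (exp_bump_step pk) t = (poly (pderiv p) t * (q\<^sup>2 * r ^ (k + 2))
      + real k * (2 * t * poly p t * (q * r ^ (k + 2))) - 2 * t * poly p t * r ^ (k + 2)) * E"
  proof -
    have a: "poly [:1, 0, -1:] t = q" "poly [:0, 1:] t = t"
      by (simp_all add: q_def power2_eq_square)
    show ?thesis
      unfolding exp_bump_def exp_bump_step_def pk prod.case poly_add poly_diff poly_mult poly_power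
        poly_smult a if_P[OF True] q_def[symmetric] r_def[symmetric] E_def[symmetric]
      by (simp add: algebra_simps)
  qed
  then have step: "exp_bump (exp_bump_step pk) t = (poly (pderiv p) t * r ^ k
      + real k * (2 * t * poly p t * r ^ (k + 1)) - 2 * t * poly p t * r ^ (k + 2)) * E"
    by (simp only: q1 q2)
  have "((\<lambda>t. poly p t * inverse (1 - t\<^sup>2) ^ k * exp (- inverse (1 - t\<^sup>2)))
      has_real_derivative exp_bump (exp_bump_step pk) t) (at t)"
    by (rule DERIV_cong[OF DERIV_mult[OF DERIV_mult[OF poly_DERIV rk] E]], unfold step)
       (simp add: flip: q_def r_def E_def, simp add: algebra_simps power2_eq_square)
  moreover have "\<forall>\<^sub>F s in nhds t. poly p s * inverse (1 - s\<^sup>2) ^ k * exp (- inverse (1 - s\<^sup>2))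
      = exp_bump pk s"
  proof -
    have "open {s::real. \<bar>s\<bar> < 1}" by (intro open_Collect_less continuous_intros)
    then have "\<forall>\<^sub>F s in nhds t. \<bar>s\<bar> < 1" using True eventually_nhds by blast
    then show ?thesis by eventually_elim (simp add: exp_bump_def pk)
  qed
  ultimately show ?thesis by (rule DERIV_cong_ev[OF refl _ refl, THEN iffD1, rotated])
next
  case False
  then obtain C where "\<And>s. \<bar>exp_bump pk s\<bar> \<le> C * (s - t)\<^sup>2"
    using exp_bump_quadratic[of t] by (metis not_le)
  then have "(exp_bump pk has_real_derivative 0) (at t)" by (rule DERIV_zero_if_quadratic)
  moreover have "exp_bump (exp_bump_step pk) t = 0"
    using False by (simp add: exp_bump_def split: prod.split)
  ultimately show ?thesis by simp
qed

lemma ex_bump: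
  obtains b where "derivative_chain b" "\<And>t. 0 \<le> b 0 t" "0 < b 0 0"
    "\<And>n t. 1 \<le> \<bar>t\<bar> \<Longrightarrow> b n t = 0"
proof
  let ?b = "\<lambda>n. exp_bump ((exp_bump_step ^^ n) ([:1:], 0))"
  show "derivative_chain ?b" by (simp add: derivative_chain_def exp_bump_DERIV)
  show "0 \<le> ?b 0 t" for t by (simp add: exp_bump_def)
  show "0 < ?b 0 0" by (simp add: exp_bump_def)
  show "?b n t = 0" if "1 \<le> \<bar>t\<bar>" for n t using that by (simp add: exp_bump_def split: prod.split)
qed

text \<open>For continuous \<open>c\<close> and \<open>0 < R\<close>, a primitive of \<open>c - c(\<cdot> - R)\<close>. For \<open>c\<close> with compact support it again has compact support, and to
  the left of the support of \<open>c(\<cdot> - R)\<close> it is a primitive of \<open>c\<close>.\<close>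
definition window_integral :: "real \<Rightarrow> (real \<Rightarrow> real) \<Rightarrow> real \<Rightarrow> real" where
  "window_integral R c t = integral {t - R..t} c"

lemma window_integral_DERIV:
  assumes c: "continuous_on UNIV c" and "0 < R"
  shows "(window_integral R c has_real_derivative c t - c (t - R)) (at t)"
proof -
  define a where "a = t - R - 1"
  define I where "I = (\<lambda>u. integral {a..u} c)"
  have I: "(I has_real_derivative c u) (at u)" if "a < u" for u
  proof -
    have "(I has_real_derivative c u) (at u within {a..u + 1})"
      unfolding I_def using that
      by (intro integral_has_real_derivative continuous_on_subset[OF c]) auto
    then show ?thesis using that
      by (subst (asm) at_within_interior) (auto)
  qed
  have "((\<lambda>u. I u - I (u - R)) has_real_derivative c t - c (t - R)) (at t)"
  proof (rule DERIV_diff)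
    show "(I has_real_derivative c t) (at t)" using I assms by (simp add: a_def)
    show "((\<lambda>u. I (u - R)) has_real_derivative c (t - R)) (at t)"
      using DERIV_shift[of I "c (t - R)" t "- R"] I[of "t - R"] by (simp add: a_def)
  qed
  moreover have "\<forall>\<^sub>F u in nhds t. I u - I (u - R) = window_integral R c u"
  proof -
    have "\<forall>\<^sub>F u in nhds t. a + R < u"
      by (intro eventually_nhds_in_open[where s="{a + R<..}", simplified]) (auto simp: a_def)
    then show ?thesis
    proof eventually_elim
      case (elim u)
      have "integral {a..u - R} c + integral {u - R..u} c = integral {a..u} c"
        using elim assms
        by (intro Henstock_Kurzweil_Integration.integral_combine integrable_continuous_interval
            continuous_on_subset[OF c]) auto
      then show ?case by (simp add: I_def window_integral_def)
    qed
  qed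
  ultimately show ?thesis by (rule DERIV_cong_ev[OF refl _ refl, THEN iffD1, rotated])
qed

lemma window_integral_le:
  assumes c: "continuous_on UNIV c" and "0 < R" and le: "\<And>u. u \<le> t \<Longrightarrow> \<bar>c u\<bar> \<le> M"
  shows "\<bar>window_integral R c t\<bar> \<le> R * M"
proof -
  have "norm (integral {t - R..t} c) \<le> M * (t - (t - R))"
    using assms by (intro integral_bound continuous_on_subset[OF c]) auto
  then show ?thesis by (simp add: window_integral_def mult.commute)
qed

lemma window_integral_le_support:
  assumes c: "continuous_on UNIV c" and "0 < \<delta>" and le: "\<And>u. \<bar>c u\<bar> \<le> M"
    and supp: "\<And>u. \<delta> \<le> \<bar>u\<bar> \<Longrightarrow> c u = 0"
  shows "\<bar>window_integral R c t\<bar> \<le> 2 * \<delta> * M"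
proof -
  have M: "0 \<le> M" using le[of 0] by simp
  define lo hi where "lo = max (t - R) (- \<delta>)" and "hi = min t \<delta>"
  have "integral {t - R..t} c = integral {lo..hi} c"
  proof (rule integral_spike_set)
    have "\<bar>x\<bar> < \<delta>" if "c x \<noteq> 0" for x using supp[of x] that by force
    then have e: "{x \<in> {t - R..t} - {lo..hi}. c x \<noteq> 0} = {}" "{x \<in> {lo..hi} - {t - R..t}. c x \<noteq> 0} = {}"
      by (fastforce simp: lo_def hi_def)+
    then show "negligible {x \<in> {t - R..t} - {lo..hi}. c x \<noteq> 0}"
      "negligible {x \<in> {lo..hi} - {t - R..t}. c x \<noteq> 0}"
      unfolding e by simp_all
  qed
  moreover have "norm (integral {lo..hi} c) \<le> 2 * \<delta> * M"
  proof (cases "lo \<le> hi")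
    case True
    have "norm (integral {lo..hi} c) \<le> M * (hi - lo)"
      using True le by (intro integral_bound continuous_on_subset[OF c]) auto
    also have "\<dots> \<le> M * (2 * \<delta>)"
      using M \<open>0 < \<delta>\<close> by (intro mult_left_mono) (auto simp: lo_def hi_def)
    finally show ?thesis by (simp add: mult_ac)
  next
    case False
    then show ?thesis using M \<open>0 < \<delta>\<close> by simp
  qed
  ultimately show ?thesis by (simp add: window_integral_def)
qed

text \<open>Iterating \<open>window_integral\<close> yields a compactly supported smooth \<open>E 0\<close> that is an \<open>l\<close>-fold
  primitive of \<open>\<beta> 0\<close> on \<open>{..R - 1}\<close>. The bounds on the derivatives of order less than \<open>l\<close> see \<open>\<beta>\<close>
  only through the bound \<open>S\<close> on its first integral, and so are insensitive to concentration of \<open>\<beta>\<close>.\<close>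
lemma ex_iterated_antiderivative:
  assumes \<beta>: "derivative_chain \<beta>" and "0 < R"
    and supp: "\<And>n t. 1 \<le> \<bar>t\<bar> \<Longrightarrow> \<beta> n t = 0"
    and S: "\<And>t. \<bar>window_integral R (\<beta> 0) t\<bar> \<le> S"
  shows "\<exists>E r. derivative_chain E \<and> (\<forall>n t. t \<le> - 1 \<or> r \<le> t \<longrightarrow> E n t = 0) \<and>
    (\<forall>n t. t \<le> R - 1 \<and> l \<le> n \<longrightarrow> E n t = \<beta> (n - l) t) \<and>
    (\<forall>n t. t \<le> R - 1 \<and> n < l \<longrightarrow> \<bar>E n t\<bar> \<le> R ^ (l - n - 1) * S)"
proof (induction l)
  case 0
  show ?case
  proof (intro exI conjI)
    show "derivative_chain \<beta>" by fact
    show "\<forall>n t. t \<le> - 1 \<or> 1 \<le> t \<longrightarrow> \<beta> n t = 0"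
      using supp by force
  qed auto
next
  case (Suc l)
  then obtain E r where E: "derivative_chain E"
    and r: "\<And>n t. t \<le> - 1 \<or> r \<le> t \<Longrightarrow> E n t = 0"
    and eq: "\<And>n t. t \<le> R - 1 \<Longrightarrow> l \<le> n \<Longrightarrow> E n t = \<beta> (n - l) t"
    and le: "\<And>n t. t \<le> R - 1 \<Longrightarrow> n < l \<Longrightarrow> \<bar>E n t\<bar> \<le> R ^ (l - n - 1) * S"
    by blast
  define E' where "E' n t = (case n of 0 \<Rightarrow> window_integral R (E 0) t
    | Suc n \<Rightarrow> E n t - E n (t - R))" for n t
  have contE: "continuous_on UNIV (E 0)" by (rule derivative_chain_continuous[OF E])
  have shift: "E' (Suc n) t = E n t" if "t \<le> R - 1" for n t
    using that r by (simp add: E'_def)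
  show ?case
  proof (intro exI conjI allI impI)
    show "derivative_chain E'"
      unfolding derivative_chain_def
    proof (intro allI)
      fix n t
      show "(E' n has_real_derivative E' (Suc n) t) (at t)"
      proof (cases n)
        case 0
        then show ?thesis
          using window_integral_DERIV[OF contE \<open>0 < R\<close>] by (simp add: E'_def[abs_def])
      next
        case (Suc k)
        have "((\<lambda>t. E k (t - R)) has_real_derivative E (Suc k) (t - R)) (at t)"
          using DERIV_shift[of "E k" "E (Suc k) (t - R)" t "- R"] derivative_chain_deriv[OF E]
          by simp
        from DERIV_diff[OF derivative_chain_deriv[OF E, of k] this]
        show ?thesis by (simp add: E'_def[abs_def] Suc)
      qed
    qed
  next
    fix n t assume t: "t \<le> - 1 \<or> max (r + R) (R - 1) \<le> t"
    have "E n t = 0" "E n (t - R) = 0" for n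
      using t r[of t n] r[of "t - R" n] \<open>0 < R\<close> by auto
    moreover have "integral {t - R..t} (E 0) = integral {t - R..t} (\<lambda>_. 0)"
      using t by (intro Henstock_Kurzweil_Integration.integral_cong r) auto
    ultimately show "E' n t = 0" by (simp add: E'_def window_integral_def split: nat.split)
  next
    fix n t assume "t \<le> R - 1 \<and> Suc l \<le> n"
    then show "E' n t = \<beta> (n - Suc l) t"
      using shift eq by (cases n) auto
  next
    fix n t assume a: "t \<le> R - 1 \<and> n < Suc l"
    show "\<bar>E' n t\<bar> \<le> R ^ (Suc l - n - 1) * S"
    proof (cases n)
      case (Suc k)
      then show ?thesis using shift le a by simp
    next
      case 0
      show ?thesis
      proof (cases l)
        case 0
        have "window_integral R (E 0) t = window_integral R (\<beta> 0) t"
          unfolding window_integral_def using a 0 eq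
          by (intro Henstock_Kurzweil_Integration.integral_cong) auto
        then show ?thesis using S 0 \<open>n = 0\<close> by (simp add: E'_def)
      next
        case (Suc k)
        have "\<bar>window_integral R (E 0) t\<bar> \<le> R * (R ^ (l - 0 - 1) * S)"
          using a Suc by (intro window_integral_le[OF contE \<open>0 < R\<close>] le) auto
        then show ?thesis using Suc \<open>n = 0\<close> by (simp add: E'_def mult.assoc)
      qed
    qed
  qed
qed

section \<open>Test functions and convolutions\<close>

lemma uniformly_continuous_bounded_support:
  fixes f :: "'a::euclidean_space \<Rightarrow> 'b::real_normed_vector"
  assumes f: "continuous_on UNIV f" and supp: "\<And>x. r \<le> norm x \<Longrightarrow> f x = 0"
  shows "uniformly_continuous_on UNIV f" and "bounded (range f)"
proof -
  have "compact (f ` cball 0 r)"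
    by (intro compact_continuous_image continuous_on_subset[OF f]) auto
  moreover have "range f \<subseteq> insert 0 (f ` cball 0 r)"
    using supp by (force simp: not_le)
  ultimately show "bounded (range f)"
    by (meson bounded_insert bounded_subset compact_imp_bounded)
  have u: "uniformly_continuous_on (cball 0 (r + 1)) f"
    by (intro compact_uniformly_continuous continuous_on_subset[OF f]) auto
  show "uniformly_continuous_on UNIV f"
    unfolding uniformly_continuous_on_def
  proof (intro allI impI)
    fix e :: real assume "0 < e"
    then obtain d where d: "0 < d"
      "\<And>x y. x \<in> cball 0 (r + 1) \<Longrightarrow> y \<in> cball 0 (r + 1) \<Longrightarrow> dist y x < d \<Longrightarrow> dist (f y) (f x) < e"
      using u unfolding uniformly_continuous_on_def by metis
    show "\<exists>d>0. \<forall>x\<in>UNIV. \<forall>y\<in>UNIV. dist y x < d \<longrightarrow> dist (f y) (f x) < e"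
    proof (intro exI[of _ "min d 1"] conjI ballI impI)
      fix x y :: 'a assume xy: "dist y x < min d 1"
      have n: "norm x \<le> norm y + dist y x" "norm y \<le> norm x + dist y x"
        using norm_triangle_ineq2[of x y] norm_triangle_ineq2[of y x]
        by (auto simp: dist_norm norm_minus_commute)
      show "dist (f y) (f x) < e"
      proof (cases "norm x < r \<or> norm y < r")
        case True
        then have "x \<in> cball 0 (r + 1)" "y \<in> cball 0 (r + 1)" using n xy by auto
        then show ?thesis using d(2) xy by simp
      next
        case False
        then show ?thesis using supp[of x] supp[of y] \<open>0 < e\<close> by auto
      qed
    qed (use d in auto)
  qed
qed

lemma integrable_mult_bounded:
  fixes a K :: "'a::euclidean_space \<Rightarrow> real"
  assumes a: "integrable lborel a" and K: "K \<in> borel_measurable borel" and B: "\<And>x. \<bar>K x\<bar> \<le> B"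
  shows "integrable lborel (\<lambda>x. a x * K x)"
proof (rule Bochner_Integration.integrable_bound)
  show "integrable lborel (\<lambda>x. \<bar>a x\<bar> * B)" using a by simp
  show "(\<lambda>x. a x * K x) \<in> borel_measurable lborel"
    using K a[THEN borel_measurable_integrable] by simp
  show "AE x in lborel. norm (a x * K x) \<le> norm (\<bar>a x\<bar> * B)"
    using order_trans[OF B abs_ge_self] by (intro AE_I2) (auto simp: abs_mult intro: mult_left_mono)
qed

lemma continuous_translate_measurable:
  fixes K :: "'a::euclidean_space \<Rightarrow> 'b::euclidean_space"
  assumes "continuous_on UNIV K"
  shows "(\<lambda>y. K (x - y)) \<in> borel_measurable borel"
  by (intro borel_measurable_continuous_onI continuous_on_compose2[OF assms] continuous_intros) auto

text \<open>Differentiation under the integral sign: nothing beyond integrability is required of \<open>a\<close>, since the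
  difference quotients of \<open>K\<close> converge uniformly.\<close>
lemma has_derivative_convolution:
  fixes a K :: "'a::euclidean_space \<Rightarrow> real" and k :: "'a \<Rightarrow> 'a"
  assumes a: "integrable lborel a"
    and K: "\<And>z. (K has_derivative (\<lambda>h. k z \<bullet> h)) (at z)"
    and k: "uniformly_continuous_on UNIV k" and bK: "bounded (range K)" and bk: "bounded (range k)"
  shows "((\<lambda>x. \<integral>y. a y * K (x - y) \<partial>lborel) has_derivative
          (\<lambda>h. \<integral>y. a y * (k (x - y) \<bullet> h) \<partial>lborel)) (at x)"
proof -
  obtain BK where BK: "\<And>z. \<bar>K z\<bar> \<le> BK"
    using bK by (auto simp: bounded_iff)
  obtain Bk where Bk: "\<And>z. norm (k z) \<le> Bk"
    using bk by (auto simp: bounded_iff)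
  have contK: "continuous_on UNIV K"
    using K by (meson continuous_at_imp_continuous_on has_derivative_continuous)
  have contk: "continuous_on UNIV k" by (rule uniformly_continuous_imp_continuous[OF k])
  have iK: "integrable lborel (\<lambda>y. a y * K (x - y))" for x
    by (rule integrable_mult_bounded[OF a continuous_translate_measurable[OF contK]]) (rule BK)
  have ik: "integrable lborel (\<lambda>y. a y * (k (x - y) \<bullet> h))" for x h
  proof (rule integrable_mult_bounded[OF a])
    show "(\<lambda>y. k (x - y) \<bullet> h) \<in> borel_measurable borel"
      using continuous_translate_measurable[OF contk] by measurable
    show "\<bar>k (x - y) \<bullet> h\<bar> \<le> Bk * norm h" for y
      using Cauchy_Schwarz_ineq2 Bk by (meson mult_right_mono norm_ge_zero order_trans)
  qed
  define A where "A = (\<integral>y. \<bar>a y\<bar> \<partial>lborel)"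
  have A: "0 \<le> A" by (simp add: A_def)
  show ?thesis
    unfolding has_derivative_at_alt
  proof (intro conjI allI impI)
    show "bounded_linear (\<lambda>h. \<integral>y. a y * (k (x - y) \<bullet> h) \<partial>lborel)"
    proof (rule bounded_linear_intro)
      show "(\<integral>y. a y * (k (x - y) \<bullet> (h + h')) \<partial>lborel) =
        (\<integral>y. a y * (k (x - y) \<bullet> h) \<partial>lborel) + (\<integral>y. a y * (k (x - y) \<bullet> h') \<partial>lborel)" for h h'
        by (simp add: inner_add_right distrib_left ik)
      show "(\<integral>y. a y * (k (x - y) \<bullet> (s *\<^sub>R h)) \<partial>lborel) = s *\<^sub>R (\<integral>y. a y * (k (x - y) \<bullet> h) \<partial>lborel)"
        for s h
        by (simp add: mult.left_commute)
      show "norm (\<integral>y. a y * (k (x - y) \<bullet> h) \<partial>lborel) \<le> norm h * (Bk * A)" for h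
      proof -
        have "norm (\<integral>y. a y * (k (x - y) \<bullet> h) \<partial>lborel) \<le> (\<integral>y. \<bar>a y\<bar> * (Bk * norm h) \<partial>lborel)"
        proof (rule Bochner_Integration.integral_norm_bound_integral)
          show "integrable lborel (\<lambda>y. \<bar>a y\<bar> * (Bk * norm h))" using a by simp
          show "norm (a y * (k (x - y) \<bullet> h)) \<le> \<bar>a y\<bar> * (Bk * norm h)" for y
            unfolding real_norm_def abs_mult using Cauchy_Schwarz_ineq2 Bk
            by (meson mult_left_mono abs_ge_zero mult_right_mono norm_ge_zero order_trans)
        qed (rule ik)
        then show ?thesis by (simp add: A_def mult_ac)
      qed
    qed
  next
    fix e :: real assume "0 < e"
    define e' where "e' = e / (A + 1)"
    have e': "0 < e'" using \<open>0 < e\<close> A by (simp add: e'_def)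
    obtain d where "0 < d" and d: "\<And>z w. dist w z < d \<Longrightarrow> dist (k w) (k z) < e'"
      using k e' unfolding uniformly_continuous_on_def by (metis UNIV_I)
    show "\<exists>d>0. \<forall>y. norm (y - x) < d \<longrightarrow> norm ((\<integral>ya. a ya * K (y - ya) \<partial>lborel)
        - (\<integral>y. a y * K (x - y) \<partial>lborel) - (\<integral>ya. a ya * (k (x - ya) \<bullet> (y - x)) \<partial>lborel))
        \<le> e * norm (y - x)"
    proof (intro exI[of _ d] conjI allI impI)
      fix x' assume x': "norm (x' - x) < d"
      have lin: "\<bar>K (x' - y) - K (x - y) - k (x - y) \<bullet> (x' - x)\<bar> \<le> norm (x' - x) * e'" for y
      proof -
        let ?S = "ball (x - y) d"
        have "norm (K (x' - y) - K (x - y) - k (x - y) \<bullet> ((x' - y) - (x - y)))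
            \<le> norm ((x' - y) - (x - y)) * e'"
        proof (rule differentiable_bound_linearization[where S="?S" and f'="\<lambda>z h. k z \<bullet> h"])
          show "(x - y) + t *\<^sub>R ((x' - y) - (x - y)) \<in> ?S" if "t \<in> {0..1}" for t
          proof -
            have "t * norm (x' - x) \<le> 1 * norm (x' - x)" using that by (intro mult_right_mono) auto
            then show ?thesis using x' that by (simp add: dist_norm)
          qed
          show "(K has_derivative (\<lambda>h. k z \<bullet> h)) (at z within ?S)" for z
            using K has_derivative_at_withinI by blast
          show "onorm ((\<bullet>) (k z) - (\<bullet>) (k (x - y))) \<le> e'" if "z \<in> ?S" for z
          proof (rule onorm_bound)
            fix h
            have "norm (((\<bullet>) (k z) - (\<bullet>) (k (x - y))) h) = \<bar>(k z - k (x - y)) \<bullet> h\<bar>"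
              by (simp add: inner_diff_left)
            also have "\<dots> \<le> norm (k z - k (x - y)) * norm h" by (rule Cauchy_Schwarz_ineq2)
            also have "\<dots> \<le> e' * norm h"
              using d[of z "x - y"] that
              by (intro mult_right_mono) (auto simp: dist_norm norm_minus_commute)
            finally show "norm (((\<bullet>) (k z) - (\<bullet>) (k (x - y))) h) \<le> e' * norm h" .
          qed (use e' in simp)
        qed (use \<open>0 < d\<close> in simp)
        then show ?thesis by simp
      qed
      have "(\<integral>ya. a ya * K (x' - ya) \<partial>lborel) - (\<integral>y. a y * K (x - y) \<partial>lborel)
          - (\<integral>ya. a ya * (k (x - ya) \<bullet> (x' - x)) \<partial>lborel)
          = (\<integral>y. a y * (K (x' - y) - K (x - y) - k (x - y) \<bullet> (x' - x)) \<partial>lborel)"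
        using iK[of x'] iK[of x] ik[of x "x' - x"] by (simp add: right_diff_distrib)
      also have "norm \<dots> \<le> (\<integral>y. \<bar>a y\<bar> * (norm (x' - x) * e') \<partial>lborel)"
      proof (rule Bochner_Integration.integral_norm_bound_integral)
        show "integrable lborel (\<lambda>y. a y * (K (x' - y) - K (x - y) - k (x - y) \<bullet> (x' - x)))"
          using iK[of x'] iK[of x] ik[of x "x' - x"] by (simp add: right_diff_distrib)
        show "integrable lborel (\<lambda>y. \<bar>a y\<bar> * (norm (x' - x) * e'))" using a by simp
        show "norm (a y * (K (x' - y) - K (x - y) - k (x - y) \<bullet> (x' - x)))
            \<le> \<bar>a y\<bar> * (norm (x' - x) * e')" for y
          unfolding real_norm_def abs_mult by (intro mult_left_mono lin) auto
      qed
      also have "\<dots> = (A * e') * norm (x' - x)" by (simp add: A_def mult_ac)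
      also have "\<dots> \<le> e * norm (x' - x)"
        using A \<open>0 < e\<close> by (intro mult_right_mono) (auto simp: e'_def divide_simps)
      finally show "norm ((\<integral>ya. a ya * K (x' - ya) \<partial>lborel) - (\<integral>y. a y * K (x - y) \<partial>lborel)
          - (\<integral>ya. a ya * (k (x - ya) \<bullet> (x' - x)) \<partial>lborel)) \<le> e * norm (x' - x)" .
    qed fact
  qed
qed

lemma test_function_has_derivative:
  fixes \<phi> :: "real ^ 'd::finite \<Rightarrow> 'a::real_normed_vector"
  assumes "\<phi> \<in> test_functions U"
  shows "(\<phi> has_derivative (\<lambda>h. \<Sum>i\<in>UNIV. (h $ i) *\<^sub>R partial i \<phi> x)) (at x)"
proof -
  have "iter_partial [] \<phi> differentiable (at x)"
    using assms unfolding test_functions_def by blast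
  then have d: "(\<phi> has_derivative frechet_derivative \<phi> (at x)) (at x)"
    by (simp add: iter_partial_def frechet_derivative_works)
  then interpret bounded_linear "frechet_derivative \<phi> (at x)" by (rule has_derivative_bounded_linear)
  have "frechet_derivative \<phi> (at x) = (\<lambda>h. \<Sum>i\<in>UNIV. (h $ i) *\<^sub>R partial i \<phi> x)"
  proof
    fix h
    have "frechet_derivative \<phi> (at x) h
        = frechet_derivative \<phi> (at x) (\<Sum>i\<in>UNIV. (h $ i) *\<^sub>R axis i 1)"
      by (simp add: basis_expansion flip: scalar_mult_eq_scaleR)
    then show "frechet_derivative \<phi> (at x) h = (\<Sum>i\<in>UNIV. (h $ i) *\<^sub>R partial i \<phi> x)"
      by (simp add: sum scaleR partial_def)
  qed
  then show ?thesis using d by simp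
qed

lemma test_function_continuous:
  "\<phi> \<in> test_functions U \<Longrightarrow> continuous_on S \<phi>"
  by (meson continuous_at_imp_continuous_on has_derivative_continuous test_function_has_derivative)

lemma test_function_partial:
  fixes \<phi> :: "real ^ 'd::finite \<Rightarrow> 'a::real_normed_vector"
  assumes "\<phi> \<in> test_functions U"
  shows "partial i \<phi> \<in> test_functions U"
proof -
  let ?S = "closure {x. \<phi> x \<noteq> 0}"
  have "partial i \<phi> x = 0" if "x \<notin> ?S" for x
  proof -
    have "(\<phi> has_derivative (\<lambda>_. 0)) (at x)"
      by (rule has_derivative_transform_within_open[of "\<lambda>_. 0" _ _ UNIV "- ?S"])
         (use that closure_subset[of "{x. \<phi> x \<noteq> 0}"] in auto)
    then show ?thesis by (simp add: partial_def frechet_derivative_at[symmetric])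
  qed
  then have "{x. partial i \<phi> x \<noteq> 0} \<subseteq> ?S" by blast
  then have "closure {x. partial i \<phi> x \<noteq> 0} \<subseteq> ?S" by (simp add: closure_minimal)
  moreover have "iter_partial is (partial i \<phi>) = iter_partial (is @ [i]) \<phi>" for "is"
    by (simp add: iter_partial_def)
  ultimately show ?thesis
    using assms unfolding test_functions_def
    by (auto intro: bounded_subset simp: compact_eq_bounded_closed)
qed

lemma test_function_iter_partial:
  "\<phi> \<in> test_functions U \<Longrightarrow> iter_partial is \<phi> \<in> test_functions U"
  by (induction "is") (simp_all add: iter_partial_def test_function_partial)

lemma test_function_support:
  fixes \<phi> :: "real ^ 'd::finite \<Rightarrow> 'a::real_normed_vector"
  assumes "\<phi> \<in> test_functions U"
  obtains r where "0 < r" "\<And>x. r \<le> norm x \<Longrightarrow> \<phi> x = 0"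
proof -
  have "bounded (closure {x. \<phi> x \<noteq> 0})"
    using assms by (auto simp: test_functions_def compact_imp_bounded)
  then have "bounded {x. \<phi> x \<noteq> 0}" using bounded_subset closure_subset by blast
  then obtain r where "0 < r" "\<And>x. \<phi> x \<noteq> 0 \<Longrightarrow> norm x \<le> r"
    by (auto simp: bounded_pos)
  then show thesis by (intro that[of "r + 1"]) force+
qed

text \<open>The gradient, as the vector of the partial derivatives.\<close>
definition gradient :: "(real ^ 'd::finite \<Rightarrow> real) \<Rightarrow> real ^ 'd \<Rightarrow> real ^ 'd" where
  "gradient \<phi> x = (\<chi> i. partial i \<phi> x)"

lemma inner_gradient: "gradient \<phi> x \<bullet> h = (\<Sum>i\<in>UNIV. h $ i * partial i \<phi> x)"
  by (simp add: gradient_def inner_vec_def mult.commute)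

lemma test_function_gradient:
  fixes \<phi> :: "real ^ 'd::finite \<Rightarrow> real"
  assumes \<phi>: "\<phi> \<in> test_functions U"
  shows "(\<phi> has_derivative (\<lambda>h. gradient \<phi> x \<bullet> h)) (at x)"
    and "bounded (range \<phi>)" and "uniformly_continuous_on UNIV (gradient \<phi>)"
    and "bounded (range (gradient \<phi>))"
proof -
  show "(\<phi> has_derivative (\<lambda>h. gradient \<phi> x \<bullet> h)) (at x)"
    using test_function_has_derivative[OF \<phi>] by (simp add: inner_gradient)
  obtain r where r: "\<And>x. r \<le> norm x \<Longrightarrow> \<phi> x = 0" using test_function_support[OF \<phi>] by metis
  show "bounded (range \<phi>)"
    by (rule uniformly_continuous_bounded_support[OF test_function_continuous[OF \<phi>] r])
  have c: "continuous_on UNIV (gradient \<phi>)"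
    unfolding gradient_def
    by (intro continuous_on_vec_lambda test_function_continuous[OF test_function_partial[OF \<phi>]])
  have "\<exists>r. \<forall>x. r \<le> norm x \<longrightarrow> partial i \<phi> x = 0" for i
    using test_function_support[OF test_function_partial[OF \<phi>]] by metis
  then obtain R where R: "\<And>i x. R i \<le> norm x \<Longrightarrow> partial i \<phi> x = 0" by metis
  have z: "gradient \<phi> x = 0" if "Max (range R) \<le> norm x" for x
    using that R by (auto simp: gradient_def vec_eq_iff)
  show "uniformly_continuous_on UNIV (gradient \<phi>)" "bounded (range (gradient \<phi>))"
    by (rule uniformly_continuous_bounded_support[OF c z]; assumption)+
qed

lemma test_function_integrable:
  fixes \<phi> :: "real ^ 'd::finite \<Rightarrow> real"
  assumes \<phi>: "\<phi> \<in> test_functions U"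
  shows "integrable lborel \<phi>"
proof -
  obtain r where r: "\<And>x. r \<le> norm x \<Longrightarrow> \<phi> x = 0" using test_function_support[OF \<phi>] by metis
  have "integrable lborel (\<lambda>x. indicator (cball 0 r) x *\<^sub>R \<phi> x)"
    by (intro borel_integrable_compact test_function_continuous[OF \<phi>]) auto
  also have "(\<lambda>x. indicator (cball 0 r) x *\<^sub>R \<phi> x) = \<phi>"
    using r by (intro ext) (auto simp: indicator_def not_le)
  finally show ?thesis .
qed

lemma integral_translate:
  fixes f :: "'a::euclidean_space \<Rightarrow> real"
  assumes "f \<in> borel_measurable borel"
  shows "(\<integral>x. f (c + x) \<partial>lborel) = (\<integral>x. f x \<partial>lborel)"
proof -
  have "(\<integral>x. f x \<partial>lborel) = (\<integral>x. f x \<partial>distr lborel borel ((+) c))" by (simp add: lborel_distr_plus)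
  also have "\<dots> = (\<integral>x. f (c + x) \<partial>lborel)"
    using assms by (subst integral_distr) auto
  finally show ?thesis by simp
qed

lemma test_function_convolution:
  fixes \<psi> :: "real ^ 'd::finite \<Rightarrow> real"
  assumes a: "integrable lborel a" and \<psi>: "\<psi> \<in> test_functions U"
  shows "((\<lambda>t. \<integral>x. a x * \<psi> (x - t *\<^sub>R z) \<partial>lborel) has_real_derivative
     (- (\<integral>x. a x * (gradient \<psi> (x - t *\<^sub>R z) \<bullet> z) \<partial>lborel))) (at t)"
proof -
  let ?K = "\<lambda>w. \<psi> (- w)" and ?k = "\<lambda>w. - gradient \<psi> (- w)"
  have K: "(?K has_derivative (\<lambda>h. ?k w \<bullet> h)) (at w)" for w
    using has_derivative_compose[OF has_derivative_minus[OF has_derivative_ident]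
        test_function_gradient(1)[OF \<psi>], of w UNIV]
    by simp
  have k: "uniformly_continuous_on UNIV ?k"
  proof -
    have "\<exists>d>0. \<forall>x y. dist y x < d \<longrightarrow> dist (- gradient \<psi> (- y)) (- gradient \<psi> (- x)) < e" if "0 < e" for e
    proof -
      obtain d where "0 < d" "\<And>x y. dist y x < d \<Longrightarrow> dist (gradient \<psi> y) (gradient \<psi> x) < e"
        using test_function_gradient(3)[OF \<psi>] \<open>0 < e\<close> unfolding uniformly_continuous_on_def
        by (metis UNIV_I)
      then show ?thesis by (intro exI[of _ d]) (simp add: dist_minus)
    qed
    then show ?thesis unfolding uniformly_continuous_on_def by simp
  qed
  have bK: "bounded (range ?K)"
    by (rule bounded_subset[OF test_function_gradient(2)[OF \<psi>]]) auto
  have bk: "bounded (range ?k)"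
    using test_function_gradient(4)[OF \<psi>] unfolding bounded_iff by auto
  have "((\<lambda>w. \<integral>y. a y * ?K (w - y) \<partial>lborel) has_derivative
      (\<lambda>h. \<integral>y. a y * (?k (t *\<^sub>R z - y) \<bullet> h) \<partial>lborel)) (at (t *\<^sub>R z))"
    by (rule has_derivative_convolution[OF a K k bK bk])
  moreover have "((\<lambda>t. t *\<^sub>R z) has_derivative (\<lambda>s. s *\<^sub>R z)) (at t)"
    by (auto intro!: derivative_eq_intros)
  ultimately have "((\<lambda>t. \<integral>y. a y * ?K (t *\<^sub>R z - y) \<partial>lborel) has_derivative
      (\<lambda>s. \<integral>y. a y * (?k (t *\<^sub>R z - y) \<bullet> (s *\<^sub>R z)) \<partial>lborel)) (at t)"
    using has_derivative_compose by blast
  moreover have "(\<lambda>s. \<integral>y. a y * (?k (t *\<^sub>R z - y) \<bullet> (s *\<^sub>R z)) \<partial>lborel)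
      = (*) (- (\<integral>x. a x * (gradient \<psi> (x - t *\<^sub>R z) \<bullet> z) \<partial>lborel))"
    by (intro ext) (simp add: mult.left_commute)
  ultimately show ?thesis by (simp add: has_field_derivative_def)
qed

text \<open>The integral of a translate of \<open>\<phi>\<close> does not depend on the translation; differentiate in the
  translation parameter.\<close>
lemma integral_partial_test_function:
  fixes \<phi> :: "real ^ 'd::finite \<Rightarrow> real"
  assumes \<phi>: "\<phi> \<in> test_functions U"
  shows "(\<integral>x. partial i \<phi> x \<partial>lborel) = 0"
proof -
  obtain r where r: "0 < r" "\<And>x. r \<le> norm x \<Longrightarrow> \<phi> x = 0" using test_function_support[OF \<phi>] by metis
  obtain r' where r': "\<And>x. r' \<le> norm x \<Longrightarrow> partial i \<phi> x = 0"
    using test_function_support[OF test_function_partial[OF \<phi>]] by metis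
  \<comment> \<open>The indicator is \<open>1\<close> on the supports of \<open>partial i \<phi>\<close> and of all translates of \<open>\<phi>\<close> by at most \<open>1\<close>.\<close>
  define a where "a = (indicator (cball 0 (max (r + 1) r')) :: real ^ 'd \<Rightarrow> real)"
  have a: "integrable lborel a"
    unfolding a_def by (rule integrable_real_indicator) (simp_all add: emeasure_bounded_finite[unfolded infinity_ennreal_def])
  have D: "((\<lambda>t. \<integral>x. a x * \<phi> (x - t *\<^sub>R axis i 1) \<partial>lborel) has_real_derivative
     (- (\<integral>x. a x * (gradient \<phi> (x - 0 *\<^sub>R axis i 1) \<bullet> axis i 1) \<partial>lborel))) (at 0)"
    by (rule test_function_convolution[OF a \<phi>])
  have const: "(\<integral>x. a x * \<phi> (x - t *\<^sub>R axis i 1) \<partial>lborel) = (\<integral>x. \<phi> x \<partial>lborel)" if "\<bar>t\<bar> \<le> 1" for t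
  proof -
    have "a x * \<phi> (x - t *\<^sub>R axis i 1) = \<phi> (- (t *\<^sub>R axis i 1) + x)" for x
    proof (cases "norm x \<le> r + 1")
      case False
      have "norm (x - t *\<^sub>R axis i 1) \<ge> norm x - norm (t *\<^sub>R axis i 1 :: real ^ 'd)"
        by (rule norm_triangle_ineq2)
      then have "r \<le> norm (x - t *\<^sub>R axis i 1)" using False that by simp
      then show ?thesis using r by simp
    qed (auto simp: a_def indicator_def le_max_iff_disj)
    then show ?thesis
      by (simp only: integral_translate[OF borel_measurable_continuous_onI[OF test_function_continuous[OF \<phi>]]])
  qed
  have "((\<lambda>t. \<integral>x. a x * \<phi> (x - t *\<^sub>R axis i 1) \<partial>lborel) has_real_derivative 0) (at 0)"
  proof (subst DERIV_cong_ev[OF refl _ refl])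
    have "\<forall>\<^sub>F t in nhds 0. t \<in> {- 1<..<1::real}" by (intro eventually_nhds_in_open) auto
    then show "\<forall>\<^sub>F t in nhds 0. (\<integral>x. a x * \<phi> (x - t *\<^sub>R axis i 1) \<partial>lborel) = (\<integral>x. \<phi> x \<partial>lborel)"
      by eventually_elim (use const in auto)
  qed simp
  from DERIV_unique[OF D this]
  have "(\<integral>x. a x * (gradient \<phi> x \<bullet> axis i 1) \<partial>lborel) = 0" by simp
  also have "(\<lambda>x. a x * (gradient \<phi> x \<bullet> axis i 1)) = partial i \<phi>"
    using r' by (intro ext) (auto simp: a_def indicator_def gradient_def inner_axis not_le le_max_iff_disj)
  finally show ?thesis .
qed

lemma integral_iter_partial_test_function:
  fixes \<phi> :: "real ^ 'd::finite \<Rightarrow> real"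
  assumes "\<phi> \<in> test_functions U" and "is \<noteq> []"
  shows "(\<integral>x. iter_partial is \<phi> x \<partial>lborel) = 0"
proof (cases "is")
  case (Cons i js)
  then show ?thesis
    using integral_partial_test_function[OF test_function_iter_partial[OF assms(1)]]
    by (simp add: iter_partial_def)
qed (use assms in simp)

section \<open>Tensor product kernels and mollification\<close>

lemma abs_integral_le:
  fixes f g :: "'a \<Rightarrow> real"
  assumes "integrable M f" "integrable M g" "\<And>x. \<bar>f x\<bar> \<le> g x"
  shows "\<bar>\<integral>x. f x \<partial>M\<bar> \<le> (\<integral>x. g x \<partial>M)"
  using assms by (intro order_trans[OF integral_abs_bound] integral_mono) auto

lemma integrable_bounded_support:
  fixes a :: "'a::euclidean_space \<Rightarrow> real"
  assumes a: "a \<in> borel_measurable borel" "\<And>x. \<bar>a x\<bar> \<le> B" and S: "bounded S" "\<And>x. x \<notin> S \<Longrightarrow> a x = 0"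
  shows "integrable lborel a"
proof -
  obtain c r where "S \<subseteq> cball c r" using S(1) bounded_subset_cball by blast
  show ?thesis
  proof (rule integrableI_bounded_set[where A="cball c r" and B=B])
    show "emeasure lborel (cball c r) < \<infinity>" by (simp add: emeasure_bounded_finite[unfolded infinity_ennreal_def])
    show "AE x in lborel. x \<notin> cball c r \<longrightarrow> a x = 0"
      using \<open>S \<subseteq> cball c r\<close> S(2) by (intro AE_I2) blast
  qed (use a in auto)
qed

text \<open>The derivative of multi-order \<open>n\<close> of the product kernel \<open>\<Prod>i. D i 0 (z $ i)\<close>, and its convolution
  with \<open>a\<close>.\<close>
definition tensor_kernel ::
  "('d::finite \<Rightarrow> nat \<Rightarrow> real \<Rightarrow> real) \<Rightarrow> ('d \<Rightarrow> nat) \<Rightarrow> real ^ 'd \<Rightarrow> real" where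
  "tensor_kernel D n z = (\<Prod>i\<in>UNIV. D i (n i) (z $ i))"

definition tensor_conv ::
  "(real ^ 'd::finite \<Rightarrow> real) \<Rightarrow> ('d \<Rightarrow> nat \<Rightarrow> real \<Rightarrow> real) \<Rightarrow> ('d \<Rightarrow> nat) \<Rightarrow> real ^ 'd \<Rightarrow> real" where
  "tensor_conv a D n x = (\<integral>y. a y * tensor_kernel D n (x - y) \<partial>lborel)"

lemma tensor_kernel_has_derivative:
  assumes "\<And>i. derivative_chain (D i)"
  shows "(tensor_kernel D n has_derivative
    (\<lambda>h. (\<chi> j. tensor_kernel D (n(j := Suc (n j))) z) \<bullet> h)) (at z)"
proof -
  have eq: "tensor_kernel D n = (\<lambda>z. \<Prod>i\<in>UNIV. D i (n i) (z $ i))"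
    by (simp add: tensor_kernel_def[abs_def])
  have "((\<lambda>z. D i (n i) (z $ i)) has_derivative (\<lambda>h. D i (Suc (n i)) (z $ i) * h $ i)) (at z)" for i
    using has_derivative_compose[OF bounded_linear_imp_has_derivative[OF bounded_linear_vec_nth[of i]]
        derivative_chain_deriv[OF assms[of i], of "n i" "z $ i", unfolded has_field_derivative_def]]
    by simp
  then have "((\<lambda>z. \<Prod>i\<in>UNIV. D i (n i) (z $ i)) has_derivative
      (\<lambda>h. \<Sum>i\<in>UNIV. (D i (Suc (n i)) (z $ i) * h $ i) * (\<Prod>j\<in>UNIV - {i}. D j (n j) (z $ j)))) (at z)"
    by (intro has_derivative_prod)
  moreover have "(D i (Suc (n i)) (z $ i) * s) * (\<Prod>j\<in>UNIV - {i}. D j (n j) (z $ j))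
      = tensor_kernel D (n(i := Suc (n i))) z * s" for i s
    unfolding tensor_kernel_def
    by (subst prod.remove[where x=i]) (auto intro!: prod.cong)
  ultimately show ?thesis
    by (simp add: eq inner_vec_def)
qed

lemma norm_ge_imp_component_ge:
  fixes z :: "real ^ 'd::finite"
  assumes "real CARD('d) * \<rho> \<le> norm z"
  shows "\<exists>i. \<rho> \<le> \<bar>z $ i\<bar>"
proof (rule ccontr)
  assume "\<nexists>i. \<rho> \<le> \<bar>z $ i\<bar>"
  then have "(\<Sum>i\<in>UNIV. \<bar>z $ i\<bar>) < (\<Sum>i\<in>(UNIV :: 'd set). \<rho>)"
    by (intro sum_strict_mono) (auto simp: not_le)
  then show False using norm_le_l1_cart[of z] assms by simp
qed

lemma tensor_kernel_eq_0:
  "(\<And>t. \<rho> \<le> \<bar>t\<bar> \<Longrightarrow> D i (n i) t = 0) \<Longrightarrow> \<rho> \<le> \<bar>z $ i\<bar> \<Longrightarrow> tensor_kernel D n z = 0"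
  unfolding tensor_kernel_def by (rule prod_zero) auto

context
  fixes D :: "'d::finite \<Rightarrow> nat \<Rightarrow> real \<Rightarrow> real" and \<rho> :: real
  assumes chain: "\<And>i. derivative_chain (D i)" and supp: "\<And>i n t. \<rho> \<le> \<bar>t\<bar> \<Longrightarrow> D i n t = 0"
begin

lemma tensor_kernel_support: "real CARD('d) * \<rho> \<le> norm z \<Longrightarrow> tensor_kernel D n z = 0"
  by (metis norm_ge_imp_component_ge tensor_kernel_eq_0 supp)

lemma continuous_tensor_kernel: "continuous_on S (tensor_kernel D n)"
  by (rule continuous_at_imp_continuous_on, rule ballI, rule has_derivative_continuous,
      rule tensor_kernel_has_derivative, rule chain)

lemma bounded_tensor_kernel: "bounded (range (tensor_kernel D n))"
  by (rule uniformly_continuous_bounded_support[OF continuous_tensor_kernel tensor_kernel_support])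

lemma integrable_tensor_kernel: "integrable lborel (tensor_kernel D n)"
proof -
  let ?C = "cball 0 (real CARD('d) * \<rho>) :: (real ^ 'd) set"
  have "integrable lborel (\<lambda>x. indicator ?C x *\<^sub>R tensor_kernel D n x)"
    by (intro borel_integrable_compact continuous_tensor_kernel) auto
  also have "(\<lambda>x. indicator ?C x *\<^sub>R tensor_kernel D n x) = tensor_kernel D n"
    using tensor_kernel_support by (intro ext) (auto simp: indicator_def not_le)
  finally show ?thesis .
qed

lemma tensor_conv_has_derivative:
  assumes a: "integrable lborel a"
  shows "(tensor_conv a D n has_derivative
    (\<lambda>h. \<integral>y. a y * ((\<chi> j. tensor_kernel D (n(j := Suc (n j))) (x - y)) \<bullet> h) \<partial>lborel)) (at x)"
proof -
  let ?k = "\<lambda>z. \<chi> j. tensor_kernel D (n(j := Suc (n j))) z"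
  have c: "continuous_on UNIV ?k"
    by (intro continuous_on_vec_lambda continuous_tensor_kernel)
  have z: "?k z = 0" if "real CARD('d) * \<rho> \<le> norm z" for z
    using that by (simp add: tensor_kernel_support vec_eq_iff)
  show ?thesis
    unfolding tensor_conv_def[abs_def]
    by (rule has_derivative_convolution[OF a tensor_kernel_has_derivative[OF chain] _
        bounded_tensor_kernel]) (rule uniformly_continuous_bounded_support[OF c z]; assumption)+
qed

lemma partial_tensor_conv:
  assumes "integrable lborel a"
  shows "partial j (tensor_conv a D n) = tensor_conv a D (n(j := Suc (n j)))"
  by (intro ext) (simp add: partial_def tensor_conv_def inner_axis
      frechet_derivative_at[OF tensor_conv_has_derivative[OF assms], symmetric])

lemma iter_partial_tensor_conv:
  assumes "integrable lborel a"
  shows "iter_partial is (tensor_conv a D n) = tensor_conv a D (\<lambda>j. n j + count_list is j)"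
proof (induction "is")
  case (Cons i "is")
  have "(\<lambda>j. n j + count_list is j)(i := Suc (n i + count_list is i))
      = (\<lambda>j. n j + count_list (i # is) j)" by auto
  then show ?case
    using Cons by (simp add: iter_partial_def partial_tensor_conv[OF assms])
qed (simp add: iter_partial_def)

lemma tensor_conv_support:
  assumes a: "\<And>y. y \<notin> cball p r \<Longrightarrow> a y = 0"
    and x: "x \<notin> cball p (r + real CARD('d) * \<rho>)"
  shows "tensor_conv a D n x = 0"
proof -
  have z: "a y * tensor_kernel D n (x - y) = 0" for y
  proof (cases "y \<in> cball p r")
    case True
    have "dist p x \<le> dist p y + norm (x - y)"
      using dist_triangle[of p x y] by (simp add: dist_norm norm_minus_commute)
    then show ?thesis using True x by (simp add: tensor_kernel_support)
  qed (simp add: a)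
  show ?thesis by (simp only: tensor_conv_def z) simp
qed

lemma tensor_conv_test_function:
  assumes a: "integrable lborel a" and supp_a: "\<And>y. y \<notin> cball p r \<Longrightarrow> a y = 0"
    and U: "cball p (r + real CARD('d) * \<rho>) \<subseteq> U"
  shows "tensor_conv a D n \<in> test_functions U"
proof -
  let ?C = "cball p (r + real CARD('d) * \<rho>)"
  have "{x. tensor_conv a D n x \<noteq> 0} \<subseteq> ?C"
    using tensor_conv_support[where a=a and r=r, OF supp_a] by blast
  then have "closure {x. tensor_conv a D n x \<noteq> 0} \<subseteq> ?C" by (simp add: closure_minimal)
  moreover have "iter_partial is (tensor_conv a D n) differentiable (at x)" for "is" x
    using tensor_conv_has_derivative[OF a] by (simp add: iter_partial_tensor_conv[OF a] differentiable_def) blast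
  ultimately show ?thesis
    using U unfolding test_functions_def
    by (auto intro: bounded_subset simp: compact_eq_bounded_closed)
qed

end

lemma integral_affine_euclidean:
  fixes f :: "'a::euclidean_space \<Rightarrow> real"
  assumes f: "f \<in> borel_measurable borel" and c: "c \<noteq> 0"
  shows "(\<integral>x. f x \<partial>lborel) = \<bar>c\<bar> ^ DIM('a) * (\<integral>x. f (t + c *\<^sub>R x) \<partial>lborel)"
proof -
  have "(\<integral>x. f x \<partial>lborel)
      = (\<integral>x. f x \<partial>density (distr lborel borel (\<lambda>x. t + c *\<^sub>R x)) (\<lambda>_. ennreal (\<bar>c\<bar> ^ DIM('a))))"
    using lborel_affine[OF c, of t] by (simp add: ennreal_power)
  also have "\<dots> = (\<integral>x. \<bar>c\<bar> ^ DIM('a) *\<^sub>R f x \<partial>distr lborel borel (\<lambda>x. t + c *\<^sub>R x))"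
    using f by (subst integral_density) auto
  also have "\<dots> = (\<integral>x. \<bar>c\<bar> ^ DIM('a) *\<^sub>R f (t + c *\<^sub>R x) \<partial>lborel)"
    using f by (subst integral_distr) auto
  finally show ?thesis by simp
qed

text \<open>The function \<open>\<mu> b(\<mu> t)\<close> and its derivatives.\<close>
definition scaled_chain :: "(nat \<Rightarrow> real \<Rightarrow> real) \<Rightarrow> real \<Rightarrow> nat \<Rightarrow> real \<Rightarrow> real" where
  "scaled_chain b \<mu> n t = \<mu> ^ (n + 1) * b n (\<mu> * t)"

lemma derivative_chain_scaled:
  assumes "derivative_chain b"
  shows "derivative_chain (scaled_chain b \<mu>)"
  unfolding derivative_chain_def scaled_chain_def[abs_def]
  by (intro allI DERIV_cong[OF DERIV_cmult[OF DERIV_chain2[OF derivative_chain_deriv[OF assms]]]])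
     (auto intro!: derivative_eq_intros)

text \<open>A nonnegative smooth bump supported in \<open>[-1, 1]\<close>. It need not have integral \<open>1\<close>; the integral
  \<open>mass\<close> of the associated product kernel is carried along instead.\<close>
locale bump =
  fixes b :: "nat \<Rightarrow> real \<Rightarrow> real"
  assumes chain: "derivative_chain b" and nonneg: "\<And>t. 0 \<le> b 0 t" and pos: "0 < b 0 0"
    and supp: "\<And>n t. 1 \<le> \<bar>t\<bar> \<Longrightarrow> b n t = 0"
begin

lemma scaled_support: "0 < \<mu> \<Longrightarrow> 1 / \<mu> \<le> \<bar>t\<bar> \<Longrightarrow> scaled_chain b \<mu> n t = 0"
  using supp[of "\<mu> * t" n] by (simp add: scaled_chain_def abs_mult field_simps)

text \<open>The product mollifier of width \<open>1 / \<mu>\<close> in each variable. Its integral does not depend on \<open>\<mu>\<close>.\<close>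
definition mollifier :: "real \<Rightarrow> real ^ 'd::finite \<Rightarrow> real" where
  "mollifier \<mu> = tensor_kernel (\<lambda>_. scaled_chain b \<mu>) (\<lambda>_. 0)"

text \<open>The integral of the mollifiers over \<open>\<real>\<^sup>d\<close>.\<close>
definition mass :: "'d::finite itself \<Rightarrow> real" where
  "mass _ = (\<integral>z. mollifier 1 (z :: real ^ 'd) \<partial>lborel)"

lemma mollifier_nonneg: "0 < \<mu> \<Longrightarrow> 0 \<le> mollifier \<mu> (z :: real ^ 'd::finite)"
  by (auto simp: mollifier_def tensor_kernel_def scaled_chain_def nonneg intro!: prod_nonneg)

lemma mollifier_facts:
  assumes "0 < \<mu>"
  shows "continuous_on S (mollifier \<mu>)" "integrable lborel (mollifier \<mu> :: real ^ 'd::finite \<Rightarrow> real)"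
    "bounded (range (mollifier \<mu> :: real ^ 'd::finite \<Rightarrow> real))"
    "\<And>z :: real ^ 'd. real CARD('d) * (1 / \<mu>) \<le> norm z \<Longrightarrow> mollifier \<mu> z = 0"
  unfolding mollifier_def
  by (rule continuous_tensor_kernel[where \<rho>="1 / \<mu>"] integrable_tensor_kernel[where \<rho>="1 / \<mu>"]
      bounded_tensor_kernel[where \<rho>="1 / \<mu>"] tensor_kernel_support[where \<rho>="1 / \<mu>"];
      simp add: derivative_chain_scaled[OF chain] scaled_support assms)+

lemma mollifier_measurable [measurable]: "0 < \<mu> \<Longrightarrow> mollifier \<mu> \<in> borel_measurable borel"
  by (intro borel_measurable_continuous_onI mollifier_facts)

lemma mollifier_scale: "mollifier \<mu> (z :: real ^ 'd::finite) = \<mu> ^ CARD('d) * mollifier 1 (\<mu> *\<^sub>R z)"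
  by (simp add: mollifier_def tensor_kernel_def scaled_chain_def prod.distrib)

lemma integral_mollifier:
  assumes "0 < \<mu>"
  shows "(\<integral>z. mollifier \<mu> (z :: real ^ 'd::finite) \<partial>lborel) = mass TYPE('d)"
  using integral_affine_euclidean[of "mollifier 1 :: real ^ 'd \<Rightarrow> real" \<mu> 0] assms
  by (simp add: mollifier_scale[of \<mu>] mass_def)

lemma mass_pos: "0 < mass TYPE('d::finite)"
proof -
  let ?m = "mollifier 1 :: real ^ 'd \<Rightarrow> real"
  have p: "0 < ?m 0" by (simp add: mollifier_def tensor_kernel_def scaled_chain_def pos)
  have "open {z. ?m 0 / 2 < ?m z}"
    by (intro open_Collect_less continuous_intros mollifier_facts) auto
  moreover have "0 \<in> {z. ?m 0 / 2 < ?m z}" using p by simp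
  ultimately obtain \<delta> where \<delta>: "0 < \<delta>" "ball 0 \<delta> \<subseteq> {z. ?m 0 / 2 < ?m z}"
    using open_contains_ball by blast
  have "0 < (?m 0 / 2) * measure lborel (ball (0 :: real ^ 'd) \<delta>)"
    using p \<delta> by (simp add: content_ball_pos)
  also have "\<dots> = (\<integral>z. (?m 0 / 2) * indicator (ball 0 \<delta>) (z :: real ^ 'd) \<partial>lborel)" by simp
  also have "\<dots> \<le> (\<integral>z. ?m z \<partial>lborel)"
  proof (rule integral_mono)
    show "integrable lborel (\<lambda>z :: real ^ 'd. (?m 0 / 2) * indicator (ball 0 \<delta>) z)"
      by (intro integrable_mult_right integrable_real_indicator)
         (simp_all add: emeasure_bounded_finite[unfolded infinity_ennreal_def])
    show "(?m 0 / 2) * indicator (ball 0 \<delta>) z \<le> ?m z" for z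
      using \<delta>(2) mollifier_nonneg[of 1 z] by (auto simp: indicator_def intro: less_imp_le)
  qed (simp add: mollifier_facts)
  finally show ?thesis by (simp add: mass_def)
qed

lemma integral_mollifier_translate:
  assumes "0 < \<mu>"
  shows "(\<integral>y. mollifier \<mu> (x - y) \<partial>lborel) = mass TYPE('d::finite)"
    and "integrable lborel (\<lambda>y. mollifier \<mu> (x - y :: real ^ 'd))"
proof -
  let ?m = "mollifier \<mu> :: real ^ 'd \<Rightarrow> real"
  show "(\<integral>y. mollifier \<mu> (x - y) \<partial>lborel) = mass TYPE('d)"
    using integral_affine_euclidean[of ?m "- 1" x] integral_mollifier[OF assms, where 'd='d] assms
    by simp
  then show "integrable lborel (\<lambda>y. ?m (x - y))"
    using mass_pos[where 'd='d] not_integrable_integral_eq by fastforce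
qed

lemma mollify:
  fixes c :: "real ^ 'd::finite \<Rightarrow> real"
  assumes c: "continuous_on UNIV c" and c1: "\<And>x. \<bar>c x\<bar> \<le> 1"
    and supp_c: "\<And>x. x \<notin> cball x0 s \<Longrightarrow> c x = 0"
    and \<delta>: "0 < \<delta>" "\<And>x y. dist x y < \<delta> \<Longrightarrow> \<bar>c x - c y\<bar> \<le> \<eta>"
  obtains \<psi> where "\<psi> \<in> test_functions UNIV" "\<And>x. \<bar>\<psi> x\<bar> \<le> 1" "\<And>x. x \<notin> cball x0 (s + \<delta>) \<Longrightarrow> \<psi> x = 0"
    "\<And>x. \<bar>\<psi> x - c x\<bar> \<le> \<eta>"
proof -
  \<comment> \<open>The mollifier of this width vanishes outside the ball of radius \<open>\<delta>\<close>.\<close>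
  define \<mu> where "\<mu> = real CARD('d) / \<delta>"
  have \<mu>: "0 < \<mu>" using \<delta> by (simp add: \<mu>_def)
  have \<mu>\<delta>: "real CARD('d) * (1 / \<mu>) = \<delta>" using \<delta> by (simp add: \<mu>_def)
  let ?Z = "mass TYPE('d)" and ?m = "mollifier \<mu> :: real ^ 'd \<Rightarrow> real"
  have Z: "0 < ?Z" by (rule mass_pos)
  define \<psi> where "\<psi> = tensor_conv (\<lambda>y. c y / ?Z) (\<lambda>_. scaled_chain b \<mu>) (\<lambda>_. 0)"
  have "integrable lborel (\<lambda>x. indicator (cball x0 s) x *\<^sub>R (c x / ?Z))"
    using Z by (intro borel_integrable_compact continuous_intros continuous_on_subset[OF c]) auto
  also have "(\<lambda>x. indicator (cball x0 s) x *\<^sub>R (c x / ?Z)) = (\<lambda>y. c y / ?Z)"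
    using supp_c by (intro ext) (auto simp: indicator_def)
  finally have ic: "integrable lborel (\<lambda>y. c y / ?Z)" .
  have \<psi>: "\<psi> x = (\<integral>y. c y * ?m (x - y) \<partial>lborel) / ?Z" for x
    by (simp add: \<psi>_def tensor_conv_def mollifier_def)
  have im: "integrable lborel (\<lambda>y. ?m (x - y))" and Zm: "(\<integral>y. ?m (x - y) \<partial>lborel) = ?Z" for x
    using integral_mollifier_translate[OF \<mu>] by auto
  have icm: "integrable lborel (\<lambda>y. c y * ?m (x - y))" for x
    using integrable_mult_bounded[OF im borel_measurable_continuous_onI[OF c] c1]
    by (simp add: mult.commute)
  show thesis
  proof
    show "\<psi> \<in> test_functions UNIV"
      unfolding \<psi>_def
      by (rule tensor_conv_test_function[where \<rho>="1 / \<mu>" and p=x0 and r=s])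
         (simp_all add: derivative_chain_scaled chain scaled_support \<mu> ic supp_c)
    show "\<bar>\<psi> x\<bar> \<le> 1" for x
    proof -
      have "\<bar>\<integral>y. c y * ?m (x - y) \<partial>lborel\<bar> \<le> (\<integral>y. ?m (x - y) \<partial>lborel)"
        using c1 mollifier_nonneg[OF \<mu>, where 'd='d]
        by (intro abs_integral_le icm im)
           (auto simp: abs_mult abs_of_nonneg mult_left_le_one_le)
      then show ?thesis using Z by (simp add: \<psi> Zm)
    qed
    show "\<psi> x = 0" if "x \<notin> cball x0 (s + \<delta>)" for x
      unfolding \<psi>_def
      by (rule tensor_conv_support[where \<rho>="1 / \<mu>" and p=x0 and r=s])
         (use that in \<open>simp_all add: derivative_chain_scaled chain scaled_support \<mu> supp_c \<mu>\<delta>[simplified]\<close>)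
    show "\<bar>\<psi> x - c x\<bar> \<le> \<eta>" for x
    proof -
      have "\<bar>(\<integral>y. (c y - c x) * ?m (x - y) \<partial>lborel)\<bar> \<le> (\<integral>y. \<eta> * ?m (x - y) \<partial>lborel)"
      proof (rule abs_integral_le)
        show "integrable lborel (\<lambda>y. (c y - c x) * ?m (x - y))"
          using icm im by (simp add: left_diff_distrib)
        show "integrable lborel (\<lambda>y. \<eta> * ?m (x - y))" using im by simp
        show "\<bar>(c y - c x) * ?m (x - y)\<bar> \<le> \<eta> * ?m (x - y)" for y
        proof (cases "dist x y < \<delta>")
          case True
          then have "\<bar>c y - c x\<bar> \<le> \<eta>" using \<delta>(2)[of y x] by (simp add: dist_commute)
          then show ?thesis
            using mollifier_nonneg[OF \<mu>, of "x - y"] by (simp add: abs_mult mult_right_mono)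
        next
          case False
          then have "?m (x - y) = 0"
            using mollifier_facts(4)[OF \<mu>, of "x - y"] \<mu>\<delta> by (simp add: dist_norm)
          then show ?thesis by simp
        qed
      qed
      moreover have "(\<integral>y. (c y - c x) * ?m (x - y) \<partial>lborel) = ?Z * (\<psi> x - c x)"
        using icm im Z by (simp add: left_diff_distrib right_diff_distrib \<psi> Zm)
      ultimately have "?Z * \<bar>\<psi> x - c x\<bar> \<le> ?Z * \<eta>"
        using Z by (simp add: Zm abs_mult mult.commute)
      then show ?thesis using Z by simp
    qed
  qed
qed

text \<open>A measurable function is almost everywhere the limit of continuous functions. These are truncated
  in value and in space and then mollified.\<close>
lemma ex_test_function_L1_approx:
  fixes a :: "real ^ 'd::finite \<Rightarrow> real"
  assumes a: "a \<in> borel_measurable borel" and a1: "\<And>x. \<bar>a x\<bar> \<le> 1"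
    and supp_a: "\<And>x. x \<notin> cball x0 r \<Longrightarrow> a x = 0" and r: "0 < r" and e: "0 < e"
  obtains \<psi> where "\<psi> \<in> test_functions UNIV" "\<And>x. \<bar>\<psi> x\<bar> \<le> 1" "\<And>x. x \<notin> cball x0 (3 * r) \<Longrightarrow> \<psi> x = 0"
    "(\<integral>x. \<bar>a x - \<psi> x\<bar> \<partial>lborel) < e"
proof -
  have "a \<in> borel_measurable lebesgue" using a by (simp add: measurable_completion)
  then have "a measurable_on UNIV"
    by (rule lebesgue_measurable_imp_measurable_on) simp
  then obtain N g where N: "negligible N" and g: "\<And>n. continuous_on UNIV (g n)"
    and lim: "\<And>x. x \<notin> N \<Longrightarrow> (\<lambda>n. g n x) \<longlonglongrightarrow> a x"
    unfolding measurable_on_def by auto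
  define cut where "cut x = max 0 (min 1 (2 - dist x x0 / r))" for x
  define c where "c n x = max (- 1) (min 1 (g n x)) * cut x" for n :: nat and x
  have cut: "0 \<le> cut x" "cut x \<le> 1" for x by (auto simp: cut_def)
  have c1: "\<bar>c n x\<bar> \<le> 1" for n x
  proof -
    have "\<bar>max (- 1) (min 1 (g n x))\<bar> * \<bar>cut x\<bar> \<le> 1 * 1"
      by (intro mult_mono) (use cut in auto)
    then show ?thesis by (simp add: c_def abs_mult)
  qed
  have cc: "continuous_on UNIV (c n)" for n
    unfolding c_def cut_def using r by (intro continuous_intros g) auto
  have supp_c: "c n x = 0" if "x \<notin> cball x0 (2 * r)" for n x
    using that r by (simp add: c_def cut_def dist_commute field_simps)
  have lim_c: "(\<lambda>n. c n x) \<longlonglongrightarrow> a x" if "x \<notin> N" for x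
  proof -
    have "(\<lambda>n. c n x) \<longlonglongrightarrow> max (- 1) (min 1 (a x)) * cut x"
      unfolding c_def by (intro tendsto_intros lim that)
    also have "max (- 1) (min 1 (a x)) * cut x = a x"
    proof (cases "x \<in> cball x0 r")
      case True
      then have "cut x = 1" using r by (simp add: cut_def dist_commute field_simps)
      then show ?thesis using a1[of x] by (auto simp: abs_le_iff)
    qed (simp add: supp_a)
    finally show ?thesis .
  qed
  have "\<exists>\<psi>. \<psi> \<in> test_functions UNIV \<and> (\<forall>x. \<bar>\<psi> x\<bar> \<le> 1) \<and> (\<forall>x. x \<notin> cball x0 (3 * r) \<longrightarrow> \<psi> x = 0)
      \<and> (\<forall>x. \<bar>\<psi> x - c n x\<bar> \<le> 1 / Suc n)" for n
  proof -
    have "c n x = 0" if "norm x0 + 3 * r \<le> norm x" for x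
    proof (rule supp_c)
      have "norm x \<le> norm x0 + dist x0 x" using norm_triangle_ineq2[of x x0] by (simp add: dist_norm norm_minus_commute)
      then show "x \<notin> cball x0 (2 * r)" using that r by auto
    qed
    then have "uniformly_continuous_on UNIV (c n)"
      by (rule uniformly_continuous_bounded_support[OF cc])
    then obtain d where d: "0 < d" "\<And>x y. dist x y < d \<Longrightarrow> dist (c n x) (c n y) < 1 / Suc n"
      unfolding uniformly_continuous_on_def by (metis UNIV_I zero_less_divide_1_iff of_nat_0_less_iff zero_less_Suc)
    show ?thesis
    proof (rule mollify[OF cc c1 supp_c, where \<delta>="min d r" and \<eta>="1 / Suc n"])
      show "0 < min d r" using d r by simp
      show "\<bar>c n x - c n y\<bar> \<le> 1 / Suc n" if "dist x y < min d r" for x y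
        using d(2)[of x y] that by (simp add: dist_real_def)
      fix \<psi> assume "\<psi> \<in> test_functions UNIV" "\<And>x. \<bar>\<psi> x\<bar> \<le> 1"
        "\<And>x. x \<notin> cball x0 (2 * r + min d r) \<Longrightarrow> \<psi> x = 0" "\<And>x. \<bar>\<psi> x - c n x\<bar> \<le> 1 / Suc n"
      then show ?thesis by (intro exI[of _ \<psi>]) auto
    qed assumption
  qed
  then obtain \<psi> where \<psi>: "\<And>n. \<psi> n \<in> test_functions UNIV" "\<And>n x. \<bar>\<psi> n x\<bar> \<le> 1"
    "\<And>n x. x \<notin> cball x0 (3 * r) \<Longrightarrow> \<psi> n x = 0" "\<And>n x. \<bar>\<psi> n x - c n x\<bar> \<le> 1 / Suc n"
    by metis
  have "(\<lambda>n. \<integral>x. \<bar>a x - \<psi> n x\<bar> \<partial>lborel) \<longlonglongrightarrow> (\<integral>x. 0 \<partial>(lborel :: (real ^ 'd) measure))"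
  proof (rule integral_dominated_convergence[where w="\<lambda>x. 2 * indicator (cball x0 (3 * r)) x"])
    show "integrable lborel (\<lambda>x. 2 * indicator (cball x0 (3 * r)) x :: real)"
      by (intro integrable_mult_right integrable_real_indicator)
         (simp_all add: emeasure_bounded_finite[unfolded infinity_ennreal_def])
    show "(\<lambda>x. \<bar>a x - \<psi> n x\<bar>) \<in> borel_measurable lborel" for n
      using a borel_measurable_continuous_onI[OF test_function_continuous[OF \<psi>(1)[of n]]] by simp
    show "AE x in lborel. norm \<bar>a x - \<psi> n x\<bar> \<le> 2 * indicator (cball x0 (3 * r)) x" for n
    proof (intro AE_I2)
      fix x
      show "norm \<bar>a x - \<psi> n x\<bar> \<le> 2 * indicator (cball x0 (3 * r)) x"
        using a1[of x] \<psi>(2)[of n x] \<psi>(3)[of x n] supp_a[of x] r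
        by (cases "x \<in> cball x0 (3 * r)") (auto simp: indicator_def)
    qed
    have "N \<in> null_sets lebesgue" using N by (simp add: negligible_iff_null_sets)
    then have "AE x in lebesgue. x \<notin> N" by (rule AE_not_in)
    then have "AE x in lborel. x \<notin> N" by (simp add: AE_completion_iff)
    then show "AE x in lborel. (\<lambda>n. \<bar>a x - \<psi> n x\<bar>) \<longlonglongrightarrow> 0"
    proof eventually_elim
      case (elim x)
      have "(\<lambda>n. \<psi> n x - c n x) \<longlonglongrightarrow> 0"
        by (rule Lim_null_comparison[OF _ LIMSEQ_inverse_real_of_nat])
           (use \<psi>(4) in \<open>simp add: inverse_eq_divide\<close>)
      then have "(\<lambda>n. (\<psi> n x - c n x) + c n x) \<longlonglongrightarrow> 0 + a x"
        by (intro tendsto_add lim_c elim)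
      then have "(\<lambda>n. a x - \<psi> n x) \<longlonglongrightarrow> a x - a x" by (intro tendsto_intros) simp
      then show ?case by (simp add: tendsto_rabs_zero)
    qed
  qed simp
  then have "\<forall>\<^sub>F n in sequentially. (\<integral>x. \<bar>a x - \<psi> n x\<bar> \<partial>lborel) < e"
    using e by (simp add: order_tendstoD)
  then obtain n where "(\<integral>x. \<bar>a x - \<psi> n x\<bar> \<partial>lborel) < e"
    by (auto simp: eventually_sequentially)
  then show thesis using that \<psi> by blast
qed

text \<open>Pairing \<open>g\<close> with the mollified \<open>a\<close> averages the correlations of \<open>g\<close> with the translates of \<open>a\<close>.\<close>
lemma integral_mollified_swap:
  fixes g a :: "real ^ 'd::finite \<Rightarrow> real"
  assumes g: "g \<in> borel_measurable borel" "\<And>x. \<bar>g x\<bar> \<le> 1" "bounded S" "\<And>x. x \<notin> S \<Longrightarrow> g x = 0"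
    and a: "a \<in> borel_measurable borel" "\<And>x. \<bar>a x\<bar> \<le> 1" and \<mu>: "0 < \<mu>"
  shows "(\<integral>x. g x * (\<integral>y. a y * mollifier \<mu> (x - y) \<partial>lborel) \<partial>lborel)
      = (\<integral>z. mollifier \<mu> z * (\<integral>x. g x * a (x - z) \<partial>lborel) \<partial>lborel)"
proof -
  let ?m = "mollifier \<mu> :: real ^ 'd \<Rightarrow> real"
  note [measurable] = g(1) a(1) mollifier_measurable[OF \<mu>]
  have ig: "integrable lborel g" by (rule integrable_bounded_support[OF g])
  have "(\<integral>y. a y * ?m (x - y) \<partial>lborel) = (\<integral>z. ?m z * a (x - z) \<partial>lborel)" for x
    using integral_affine_euclidean[of "\<lambda>y. a y * ?m (x - y)" "- 1" x] by (simp add: mult.commute)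
  then have "(\<integral>x. g x * (\<integral>y. a y * ?m (x - y) \<partial>lborel) \<partial>lborel)
      = (\<integral>x. (\<integral>z. g x * (?m z * a (x - z)) \<partial>lborel) \<partial>lborel)" by simp
  also have "\<dots> = (\<integral>z. (\<integral>x. g x * (?m z * a (x - z)) \<partial>lborel) \<partial>lborel)"
  proof (rule lborel_pair.Fubini_integral[symmetric])
    show "integrable (lborel \<Otimes>\<^sub>M lborel) (\<lambda>(x, z). g x * (?m z * a (x - z)))"
    proof (rule Bochner_Integration.integrable_bound)
      show "integrable (lborel \<Otimes>\<^sub>M lborel) (\<lambda>(x, z). g x * ?m z)"
        by (rule lborel_pair.Fubini_integrable)
           (simp_all add: abs_mult mollifier_facts[OF \<mu>] ig integrable_mult_right)
      show "(\<lambda>(x, z). g x * (?m z * a (x - z))) \<in> borel_measurable (lborel \<Otimes>\<^sub>M lborel)"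
        by measurable
      show "AE p in lborel \<Otimes>\<^sub>M lborel. norm (case p of (x, z) \<Rightarrow> g x * (?m z * a (x - z)))
          \<le> norm (case p of (x, z) \<Rightarrow> g x * ?m z)"
        using a(2) by (intro AE_I2) (auto simp: abs_mult intro!: mult_left_mono mult_left_le)
    qed
  qed
  also have "\<dots> = (\<integral>z. ?m z * (\<integral>x. g x * a (x - z) \<partial>lborel) \<partial>lborel)"
  proof -
    have "g x * (?m z * a (x - z)) = ?m z * (g x * a (x - z))" for x z by simp
    then show ?thesis by (simp only: integral_mult_right_zero)
  qed
  finally show ?thesis .
qed

end

section \<open>The boundary of a Lipschitz domain\<close>

lemma negligible_hyperplane_orthogonal:
  fixes n :: "'a::euclidean_space"
  assumes "norm n = 1"
  shows "negligible {y. y \<bullet> n = 0}"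
proof -
  have "n \<noteq> 0" using assms by auto
  then have "negligible {y. n \<bullet> y = 0}" by (intro negligible_hyperplane) auto
  then show ?thesis by (simp add: inner_commute)
qed

text \<open>The graph is the image of a hyperplane under a Lipschitz map.\<close>
lemma negligible_lipschitz_graph:
  fixes n :: "'a::euclidean_space" and \<gamma> :: "'a \<Rightarrow> real"
  assumes n: "norm n = 1" and \<gamma>: "K-lipschitz_on {y. y \<bullet> n = 0} \<gamma>"
  shows "negligible {x. \<gamma> (x - (x \<bullet> n) *\<^sub>R n) = x \<bullet> n}"
proof -
  define H where "H = {y. y \<bullet> n = 0}"
  let ?g = "\<lambda>y. y + \<gamma> y *\<^sub>R n"
  have nn: "n \<bullet> n = 1" using n by (simp add: norm_eq_1)
  have "negligible (?g ` H)"
  proof (rule negligible_locally_Lipschitz_image)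
    show "negligible H" unfolding H_def by (rule negligible_hyperplane_orthogonal[OF n])
    fix x assume x: "x \<in> H"
    show "\<exists>T B. open T \<and> x \<in> T \<and> (\<forall>y\<in>H \<inter> T. norm (?g y - ?g x) \<le> B * norm (y - x))"
    proof (intro exI[of _ UNIV] exI[of _ "1 + K"] conjI ballI)
      fix y assume "y \<in> H \<inter> UNIV"
      then have "\<bar>\<gamma> y - \<gamma> x\<bar> \<le> K * norm (y - x)"
        using lipschitz_onD[OF \<gamma>, of y x] x by (simp add: H_def dist_norm)
      moreover have "?g y - ?g x = (y - x) + (\<gamma> y - \<gamma> x) *\<^sub>R n" by (simp add: algebra_simps)
      then have "norm (?g y - ?g x) \<le> norm (y - x) + \<bar>\<gamma> y - \<gamma> x\<bar>"
        using norm_triangle_ineq[of "y - x" "(\<gamma> y - \<gamma> x) *\<^sub>R n"] n by (simp only:) simp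
      ultimately show "norm (?g y - ?g x) \<le> (1 + K) * norm (y - x)" by (simp add: algebra_simps)
    qed auto
  qed simp
  moreover have "{x. \<gamma> (x - (x \<bullet> n) *\<^sub>R n) = x \<bullet> n} \<subseteq> ?g ` H"
  proof
    fix x assume "x \<in> {x. \<gamma> (x - (x \<bullet> n) *\<^sub>R n) = x \<bullet> n}"
    then have "x = ?g (x - (x \<bullet> n) *\<^sub>R n)" by simp
    moreover have "x - (x \<bullet> n) *\<^sub>R n \<in> H" by (simp add: H_def inner_diff_left nn)
    ultimately show "x \<in> ?g ` H" by blast
  qed
  ultimately show ?thesis by (rule negligible_subset)
qed

lemma negligible_frontier_lipschitz_domain:
  assumes "lipschitz_domain \<Omega>"
  shows "negligible (frontier \<Omega>)"
proof (rule locally_negligible_alt[THEN iffD2], rule ballI)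
  fix p assume p: "p \<in> frontier \<Omega>"
  have "open \<Omega>" using assms by (simp add: lipschitz_domain_def)
  obtain r n K and \<gamma> :: "real ^ 'a \<Rightarrow> real" where "0 < r" and n: "norm n = 1"
    and \<gamma>: "K-lipschitz_on {y. y \<bullet> n = 0} \<gamma>"
    and eq: "\<Omega> \<inter> ball p r = {x \<in> ball p r. \<gamma> (x - (x \<bullet> n) *\<^sub>R n) < x \<bullet> n}"
    using assms[unfolded lipschitz_domain_def, THEN conjunct2, THEN conjunct2, THEN conjunct2,
        THEN bspec, OF p] by (elim exE conjE) (rule that)
  have nn: "n \<bullet> n = 1" using n by (simp add: norm_eq_1)
  let ?h = "\<lambda>x. \<gamma> (x - (x \<bullet> n) *\<^sub>R n) - x \<bullet> n"
  have cont: "continuous_on UNIV ?h"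
    by (intro continuous_intros continuous_on_compose2[OF lipschitz_on_continuous_on[OF \<gamma>]])
       (auto simp: inner_diff_left nn)
  have "frontier \<Omega> \<inter> ball p r \<subseteq> {x. \<gamma> (x - (x \<bullet> n) *\<^sub>R n) = x \<bullet> n}"
  proof clarify
    fix x assume x: "x \<in> frontier \<Omega>" "x \<in> ball p r"
    then have "x \<notin> \<Omega>" using \<open>open \<Omega>\<close> by (simp add: frontier_def interior_open)
    then have "0 \<le> ?h x" using eq x by fastforce
    moreover have "\<not> 0 < ?h x"
    proof
      assume "0 < ?h x"
      define U where "U = {y. 0 < ?h y} \<inter> ball p r"
      have "open U" unfolding U_def
        by (intro open_Int open_Collect_less cont continuous_intros) auto
      moreover have "x \<in> U" using x \<open>0 < ?h x\<close> by (simp add: U_def)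
      moreover have "U \<inter> \<Omega> = {}" using eq unfolding U_def set_eq_iff by force
      ultimately have "x \<notin> closure \<Omega>" by (metis closure_iff_nhds_not_empty inf.commute order_refl)
      then show False using x by (simp add: frontier_def)
    qed
    ultimately show "\<gamma> (x - (x \<bullet> n) *\<^sub>R n) = x \<bullet> n" by simp
  qed
  then have "negligible (frontier \<Omega> \<inter> ball p r)"
    by (rule negligible_subset[OF negligible_lipschitz_graph[OF n \<gamma>]])
  then show "\<exists>U. openin (top_of_set (frontier \<Omega>)) U \<and> p \<in> U \<and> negligible U"
    using p \<open>0 < r\<close> by (intro exI[of _ "frontier \<Omega> \<inter> ball p r"]) (auto intro: openin_open_Int)
qed

section \<open>Total variation and translations\<close>

lemma iter_partial_translate_scaleR:
  fixes \<psi> :: "real ^ 'd::finite \<Rightarrow> real" and v :: "'a::real_normed_vector"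
  assumes "\<psi> \<in> test_functions U"
  shows "iter_partial is (\<lambda>y. \<psi> (y - c) *\<^sub>R v) = (\<lambda>y. iter_partial is \<psi> (y - c) *\<^sub>R v)"
    and "((\<lambda>y. \<psi> (y - c) *\<^sub>R v) has_derivative (\<lambda>h. (gradient \<psi> (x - c) \<bullet> h) *\<^sub>R v)) (at x)"
proof -
  have D: "((\<lambda>y. f (y - c) *\<^sub>R v) has_derivative (\<lambda>h. (gradient f (x - c) \<bullet> h) *\<^sub>R v)) (at x)"
    if "f \<in> test_functions U" for f x
  proof -
    have "((\<lambda>y. y - c) has_derivative (\<lambda>h. h)) (at x)"
      by (auto intro!: derivative_eq_intros)
    then have "((\<lambda>y. f (y - c)) has_derivative (\<lambda>h. gradient f (x - c) \<bullet> h)) (at x)"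
      using has_derivative_compose test_function_gradient(1)[OF that] by blast
    then show ?thesis by (rule has_derivative_scaleR_left)
  qed
  show "((\<lambda>y. \<psi> (y - c) *\<^sub>R v) has_derivative (\<lambda>h. (gradient \<psi> (x - c) \<bullet> h) *\<^sub>R v)) (at x)"
    by (rule D[OF assms])
  show "iter_partial is (\<lambda>y. \<psi> (y - c) *\<^sub>R v) = (\<lambda>y. iter_partial is \<psi> (y - c) *\<^sub>R v)"
  proof (induction "is")
    case (Cons i js)
    have "partial i (\<lambda>y. iter_partial js \<psi> (y - c) *\<^sub>R v) x
        = partial i (iter_partial js \<psi>) (x - c) *\<^sub>R v" for x
      unfolding partial_def frechet_derivative_at[OF D[OF test_function_iter_partial[OF assms]], symmetric]
      by (simp add: gradient_def inner_axis partial_def)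
    then show ?case using Cons by (simp add: iter_partial_def)
  qed (simp add: iter_partial_def)
qed

text \<open>The derivative in \<open>t\<close> of the pairing of \<open>X \<bullet> N\<close> with \<open>\<psi>(\<cdot> - t z)\<close> is, up to the factor \<open>\<bar>z\<bar>\<close>, the
  pairing of \<open>X\<close> with the divergence of an admissible test field, and so is bounded by \<open>\<bar>z\<bar> V\<close>.\<close>
lemma total_variation_translate_test_function:
  fixes X :: "real ^ 'd::finite \<Rightarrow> 'a::euclidean_space"
  assumes X: "set_integrable lebesgue \<Omega> X" and V: "total_variation \<Omega> X \<le> ennreal V" "0 \<le> V"
    and N: "norm N = 1" and w: "integrable lborel w" "AE x in lebesgue. w x = indicator \<Omega> x * (X x \<bullet> N)"
    and \<psi>: "\<psi> \<in> test_functions UNIV" "\<And>x. \<bar>\<psi> x\<bar> \<le> 1" "compact K" "\<And>x. x \<notin> K \<Longrightarrow> \<psi> x = 0"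
    and K: "\<And>t x. 0 \<le> t \<Longrightarrow> t \<le> 1 \<Longrightarrow> x \<in> K \<Longrightarrow> x + t *\<^sub>R z \<in> \<Omega>"
  shows "\<bar>(\<integral>x. w x * \<psi> (x - z) \<partial>lborel) - (\<integral>x. w x * \<psi> x \<partial>lborel)\<bar> \<le> norm z * V"
proof (cases "z = 0")
  case False
  define \<Theta> where "\<Theta> t = (\<integral>x. w x * \<psi> (x - t *\<^sub>R z) \<partial>lborel)" for t
  define G where "G t = (\<integral>x. w x * (gradient \<psi> (x - t *\<^sub>R z) \<bullet> z) \<partial>lborel)" for t
  have D: "(\<Theta> has_real_derivative - G t) (at t within {0..1})" for t
    unfolding \<Theta>_def G_def
    by (rule has_field_derivative_at_within[OF test_function_convolution[OF w(1) \<psi>(1)]])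
  have G: "\<sigma> * G t \<le> norm z * V" if t: "t \<in> {0..1}" and \<sigma>: "\<bar>\<sigma>\<bar> = 1" for t \<sigma>
  proof -
    \<comment> \<open>The test field is \<open>\<psi>(\<cdot> - t z)\<close> times the unit vector \<open>\<sigma> z / \<bar>z\<bar> \<otimes> N\<close>; the sign \<open>\<sigma>\<close> gives both
      bounds on \<open>G\<close>.\<close>
    define v :: "'a ^ 'd" where "v = (\<chi> i. (\<sigma> * z $ i / norm z) *\<^sub>R N)"
    define \<phi> where "\<phi> y = \<psi> (y - t *\<^sub>R z) *\<^sub>R v" for y
    have "(norm v)\<^sup>2 = (\<Sum>i\<in>UNIV. (z $ i)\<^sup>2) / (norm z)\<^sup>2"
    proof -
      have "(norm v)\<^sup>2 = (\<Sum>i\<in>UNIV. (norm (v $ i))\<^sup>2)"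
        by (simp add: norm_vec_def L2_set_def sum_nonneg)
      also have "\<dots> = (\<Sum>i\<in>UNIV. (z $ i)\<^sup>2 / (norm z)\<^sup>2)"
        using N \<sigma> by (simp add: v_def abs_mult power_divide)
      finally show ?thesis by (simp add: sum_divide_distrib)
    qed
    also have "(\<Sum>i\<in>UNIV. (z $ i)\<^sup>2) = (norm z)\<^sup>2"
      by (simp add: norm_vec_def L2_set_def sum_nonneg)
    finally have nv: "norm v = 1" using False using norm_ge_zero[of v] by (simp add: power2_eq_1_iff del: norm_ge_zero)
    have \<phi>: "\<phi> \<in> test_functions \<Omega>"
    proof -
      let ?K = "(\<lambda>x. x + t *\<^sub>R z) ` K"
      have "compact ?K" using \<psi>(3) by (intro compact_continuous_image continuous_intros)
      moreover have "{x. \<phi> x \<noteq> 0} \<subseteq> ?K"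
        using \<psi>(4) by (force simp: \<phi>_def image_iff algebra_simps intro: bexI[of _ "_ - t *\<^sub>R z"])
      then have "closure {x. \<phi> x \<noteq> 0} \<subseteq> ?K" using \<open>compact ?K\<close> by (simp add: closure_minimal compact_imp_closed)
      moreover have "?K \<subseteq> \<Omega>" using K t by auto
      moreover have "iter_partial is \<phi> differentiable (at x)" for "is" x
        unfolding \<phi>_def iter_partial_translate_scaleR(1)[OF \<psi>(1)] differentiable_def
        using iter_partial_translate_scaleR(2)[OF test_function_iter_partial[OF \<psi>(1)]] by blast
      ultimately show ?thesis
        unfolding test_functions_def by (auto simp: compact_eq_bounded_closed intro: bounded_subset)
    qed
    moreover have "norm (\<phi> x) \<le> 1" for x using \<psi>(2) nv by (simp add: \<phi>_def)
    ultimately have le: "ennreal (\<integral>x\<in>\<Omega>. (\<Sum>i\<in>UNIV. X x \<bullet> partial i (\<lambda>y. \<phi> y $ i) x) \<partial>lebesgue)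
        \<le> total_variation \<Omega> X"
      unfolding total_variation_def by (intro SUP_upper) auto
    let ?q = "\<lambda>x. \<sigma> / norm z * (gradient \<psi> (x - t *\<^sub>R z) \<bullet> z)"
    have "(\<Sum>i\<in>UNIV. X x \<bullet> partial i (\<lambda>y. \<phi> y $ i) x) = (X x \<bullet> N) * ?q x" for x
    proof -
      have "partial i (\<lambda>y. \<phi> y $ i) x = partial i \<psi> (x - t *\<^sub>R z) *\<^sub>R (v $ i)" for i
        using iter_partial_translate_scaleR(1)[OF \<psi>(1), of "[i]" "t *\<^sub>R z" "v $ i"]
        by (simp add: iter_partial_def \<phi>_def fun_eq_iff)
      then have "X x \<bullet> partial i (\<lambda>y. \<phi> y $ i) x
          = (X x \<bullet> N) * (\<sigma> / norm z) * (z $ i * partial i \<psi> (x - t *\<^sub>R z))" for i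
        by (simp add: v_def)
      then show ?thesis by (simp add: inner_gradient sum_distrib_left sum_divide_distrib mult.assoc)
    qed
    then have "(\<integral>x\<in>\<Omega>. (\<Sum>i\<in>UNIV. X x \<bullet> partial i (\<lambda>y. \<phi> y $ i) x) \<partial>lebesgue)
        = (\<integral>x. ((indicator \<Omega> x *\<^sub>R X x) \<bullet> N) * ?q x \<partial>lebesgue)"
      by (simp add: set_lebesgue_integral_def mult.assoc)
    also have "\<dots> = (\<integral>x. w x * ?q x \<partial>lebesgue)"
    proof (rule integral_cong_AE)
      have c: "continuous_on UNIV ?q"
        by (intro continuous_intros continuous_on_compose2[OF
              uniformly_continuous_imp_continuous[OF test_function_gradient(3)[OF \<psi>(1)]]]) auto
      have q: "?q \<in> borel_measurable lebesgue"
        by (rule measurable_completion) (use borel_measurable_continuous_onI[OF c] in simp)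
      have "(\<lambda>x. indicator \<Omega> x *\<^sub>R X x) \<in> borel_measurable lebesgue"
        using X unfolding set_integrable_def by auto
      then show "(\<lambda>x. ((indicator \<Omega> x *\<^sub>R X x) \<bullet> N) * ?q x) \<in> borel_measurable lebesgue"
        using q by measurable
      have "w \<in> borel_measurable lebesgue"
        by (rule measurable_completion) (use w in auto)
      then show "(\<lambda>x. w x * ?q x) \<in> borel_measurable lebesgue" using q by measurable
      show "AE x in lebesgue. ((indicator \<Omega> x *\<^sub>R X x) \<bullet> N) * ?q x = w x * ?q x"
        using w(2) by eventually_elim simp
    qed
    also have "\<dots> = (\<integral>x. w x * ?q x \<partial>lborel)"
    proof (rule integral_completion)
      have "continuous_on UNIV ?q"
        by (intro continuous_intros continuous_on_compose2[OF
              uniformly_continuous_imp_continuous[OF test_function_gradient(3)[OF \<psi>(1)]]]) auto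
      from borel_measurable_continuous_onI[OF this]
      have "(\<lambda>x. w x * ?q x) \<in> borel_measurable borel"
        by (rule borel_measurable_times[rotated]) (use w(1) in auto)
      then show "(\<lambda>x. w x * ?q x) \<in> borel_measurable lborel" by simp
    qed
    also have "\<dots> = (\<integral>x. \<sigma> / norm z * (w x * (gradient \<psi> (x - t *\<^sub>R z) \<bullet> z)) \<partial>lborel)"
      by (intro Bochner_Integration.integral_cong refl) simp
    also have "\<dots> = \<sigma> / norm z * G t" unfolding G_def by (rule integral_mult_right_zero)
    finally have "ennreal (\<sigma> / norm z * G t) \<le> ennreal V"
      using order_trans[OF le V(1)] by (simp only:)
    then have "\<sigma> / norm z * G t \<le> V" by (simp only: ennreal_le_iff[OF V(2)])
    then show ?thesis using False by (simp add: field_simps)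
  qed
  have "\<bar>G t\<bar> \<le> norm z * V" if "t \<in> {0..1}" for t
    using G[OF that, of 1] G[OF that, of "- 1"] by simp
  then have "norm (\<Theta> 1 - \<Theta> 0) \<le> norm z * V * norm (1 - 0 :: real)"
    by (intro field_differentiable_bound[where S="{0..1}", OF _ D]) auto
  then show ?thesis by (simp add: \<Theta>_def)
qed simp

lemma integral_indicator_translate_test_function:
  fixes \<psi> :: "real ^ 'd::finite \<Rightarrow> real"
  assumes \<psi>: "\<psi> \<in> test_functions U" "\<And>x. x \<notin> K \<Longrightarrow> \<psi> x = 0" and K: "\<And>x. x \<in> K \<Longrightarrow> x + z \<in> \<Omega>"
  shows "(\<integral>x. indicator \<Omega> x * \<psi> (x - z) \<partial>lborel) = (\<integral>x. \<psi> x \<partial>lborel)"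
proof -
  have "indicator \<Omega> x * \<psi> (x - z) = \<psi> (- z + x)" for x
    using \<psi>(2)[of "x - z"] K[of "x - z"] by (auto simp: indicator_def)
  then show ?thesis
    by (simp only: integral_translate[OF borel_measurable_continuous_onI[OF test_function_continuous[OF \<psi>(1)]]])
qed

context bump
begin

text \<open>Here \<open>g\<close> is a Borel representative of \<open>f - lam\<close>, where \<open>X = B + f (A - B)\<close> on \<open>\<Omega>\<close>, and \<open>a\<close> is the
  sign of \<open>g\<close> on \<open>cball x0 r\<close>. The function \<open>a\<close> has no regularity: in the estimate of
  \<open>total_variation_translate_test_function\<close> only the supremum of \<open>\<psi>\<close> enters, so \<open>\<psi>\<close> may
  approximate \<open>a\<close> in \<open>L\<^sup>1\<close>.\<close>
lemma phase_correlation_ge: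
  fixes X :: "real ^ 'd::finite \<Rightarrow> 'a::euclidean_space"
  assumes \<Omega>: "open \<Omega>" "bounded \<Omega>" and r: "0 < r" "cball x0 (4 * r) \<subseteq> \<Omega>"
    and lam: "0 < lam" "lam < 1" and AB: "A \<noteq> B" and F: "F = lam *\<^sub>R A + (1 - lam) *\<^sub>R B"
    and X: "set_integrable lebesgue \<Omega> X" "\<And>x. x \<in> \<Omega> \<Longrightarrow> X x \<in> {A, B}"
    and V: "total_variation \<Omega> X \<le> ennreal V" "0 \<le> V"
  obtains g a :: "real ^ 'd \<Rightarrow> real" where
    "g \<in> borel_measurable borel" "\<And>x. \<bar>g x\<bar> \<le> 1" "\<And>x. x \<notin> \<Omega> \<Longrightarrow> g x = 0"
    "AE x in lebesgue. x \<in> \<Omega> \<longrightarrow> X x - F = g x *\<^sub>R (A - B)"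
    "a \<in> borel_measurable borel" "\<And>x. \<bar>a x\<bar> \<le> 1" "\<And>x. x \<notin> cball x0 r \<Longrightarrow> a x = 0"
    "\<And>z. norm z \<le> r \<Longrightarrow> min lam (1 - lam) * measure lborel (cball x0 r) - norm z * V / norm (A - B)
       \<le> (\<integral>x. g x * a (x - z) \<partial>lborel)"
proof -
  define d where "d = norm (A - B)"
  define N where "N = (A - B) /\<^sub>R d"
  have d: "0 < d" using AB by (simp add: d_def)
  have N: "norm N = 1" using d by (simp add: N_def d_def[symmetric])
  have BA: "A - B = d *\<^sub>R N" using d by (simp add: N_def)
  have NN: "N \<bullet> N = 1" using N by (simp add: norm_eq_1)
  define h where "h x = ((indicator \<Omega> x *\<^sub>R X x) \<bullet> N - indicator \<Omega> x * (F \<bullet> N)) / d" for x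
  have [measurable]: "\<Omega> \<in> sets borel" using \<Omega> by simp
  then have \<Omega>leb: "\<Omega> \<in> sets lebesgue" by simp
  have "(\<lambda>x. indicator \<Omega> x *\<^sub>R X x) \<in> borel_measurable lebesgue"
    using X(1) unfolding set_integrable_def by auto
  then have "h \<in> borel_measurable lebesgue" unfolding h_def using \<Omega>leb by measurable
  then obtain g' where g'[measurable]: "g' \<in> borel_measurable lborel" and eq: "AE x in lborel. h x = g' x"
    using completion_ex_borel_measurable_real by blast
  then have g'b [measurable]: "g' \<in> borel_measurable borel" by simp
  have AF: "A - F = ((1 - lam) * d) *\<^sub>R N" "B - F = (- lam * d) *\<^sub>R N"
  proof -
    have "A - F = (1 - lam) *\<^sub>R (A - B)" "B - F = (- lam) *\<^sub>R (A - B)"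
      by (simp_all add: F algebra_simps)
    then show "A - F = ((1 - lam) * d) *\<^sub>R N" "B - F = (- lam * d) *\<^sub>R N" by (simp_all add: BA)
  qed
  have h: "X x - F = (h x * d) *\<^sub>R N \<and> min lam (1 - lam) \<le> \<bar>h x\<bar> \<and> \<bar>h x\<bar> \<le> 1" if x: "x \<in> \<Omega>" for x
  proof -
    have hx: "h x = ((X x - F) \<bullet> N) / d" using x by (simp add: h_def inner_diff_left)
    from X(2)[OF x] consider "X x = A" | "X x = B" by auto
    then show ?thesis
    proof cases
      case 1
      then have "h x = 1 - lam" using d by (simp add: hx AF NN)
      then show ?thesis using 1 AF lam by auto
    next
      case 2
      then have "h x = - lam" using d by (simp add: hx AF NN)
      then show ?thesis using 2 AF lam by auto
    qed
  qed
  define g where "g x = indicator \<Omega> x * max (- 1) (min 1 (g' x))" for x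
  have g[measurable]: "g \<in> borel_measurable borel" unfolding g_def by measurable
  have g1: "\<bar>g x\<bar> \<le> 1" for x by (auto simp: g_def indicator_def)
  have g0: "g x = 0" if "x \<notin> \<Omega>" for x using that by (simp add: g_def)
  have gh: "AE x in lborel. g x = indicator \<Omega> x * h x"
    using eq
  proof eventually_elim
    case (elim x)
    then show ?case using h[of x] by (auto simp: g_def indicator_def)
  qed
  have gh': "AE x in lebesgue. g x = indicator \<Omega> x * h x" using gh by (rule AE_completion)
  define a where "a x = indicator (cball x0 r) x * sgn (g x)" for x
  have [measurable]: "cball x0 r \<in> sets borel" by simp
  have a[measurable]: "a \<in> borel_measurable borel" unfolding a_def sgn_real_def by measurable
  have a1: "\<bar>a x\<bar> \<le> 1" for x by (auto simp: a_def indicator_def sgn_real_def)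
  have a0: "a x = 0" if "x \<notin> cball x0 r" for x using that by (simp add: a_def)
  have ig: "integrable lborel g" by (rule integrable_bounded_support[OF g g1 \<Omega>(2) g0])
  have main: "min lam (1 - lam) * measure lborel (cball x0 r) - norm z * V / d
       \<le> (\<integral>x. g x * a (x - z) \<partial>lborel)" if z: "norm z \<le> r" for z
  proof -
    have iga: "integrable lborel (\<lambda>x. g x * a (x - y))" for y
      by (rule integrable_mult_bounded[OF ig _ a1]) measurable
    have "min lam (1 - lam) * measure lborel (cball x0 r)
        = (\<integral>x. min lam (1 - lam) * indicator (cball x0 r) x \<partial>lborel)" by simp
    also have "\<dots> \<le> (\<integral>x. g x * a (x - 0) \<partial>lborel)"
    proof (rule integral_mono_AE)
      show "integrable lborel (\<lambda>x. min lam (1 - lam) * indicator (cball x0 r) x)"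
        by (intro integrable_mult_right integrable_real_indicator)
           (simp_all add: emeasure_bounded_finite[unfolded infinity_ennreal_def])
      show "AE x in lborel. min lam (1 - lam) * indicator (cball x0 r) x \<le> g x * a (x - 0)"
        using gh
      proof eventually_elim
        case (elim x)
        show ?case
        proof (cases "x \<in> cball x0 r")
          case True
          then have "x \<in> \<Omega>" using r by auto
          then have "min lam (1 - lam) \<le> \<bar>g x\<bar>" using h[of x] elim by simp
          moreover have "g x * sgn (g x) = \<bar>g x\<bar>" by (simp add: abs_sgn)
          ultimately show ?thesis using True by (simp add: a_def)
        qed (simp add: a_def)
      qed
    qed (rule iga)
    finally have low: "min lam (1 - lam) * measure lborel (cball x0 r) \<le> (\<integral>x. g x * a x \<partial>lborel)"
      by simp
    have "(\<integral>x. g x * a x \<partial>lborel) - (\<integral>x. g x * a (x - z) \<partial>lborel) \<le> norm z * V / d + e" if "0 < e" for e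
    proof -
      obtain \<psi> where \<psi>: "\<psi> \<in> test_functions UNIV" "\<And>x. \<bar>\<psi> x\<bar> \<le> 1" "\<And>x. x \<notin> cball x0 (3 * r) \<Longrightarrow> \<psi> x = 0"
        "(\<integral>x. \<bar>a x - \<psi> x\<bar> \<partial>lborel) < e / 2"
        using ex_test_function_L1_approx[OF a a1 a0 r(1), where e="e / 2"] \<open>0 < e\<close> by auto
      have m\<psi>[measurable]: "\<psi> \<in> borel_measurable borel"
        by (rule borel_measurable_continuous_onI[OF test_function_continuous[OF \<psi>(1)]])
      have ig\<psi>: "integrable lborel (\<lambda>x. g x * \<psi> (x - y))" for y
        by (rule integrable_mult_bounded[OF ig _ \<psi>(2)]) measurable
      have ia: "integrable lborel a" by (rule integrable_bounded_support[OF a a1 bounded_cball a0])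
      have ia\<psi>: "integrable lborel (\<lambda>x. \<bar>a x - \<psi> x\<bar>)"
        using ia test_function_integrable[OF \<psi>(1)] by simp
      have near: "\<bar>(\<integral>x. g x * a (x - y) \<partial>lborel) - (\<integral>x. g x * \<psi> (x - y) \<partial>lborel)\<bar> \<le> e / 2" for y
      proof -
        have tr: "(\<integral>x. \<bar>a (x - y) - \<psi> (x - y)\<bar> \<partial>lborel) = (\<integral>x. \<bar>a x - \<psi> x\<bar> \<partial>lborel)"
          using integral_translate[of "\<lambda>x. \<bar>a x - \<psi> x\<bar>" "- y"] by simp
        have "\<bar>\<integral>x. g x * (a (x - y) - \<psi> (x - y)) \<partial>lborel\<bar> \<le> (\<integral>x. \<bar>a (x - y) - \<psi> (x - y)\<bar> \<partial>lborel)"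
        proof (rule abs_integral_le)
          show "integrable lborel (\<lambda>x. g x * (a (x - y) - \<psi> (x - y)))"
            using iga ig\<psi> by (simp add: right_diff_distrib)
          have "integrable (distr lborel borel ((+) (- y))) (\<lambda>x. \<bar>a x - \<psi> x\<bar>)"
            using ia\<psi> by (simp only: lborel_distr_plus)
          then show "integrable lborel (\<lambda>x. \<bar>a (x - y) - \<psi> (x - y)\<bar>)"
            by (subst (asm) integrable_distr_eq) auto
          show "\<bar>g x * (a (x - y) - \<psi> (x - y))\<bar> \<le> \<bar>a (x - y) - \<psi> (x - y)\<bar>" for x
            using g1[of x] by (simp add: abs_mult mult_left_le_one_le)
        qed
        then show ?thesis using \<psi>(4) iga ig\<psi> by (simp add: right_diff_distrib tr)
      qed
      \<comment> \<open>\<open>w\<close> represents \<open>X \<bullet> N\<close> on \<open>\<Omega>\<close>. There it differs from \<open>d g\<close> by a constant, whose pairing with the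
        translates of \<open>\<psi>\<close> does not depend on the translation.\<close>
      define w where "w x = d * g x + (F \<bullet> N) * indicator \<Omega> x" for x
      have i\<Omega>: "integrable lborel (indicator \<Omega> :: _ \<Rightarrow> real)"
        using \<Omega> by (intro integrable_real_indicator) (simp_all add: emeasure_bounded_finite[unfolded infinity_ennreal_def])
      have i\<Omega>\<psi>: "integrable lborel (\<lambda>x. indicator \<Omega> x * \<psi> (x - y))" for y
        by (rule integrable_mult_bounded[OF i\<Omega> _ \<psi>(2)]) measurable
      have iw: "integrable lborel w" unfolding w_def using ig i\<Omega> by simp
      have w: "AE x in lebesgue. w x = indicator \<Omega> x * (X x \<bullet> N)"
        using gh' by eventually_elim (use d in \<open>auto simp: w_def h_def indicator_def field_simps\<close>)
      have K: "x + t *\<^sub>R z \<in> \<Omega>" if "0 \<le> t" "t \<le> 1" "x \<in> cball x0 (3 * r)" for t x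
      proof -
        have "norm (t *\<^sub>R z) \<le> r"
          using that z mult_mono[of t 1 "norm z" r] by simp
        moreover have "dist x0 (x + t *\<^sub>R z) \<le> dist x0 x + norm (t *\<^sub>R z)"
          using dist_triangle[of x0 "x + t *\<^sub>R z" x] by (simp add: dist_norm)
        ultimately have "x + t *\<^sub>R z \<in> cball x0 (4 * r)" using that by simp
        then show ?thesis using r by blast
      qed
      have "\<bar>(\<integral>x. w x * \<psi> (x - z) \<partial>lborel) - (\<integral>x. w x * \<psi> x \<partial>lborel)\<bar> \<le> norm z * V"
        by (rule total_variation_translate_test_function[OF X(1) V N iw w \<psi>(1,2) compact_cball \<psi>(3) K])
      moreover have wy: "(\<integral>x. w x * \<psi> (x - y) \<partial>lborel)
          = d * (\<integral>x. g x * \<psi> (x - y) \<partial>lborel) + (F \<bullet> N) * (\<integral>x. \<psi> x \<partial>lborel)" if "y = 0 \<or> y = z" for y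
      proof -
        have "\<And>x. x \<in> cball x0 (3 * r) \<Longrightarrow> x + y \<in> \<Omega>"
          using K[of 0] K[of 1] \<open>y = 0 \<or> y = z\<close> by auto
        with \<psi>(1,3) have "(\<integral>x. indicator \<Omega> x * \<psi> (x - y) \<partial>lborel) = (\<integral>x. \<psi> x \<partial>lborel)"
          by (rule integral_indicator_translate_test_function)
        moreover have "(\<integral>x. w x * \<psi> (x - y) \<partial>lborel)
            = (\<integral>x. d * (g x * \<psi> (x - y)) + (F \<bullet> N) * (indicator \<Omega> x * \<psi> (x - y)) \<partial>lborel)"
          by (simp add: w_def algebra_simps)
        ultimately show ?thesis using ig\<psi> i\<Omega>\<psi> by simp
      qed
      ultimately have "\<bar>d * ((\<integral>x. g x * \<psi> (x - z) \<partial>lborel) - (\<integral>x. g x * \<psi> x \<partial>lborel))\<bar> \<le> norm z * V"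
        using wy[of z] wy[of 0] by (simp add: right_diff_distrib)
      then have "\<bar>(\<integral>x. g x * \<psi> (x - z) \<partial>lborel) - (\<integral>x. g x * \<psi> x \<partial>lborel)\<bar> \<le> norm z * V / d"
        using d by (simp add: abs_mult pos_le_divide_eq mult.commute)
      moreover have "\<bar>(\<integral>x. g x * a x \<partial>lborel) - (\<integral>x. g x * \<psi> x \<partial>lborel)\<bar> \<le> e / 2"
        using near[of 0] by simp
      ultimately show ?thesis using near[of z] by linarith
    qed
    then have "(\<integral>x. g x * a x \<partial>lborel) - (\<integral>x. g x * a (x - z) \<partial>lborel) \<le> norm z * V / d"
      by (rule field_le_epsilon)
    then show ?thesis using low by linarith
  qed
  have "AE x in lebesgue. x \<in> \<Omega> \<longrightarrow> X x - F = g x *\<^sub>R (A - B)"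
    using gh'
  proof eventually_elim
    case (elim x)
    then show ?case using h[of x] by (auto simp: BA)
  qed
  from that[OF g g1 g0 this a a1 a0 main[unfolded d_def]] show thesis by simp
qed

end

section \<open>Components of symmetric products of basis vectors\<close>

lemma map_eq_of_position:
  fixes xs :: "'b list"
  assumes len: "length xs = CARD('m::{finite,linorder})"
  shows "map (\<lambda>a :: 'm. xs ! card {..<a}) (sorted_list_of_set UNIV) = xs"
proof (rule nth_equalityI)
  let ?s = "sorted_list_of_set (UNIV :: 'm set)"
  show "length (map (\<lambda>a :: 'm. xs ! card {..<a}) ?s) = length xs"
    using len by simp
  fix n assume n: "n < length (map (\<lambda>a :: 'm. xs ! card {..<a}) ?s)"
  then have n: "n < length ?s" by simp
  have "{..<?s ! n} = set (take n ?s)"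
  proof -
    have sd: "sorted ?s" "distinct ?s" "set ?s = UNIV" by auto
    have "x \<in> set (take n ?s)" if x: "x < ?s ! n" for x
    proof -
      obtain i where i: "i < length ?s" "?s ! i = x"
        using sd(3) by (metis UNIV_I in_set_conv_nth)
      then have "i < n"
        using x sd(1) n by (metis leD linorder_le_less_linear sorted_nth_mono)
      then show ?thesis using i n by (force simp: in_set_conv_nth)
    qed
    moreover have "x < ?s ! n" if x: "x \<in> set (take n ?s)" for x
    proof -
      obtain i where "i < n" "x = ?s ! i" using x n by (auto simp: in_set_conv_nth)
      then show ?thesis
        using sd n by (metis order.strict_trans order_le_less sorted_nth_mono nth_eq_iff_index_eq less_imp_neq)
    qed
    ultimately show ?thesis by blast
  qed
  then have "card {..<?s ! n} = n"
    using n by (simp add: distinct_card)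
  then show "map (\<lambda>a. xs ! card {..<a}) ?s ! n = xs ! n" using n by simp
qed

lemma count_map_sorted_list:
  "count (mset (map i (sorted_list_of_set (UNIV :: 'm::{finite,linorder} set)))) j = card {a. i a = j}"
proof -
  have "mset (map i (sorted_list_of_set (UNIV :: 'm set))) = image_mset i (mset_set UNIV)"
    by (metis mset_map mset_sorted_list_of_multiset sorted_list_of_mset_set)
  then show ?thesis
    by (simp add: count_image_mset vimage_def Int_def)
qed

text \<open>The monotone multi-index in which each \<open>j\<close> occurs \<open>l j\<close> times; meaningful if the \<open>l j\<close> sum to the
  number of slots.\<close>
definition basis_index :: "('d::{finite,linorder} \<Rightarrow> nat) \<Rightarrow> 'm::{finite,linorder} \<Rightarrow> 'd" where
  "basis_index l a =
     concat (map (\<lambda>j. replicate (l j) j) (sorted_list_of_set UNIV)) ! card {..<a}"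

lemma length_basis_list:
  "length (concat (map (\<lambda>j. replicate (l j) j) (sorted_list_of_set (UNIV :: 'd::{finite,linorder} set))))
     = (\<Sum>j\<in>UNIV. l j)"
  by (simp add: length_concat o_def sum_list_distinct_conv_sum_set)

context
  fixes l :: "'d::{finite,linorder} \<Rightarrow> nat"
  assumes sum_l: "(\<Sum>j\<in>UNIV. l j) = CARD('m::{finite,linorder})"
begin

lemma map_basis_index:
  "map (basis_index l :: 'm \<Rightarrow> 'd) (sorted_list_of_set UNIV)
     = concat (map (\<lambda>j. replicate (l j) j) (sorted_list_of_set UNIV))"
  unfolding basis_index_def[abs_def]
  by (rule map_eq_of_position) (simp only: length_basis_list sum_l)

lemma card_basis_index: "card {a :: 'm. basis_index l a = j} = l j"
proof -
  have "count (mset (concat (map (\<lambda>j. replicate (l j) j) xs))) j = (\<Sum>i\<leftarrow>xs. if i = j then l i else 0)"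
    for xs by (induction xs) auto
  then have "card {a :: 'm. basis_index l a = j} = (\<Sum>i\<leftarrow>sorted_list_of_set UNIV. if i = j then l i else 0)"
    by (simp only: map_basis_index flip: count_map_sorted_list)
  then show ?thesis by (simp add: sum_list_distinct_conv_sum_set)
qed

lemma mono_eq_if_card_eq:
  fixes i k :: "'m \<Rightarrow> 'd"
  assumes "mono i" "mono k" "\<And>j. card {a. i a = j} = card {a. k a = j}"
  shows "i = k"
proof -
  let ?s = "sorted_list_of_set (UNIV :: 'm set)"
  have "sorted (map i ?s)" if "mono i" for i :: "'m \<Rightarrow> 'd"
    using that by (simp add: sorted_map sorted_wrt_mono_rel[of _ "(\<le>)"] monoD)
  moreover have "mset (map i ?s) = mset (map k ?s)"
    by (rule multiset_eqI) (simp only: count_map_sorted_list assms(3))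
  ultimately have "map i ?s = map k ?s"
    using assms(1,2) by (metis properties_for_sort)
  then show ?thesis by (simp add: fun_eq_iff)
qed

lemma mono_basis_index: "mono (basis_index l :: 'm \<Rightarrow> 'd)"
proof (rule monoI)
  fix a b :: 'm assume "a \<le> b"
  let ?xs = "concat (map (\<lambda>j. replicate (l j) j) (sorted_list_of_set (UNIV :: 'd set)))"
  have "sorted (concat (map (\<lambda>j. replicate (l j) j) xs))" if "sorted xs" for xs
    using that by (induction xs) (auto simp: sorted_append)
  then have "sorted ?xs" by simp
  moreover have "card {..<a} \<le> card {..<b}"
    using \<open>a \<le> b\<close> by (intro card_mono) auto
  moreover have "card {..<b} < CARD('m)" by (intro psubset_card_mono) auto
  ultimately show "basis_index l a \<le> basis_index l b"
    unfolding basis_index_def by (intro sorted_nth_mono) (simp_all only: length_basis_list sum_l)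
qed

text \<open>A rearrangement of the factors contributes \<open>1\<close> at the multi-index \<open>i\<close> if it lists the basis
  vectors in the order given by \<open>i\<close>, and \<open>0\<close> otherwise.\<close>
lemma basis_sym_prod_nth:
  "(basis_sym_prod l :: ('m, 'd) tens) $ i
     = card {\<tau>. \<tau> permutes UNIV \<and> i = basis_index l \<circ> \<tau>} / fact CARD('m)"
proof -
  have fac: "basis_factors l ! card {..<a} = axis (basis_index l a) 1" for a :: 'm
  proof -
    have "basis_factors l = map (\<lambda>j. axis j 1) (concat (map (\<lambda>j. replicate (l j) j) (sorted_list_of_set UNIV)))"
      by (simp add: basis_factors_def map_concat o_def)
    moreover have "card {..<a} < CARD('m)" by (intro psubset_card_mono) auto
    ultimately show ?thesis
      unfolding basis_index_def by (simp only: nth_map length_basis_list sum_l)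
  qed
  have "tensor_prod ((\<lambda>a :: 'm. basis_factors l ! card {..<a}) \<circ> \<tau>) $ i
      = of_bool (i = basis_index l \<circ> \<tau>)" for \<tau> :: "'m \<Rightarrow> 'm"
  proof (cases "i = basis_index l \<circ> \<tau>")
    case False
    then obtain a where "i a \<noteq> basis_index l (\<tau> a)" by (auto simp: fun_eq_iff)
    then have "(\<Prod>a\<in>UNIV. axis (basis_index l (\<tau> a)) (1::real) $ i a) = 0"
      by (intro prod_zero) (auto simp: axis_def)
    then show ?thesis using False by (simp add: tensor_prod_def fac)
  qed (simp add: tensor_prod_def fac axis_def)
  then have "(basis_sym_prod l :: ('m, 'd) tens) $ i
      = (\<Sum>\<tau> | \<tau> permutes UNIV. of_bool (i = basis_index l \<circ> \<tau>)) / fact CARD('m)"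
    by (simp add: basis_sym_prod_def sym_prod_def sum_component)
  also have "(\<Sum>\<tau> | \<tau> permutes UNIV. of_bool (i = basis_index l \<circ> \<tau>) :: real)
      = card {\<tau>. \<tau> permutes UNIV \<and> i = basis_index l \<circ> \<tau>}"
    by (simp add: of_bool_def sum.If_cases Int_def)
  finally show ?thesis .
qed

lemma basis_sym_prod_at_basis_index:
  "0 < (basis_sym_prod l :: ('m, 'd) tens) $ basis_index l"
proof -
  have "id \<in> {\<tau>. \<tau> permutes UNIV \<and> basis_index l = (basis_index l :: 'm \<Rightarrow> 'd) \<circ> \<tau>}"
    by (simp add: permutes_id)
  then have "0 < card {\<tau>. \<tau> permutes UNIV \<and> basis_index l = (basis_index l :: 'm \<Rightarrow> 'd) \<circ> \<tau>}"
    by (metis (no_types, lifting) card_gt_0_iff empty_iff finite)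
  then show ?thesis by (simp only: basis_sym_prod_nth) simp
qed

lemma basis_sym_prod_eq_0:
  assumes "mono i" "i \<noteq> basis_index l"
  shows "(basis_sym_prod l :: ('m, 'd) tens) $ i = 0"
proof -
  have False if \<tau>: "\<tau> permutes UNIV" "i = basis_index l \<circ> \<tau>" for \<tau>
  proof -
    have "card {a. i a = j} = card {a :: 'm. basis_index l a = j}" for j
    proof -
      have "{a. basis_index l a = j} = \<tau> ` {a. i a = j}"
        using \<tau> permutes_surj[OF \<tau>(1)] by (auto simp: image_iff)
      then show ?thesis by (simp add: card_image permutes_inj_on[OF \<tau>(1)])
    qed
    then show False using mono_eq_if_card_eq[OF assms(1) mono_basis_index] assms(2) by blast
  qed
  then have "{\<tau>. \<tau> permutes UNIV \<and> i = basis_index l \<circ> \<tau>} = {}" by blast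
  then show ?thesis by (simp only: basis_sym_prod_nth) simp
qed

end

section \<open>A potential with prescribed mixed derivative\<close>

text \<open>Subtraction is truncated, so the left-hand side counts the derivatives in excess of \<open>l\<close>. Some
  direction has \<open>l i \<le> \<alpha> i\<close>, and there \<open>l i\<close> derivatives are saved.\<close>
lemma sum_monus_le:
  fixes \<alpha> l :: "'d::finite \<Rightarrow> nat"
  assumes "(\<Sum>i\<in>UNIV. \<alpha> i) = (\<Sum>i\<in>UNIV. l i)"
  shows "(\<Sum>i\<in>UNIV. \<alpha> i - l i) \<le> (\<Sum>i\<in>UNIV. l i) - Min (range l)"
proof -
  have "\<exists>i. l i \<le> \<alpha> i"
  proof (rule ccontr)
    assume "\<nexists>i. l i \<le> \<alpha> i"
    then have "(\<Sum>i\<in>UNIV. \<alpha> i) < (\<Sum>i\<in>UNIV. l i)"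
      by (intro sum_strict_mono) (auto simp: not_le)
    then show False using assms by simp
  qed
  then obtain i where i: "l i \<le> \<alpha> i" ..
  have "(\<Sum>j\<in>UNIV. \<alpha> j - l j) + l i = (\<Sum>j\<in>UNIV - {i}. \<alpha> j - l j) + \<alpha> i"
    using i by (subst sum.remove[of _ i]) auto
  also have "\<dots> \<le> (\<Sum>j\<in>UNIV - {i}. \<alpha> j) + \<alpha> i"
    by (intro add_mono sum_mono) auto
  also have "\<dots> = (\<Sum>j\<in>UNIV. l j)"
    unfolding assms[symmetric] by (subst (2) sum.remove[of _ i]) auto
  finally have "(\<Sum>j\<in>UNIV. \<alpha> j - l j) + l i \<le> (\<Sum>j\<in>UNIV. l j)" .
  moreover have "Min (range l) \<le> l i" by (intro Min_le) auto
  ultimately show ?thesis by linarith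
qed

text \<open>If, at the points where \<open>a\<close> does not vanish, the \<open>i\<close>-th factor is bounded by \<open>u i\<close> and vanishes outside
  \<open>[- s i, s i]\<close>, the integral is at most the
  product of the bounds times the volume of the box.\<close>
lemma abs_integral_tensor_kernel_le:
  fixes u s :: "'d::finite \<Rightarrow> real"
  assumes a: "\<And>y. \<bar>a y\<bar> \<le> 1"
    and int: "integrable lborel (\<lambda>y. a y * tensor_kernel E \<alpha> (x - y))"
    and s: "\<And>i. 0 \<le> s i" and u: "\<And>i. 0 \<le> u i"
    and le: "\<And>y i. a y \<noteq> 0 \<Longrightarrow> \<bar>E i (\<alpha> i) (x $ i - y $ i)\<bar> \<le> u i"
    and supp: "\<And>y i. a y \<noteq> 0 \<Longrightarrow> s i < \<bar>x $ i - y $ i\<bar> \<Longrightarrow> E i (\<alpha> i) (x $ i - y $ i) = 0"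
  shows "\<bar>tensor_conv a E \<alpha> x\<bar> \<le> (\<Prod>i\<in>UNIV. u i * (2 * s i))"
proof -
  define p q :: "real ^ 'd" where "p = (\<chi> i. x $ i - s i)" and "q = (\<chi> i. x $ i + s i)"
  have "p $ i \<le> q $ i" for i using s[of i] by (simp add: p_def q_def)
  then have "cbox p q \<noteq> {}" by (simp add: interval_ne_empty_cart)
  then have m: "measure lborel (cbox p q) = (\<Prod>i\<in>UNIV. 2 * s i)"
    by (simp add: content_cbox_cart p_def q_def)
  have "\<bar>tensor_conv a E \<alpha> x\<bar> \<le> (\<integral>y. (\<Prod>i\<in>UNIV. u i) * indicator (cbox p q) y \<partial>lborel)"
    unfolding tensor_conv_def
  proof (rule abs_integral_le[OF int])
    show "integrable lborel (\<lambda>y. (\<Prod>i\<in>UNIV. u i) * indicator (cbox p q) y)"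
      by (intro integrable_mult_right integrable_real_indicator)
         (simp_all add: emeasure_bounded_finite[unfolded infinity_ennreal_def])
    fix y
    show "\<bar>a y * tensor_kernel E \<alpha> (x - y)\<bar> \<le> (\<Prod>i\<in>UNIV. u i) * indicator (cbox p q) y"
    proof (cases "a y = 0 \<or> tensor_kernel E \<alpha> (x - y) = 0")
      case True
      then show ?thesis using u by (auto simp: indicator_def intro!: prod_nonneg)
    next
      case False
      then have "E i (\<alpha> i) (x $ i - y $ i) \<noteq> 0" for i
        by (auto simp: tensor_kernel_def)
      then have "\<bar>x $ i - y $ i\<bar> \<le> s i" for i using supp[of y i] False by force
      then have "y \<in> cbox p q"
        by (auto simp: mem_box_cart p_def q_def abs_le_iff algebra_simps)
      moreover have "\<bar>a y\<bar> * \<bar>tensor_kernel E \<alpha> (x - y)\<bar> \<le> 1 * (\<Prod>i\<in>UNIV. u i)"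
        unfolding tensor_kernel_def abs_prod
        by (intro mult_mono a prod_mono) (use False le in \<open>auto intro: prod_nonneg\<close>)
      ultimately show ?thesis by (simp add: abs_mult)
    qed
  qed
  also have "\<dots> = (\<Prod>i\<in>UNIV. u i * (2 * s i))" by (simp add: m prod.distrib)
  finally show ?thesis .
qed

context bump
begin

lemma ex_uniform_bound: "\<exists>M. \<forall>k\<le>m. \<forall>t. \<bar>b k t\<bar> \<le> M"
proof -
  have "\<exists>M. \<forall>t. \<bar>b k t\<bar> \<le> M" for k
  proof -
    have "bounded (range (b k))"
      by (rule uniformly_continuous_bounded_support(2)[OF derivative_chain_continuous[OF chain], of 1])
         (use supp in auto)
    then show ?thesis by (auto simp: bounded_iff)
  qed
  then obtain M where M: "\<And>k t. \<bar>b k t\<bar> \<le> M k" by metis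
  have "\<bar>b k t\<bar> \<le> Max (M ` {..m})" if "k \<le> m" for k t
    using that by (intro order_trans[OF M] Max_ge) auto
  then show ?thesis by blast
qed

text \<open>In each variable, an \<open>l i\<close>-fold primitive of the kernel \<open>\<mu> b(\<mu> t)\<close>, with compact support. The
  derivatives of order less than \<open>l i\<close> are bounded independently of \<open>\<mu>\<close>.\<close>
lemma ex_kernel_chain:
  assumes R: "1 \<le> R" and \<mu>: "1 \<le> \<mu>" and M: "\<And>t. \<bar>b 0 t\<bar> \<le> M"
  obtains E :: "'d::finite \<Rightarrow> nat \<Rightarrow> real \<Rightarrow> real" and \<rho> where
    "\<And>i. derivative_chain (E i)" "\<And>i n t. \<rho> \<le> \<bar>t\<bar> \<Longrightarrow> E i n t = 0"
    "\<And>i n t. \<bar>t\<bar> \<le> R - 1 \<Longrightarrow> l i \<le> n \<Longrightarrow> E i n t = scaled_chain b \<mu> (n - l i) t"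
    "\<And>i n t. \<bar>t\<bar> \<le> R - 1 \<Longrightarrow> n < l i \<Longrightarrow> \<bar>E i n t\<bar> \<le> R ^ l i * (2 * M)"
proof -
  let ?\<beta> = "scaled_chain b \<mu>"
  have M0: "0 \<le> M" using M[of 0] by simp
  have "\<exists>E r. derivative_chain E \<and> (\<forall>n t. t \<le> - 1 \<or> r \<le> t \<longrightarrow> E n t = 0) \<and>
    (\<forall>n t. t \<le> R - 1 \<and> l i \<le> n \<longrightarrow> E n t = ?\<beta> (n - l i) t) \<and>
    (\<forall>n t. t \<le> R - 1 \<and> n < l i \<longrightarrow> \<bar>E n t\<bar> \<le> R ^ (l i - n - 1) * (2 * M))" for i :: 'd
  proof (rule ex_iterated_antiderivative)
    show "derivative_chain ?\<beta>" by (rule derivative_chain_scaled[OF chain])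
    show "?\<beta> n t = 0" if "1 \<le> \<bar>t\<bar>" for n t
    proof (rule scaled_support)
      have "1 / \<mu> \<le> 1" using \<mu> by simp
      then show "1 / \<mu> \<le> \<bar>t\<bar>" using that by linarith
    qed (use \<mu> in simp)
    show "\<bar>window_integral R (?\<beta> 0) t\<bar> \<le> 2 * M" for t
    proof -
      have "\<bar>window_integral R (?\<beta> 0) t\<bar> \<le> 2 * (1 / \<mu>) * (\<mu> * M)"
      proof (rule window_integral_le_support)
        show "continuous_on UNIV (?\<beta> 0)"
          by (rule derivative_chain_continuous[OF derivative_chain_scaled[OF chain]])
        show "\<bar>?\<beta> 0 u\<bar> \<le> \<mu> * M" for u
          using M[of "\<mu> * u"] \<mu> by (simp add: scaled_chain_def abs_mult)
        show "?\<beta> 0 u = 0" if "1 / \<mu> \<le> \<bar>u\<bar>" for u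
          by (rule scaled_support) (use \<mu> that in auto)
      qed (use \<mu> in simp)
      then show ?thesis using \<mu> by simp
    qed
  qed (use R in simp)
  then obtain E r where E: "\<And>i :: 'd. derivative_chain (E i)"
    and r: "\<And>i n t. t \<le> - 1 \<or> r i \<le> t \<Longrightarrow> E i n t = 0"
    and eq: "\<And>i n t. t \<le> R - 1 \<Longrightarrow> l i \<le> n \<Longrightarrow> E i n t = ?\<beta> (n - l i) t"
    and le: "\<And>i n t. t \<le> R - 1 \<Longrightarrow> n < l i \<Longrightarrow> \<bar>E i n t\<bar> \<le> R ^ (l i - n - 1) * (2 * M)"
    by metis
  show thesis
  proof (rule that[of E "max 1 (Max (range r))"])
    show "E i n t = 0" if "max 1 (Max (range r)) \<le> \<bar>t\<bar>" for i n t
    proof -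
      have "r i \<le> Max (range r)" by (intro Max_ge) auto
      then show ?thesis using that by (intro r) linarith
    qed
    show "\<bar>E i n t\<bar> \<le> R ^ l i * (2 * M)" if "\<bar>t\<bar> \<le> R - 1" "n < l i" for i n t
    proof -
      have "\<bar>E i n t\<bar> \<le> R ^ (l i - n - 1) * (2 * M)" using that by (intro le) auto
      also have "\<dots> \<le> R ^ l i * (2 * M)"
        using R M0 by (intro mult_right_mono power_increasing) auto
      finally show ?thesis .
    qed
  qed (use E eq in auto)
qed

text \<open>The test function \<open>\<phi>\<close> whose derivative of multi-order \<open>l\<close> is the mollified \<open>a\<close> on \<open>\<Omega>\<close>, with bounds
  on all derivatives of the same total order. It is the convolution of \<open>a\<close> with the product of
  the kernels from \<open>ex_kernel_chain\<close>.\<close>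
lemma ex_potential:
  fixes l :: "'d::finite \<Rightarrow> nat"
  assumes "bounded \<Omega>"
  shows "\<exists>C>0. \<forall>\<mu> a. 1 \<le> \<mu> \<longrightarrow> a \<in> borel_measurable borel \<longrightarrow> (\<forall>x. \<bar>a x\<bar> \<le> 1) \<longrightarrow> (\<forall>x. x \<notin> \<Omega> \<longrightarrow> a x = 0) \<longrightarrow>
      (\<exists>\<phi> \<in> test_functions UNIV.
        (\<forall>is. (\<forall>j. count_list is j = l j) \<longrightarrow>
           (\<forall>x\<in>\<Omega>. iter_partial is \<phi> x = (\<integral>y. a y * mollifier \<mu> (x - y) \<partial>lborel))) \<and>
        (\<forall>is. length is = (\<Sum>j\<in>UNIV. l j) \<longrightarrow>
           (\<forall>x\<in>\<Omega>. \<bar>iter_partial is \<phi> x\<bar> \<le> C * \<mu> ^ ((\<Sum>j\<in>UNIV. l j) - Min (range l)))))"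
proof -
  obtain c where c: "\<And>x. x \<in> \<Omega> \<Longrightarrow> norm x \<le> c" using assms bounded_iff by blast
  \<comment> \<open>\<open>R - 1\<close> bounds the differences of the coordinates of two points of \<open>\<Omega>\<close>.\<close>
  define R where "R = 2 * \<bar>c\<bar> + 1"
  have R: "1 \<le> R" by (simp add: R_def)
  have diff: "\<bar>x $ i - y $ i\<bar> \<le> R - 1" if "x \<in> \<Omega>" "y \<in> \<Omega>" for x y i
    using component_le_norm_cart[of "x - y" i] norm_triangle_ineq4[of x y] c[OF that(1)] c[OF that(2)]
    by (simp add: R_def)
  define m where "m = (\<Sum>j\<in>UNIV. l j)"
  have lm: "l i \<le> m" for i unfolding m_def by (rule member_le_sum) auto
  obtain M where M: "\<And>k t. k \<le> m \<Longrightarrow> \<bar>b k t\<bar> \<le> M" using ex_uniform_bound by blast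
  have M0: "0 \<le> M" using M[of 0 0] by simp
  define M' where "M' = R ^ m * (2 * M)"
  have M'0: "0 \<le> M'" using M0 R by (simp add: M'_def)
  have RM: "R ^ l i * (2 * M) \<le> M'" for i
    unfolding M'_def using R M0 lm by (intro mult_right_mono power_increasing) auto
  have MM': "M \<le> M'"
  proof -
    have "1 * M \<le> R ^ m * (2 * M)" using R M0 by (intro mult_mono) auto
    then show ?thesis by (simp add: M'_def)
  qed
  define C where "C = (2 * R * M') ^ CARD('d) + 1"
  have "0 \<le> (2 * R * M') ^ CARD('d)" using M'0 R by simp
  then have C0: "0 < C" by (simp add: C_def)
  show ?thesis
  proof (intro exI[of _ C] conjI C0 allI impI)
    fix \<mu> :: real and a :: "real ^ 'd \<Rightarrow> real"
    assume \<mu>: "1 \<le> \<mu>" and a: "a \<in> borel_measurable borel" and "\<forall>x. \<bar>a x\<bar> \<le> 1"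
      and "\<forall>x. x \<notin> \<Omega> \<longrightarrow> a x = 0"
    then have a1: "\<And>x. \<bar>a x\<bar> \<le> 1" and a0: "\<And>x. x \<notin> \<Omega> \<Longrightarrow> a x = 0" by auto
    obtain E :: "'d \<Rightarrow> nat \<Rightarrow> real \<Rightarrow> real" and \<rho> where
      E: "\<And>i. derivative_chain (E i)" and \<rho>: "\<And>i n t. \<rho> \<le> \<bar>t\<bar> \<Longrightarrow> E i n t = 0"
      and eq: "\<And>i n t. \<bar>t\<bar> \<le> R - 1 \<Longrightarrow> l i \<le> n \<Longrightarrow> E i n t = scaled_chain b \<mu> (n - l i) t"
      and le: "\<And>i n t. \<bar>t\<bar> \<le> R - 1 \<Longrightarrow> n < l i \<Longrightarrow> \<bar>E i n t\<bar> \<le> R ^ l i * (2 * M)"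
      using ex_kernel_chain[OF R \<mu>, of M l] M[of 0] by blast
    have ia: "integrable lborel a" by (rule integrable_bounded_support[OF a a1 assms a0])
    obtain BE where BE: "\<And>n z. \<bar>tensor_kernel E n z\<bar> \<le> BE n"
    proof -
      have "\<exists>B. \<forall>z. \<bar>tensor_kernel E n z\<bar> \<le> B" for n
        using bounded_tensor_kernel[where D=E and n=n, OF E \<rho>] by (auto simp: bounded_iff)
      then show thesis using that by metis
    qed
    have iE: "integrable lborel (\<lambda>y. a y * tensor_kernel E n (x - y))" for n x
      by (rule integrable_mult_bounded[OF ia continuous_translate_measurable BE])
         (rule continuous_tensor_kernel[where D=E, OF E \<rho>])
    define \<phi> where "\<phi> = tensor_conv a E (\<lambda>_. 0)"
    have it: "iter_partial is \<phi> = tensor_conv a E (count_list is)" for "is"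
      unfolding \<phi>_def using iter_partial_tensor_conv[where D=E, OF E \<rho> ia] by simp
    show "\<exists>\<phi> \<in> test_functions UNIV.
        (\<forall>is. (\<forall>j. count_list is j = l j) \<longrightarrow>
           (\<forall>x\<in>\<Omega>. iter_partial is \<phi> x = (\<integral>y. a y * mollifier \<mu> (x - y) \<partial>lborel))) \<and>
        (\<forall>is. length is = (\<Sum>j\<in>UNIV. l j) \<longrightarrow>
           (\<forall>x\<in>\<Omega>. \<bar>iter_partial is \<phi> x\<bar> \<le> C * \<mu> ^ ((\<Sum>j\<in>UNIV. l j) - Min (range l))))"
    proof (intro bexI[of _ \<phi>] conjI allI impI ballI)
      show "\<phi> \<in> test_functions UNIV"
        unfolding \<phi>_def
      proof (rule tensor_conv_test_function[where D=E and \<rho>=\<rho> and p=0 and r=c, OF E \<rho> ia])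
        show "a y = 0" if "y \<notin> cball 0 c" for y using that c[of y] a0[of y] by auto
      qed auto
    next
      fix "is" :: "'d list" and x assume "is": "\<forall>j. count_list is j = l j" and x: "x \<in> \<Omega>"
      have z: "a y * tensor_kernel E l (x - y) = a y * mollifier \<mu> (x - y)" for y
      proof (cases "y \<in> \<Omega>")
        case True
        then show ?thesis using eq[OF diff[OF x True]] by (simp add: tensor_kernel_def mollifier_def)
      qed (simp add: a0)
      have "count_list is = l" using "is" by auto
      then show "iter_partial is \<phi> x = (\<integral>y. a y * mollifier \<mu> (x - y) \<partial>lborel)"
        by (simp only: it tensor_conv_def z)
    next
      fix "is" :: "'d list" and x assume len: "length is = (\<Sum>j\<in>UNIV. l j)" and x: "x \<in> \<Omega>"
      define \<alpha> where "\<alpha> = count_list is"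
      have sum_\<alpha>: "(\<Sum>i\<in>UNIV. \<alpha> i) = (\<Sum>i\<in>UNIV. l i)"
        unfolding \<alpha>_def len[symmetric] by (rule sum_count_set) auto
      have \<alpha>m: "\<alpha> i \<le> m" for i unfolding m_def sum_\<alpha>[symmetric] by (rule member_le_sum) auto
      \<comment> \<open>A factor with \<open>l i \<le> \<alpha> i\<close> is a derivative of the concentrated kernel, of height \<open>\<mu>\<close> to the power
        \<open>\<alpha> i - l i + 1\<close> and width \<open>1 / \<mu>\<close>; the others are only bounded, on an interval of length of order \<open>R\<close>.\<close>
      define u where "u i = (if l i \<le> \<alpha> i then \<mu> ^ (\<alpha> i - l i + 1) * M' else M')" for i
      define s where "s i = (if l i \<le> \<alpha> i then 1 / \<mu> else R)" for i
      have "\<bar>tensor_conv a E \<alpha> x\<bar> \<le> (\<Prod>i\<in>UNIV. u i * (2 * s i))"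
      proof (rule abs_integral_tensor_kernel_le[OF a1 iE])
        fix y i assume "a y \<noteq> 0"
        then have "y \<in> \<Omega>" using a0 by blast
        note d = diff[OF x this, of i]
        show "\<bar>E i (\<alpha> i) (x $ i - y $ i)\<bar> \<le> u i"
        proof (cases "l i \<le> \<alpha> i")
          case True
          have "\<bar>b (\<alpha> i - l i) (\<mu> * (x $ i - y $ i))\<bar> \<le> M'"
            using \<alpha>m[of i] by (intro order_trans[OF M MM']) linarith
          then show ?thesis
            using True \<mu> by (simp add: eq[OF d True] u_def scaled_chain_def abs_mult)
        next
          case False
          then show ?thesis using order_trans[OF le[OF d, of "\<alpha> i"] RM] by (simp add: u_def)
        qed
        assume s: "s i < \<bar>x $ i - y $ i\<bar>"
        then have l: "l i \<le> \<alpha> i" using d by (auto simp: s_def split: if_splits)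
        then show "E i (\<alpha> i) (x $ i - y $ i) = 0"
          unfolding eq[OF d l] using s \<mu> by (intro scaled_support) (auto simp: s_def)
      qed (use \<mu> R M'0 in \<open>auto simp: s_def u_def\<close>)
      also have "\<dots> \<le> (\<Prod>i\<in>UNIV. (2 * R * M') * \<mu> ^ (\<alpha> i - l i))"
      proof (intro prod_mono conjI)
        fix i
        show "0 \<le> u i * (2 * s i)" using \<mu> R M'0 by (auto simp: s_def u_def)
        show "u i * (2 * s i) \<le> (2 * R * M') * \<mu> ^ (\<alpha> i - l i)"
        proof (cases "l i \<le> \<alpha> i")
          case True
          have "u i * (2 * s i) = (2 * 1 * M') * \<mu> ^ (\<alpha> i - l i)"
            using True \<mu> by (simp add: u_def s_def)
          also have "\<dots> \<le> (2 * R * M') * \<mu> ^ (\<alpha> i - l i)"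
            using R M'0 \<mu> by (intro mult_right_mono mult_left_mono) auto
          finally show ?thesis .
        qed (use R M'0 in \<open>simp add: u_def s_def\<close>)
      qed
      also have "\<dots> = (2 * R * M') ^ CARD('d) * \<mu> ^ (\<Sum>i\<in>UNIV. \<alpha> i - l i)"
        by (simp add: prod.distrib power_sum)
      also have "\<dots> \<le> C * \<mu> ^ ((\<Sum>j\<in>UNIV. l j) - Min (range l))"
        using \<mu> C0 sum_monus_le[OF sum_\<alpha>]
        by (intro mult_mono power_increasing) (auto simp: C_def)
      finally show "\<bar>iter_partial is \<phi> x\<bar> \<le> C * \<mu> ^ ((\<Sum>j\<in>UNIV. l j) - Min (range l))"
        by (simp add: it \<alpha>_def)
    qed
  qed
qed

end

section \<open>The lower energy bound\<close>

lemma Cauchy_Schwarz_integral_indicator: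
  fixes h :: "'a::euclidean_space \<Rightarrow> real"
  assumes h: "h \<in> borel_measurable lebesgue" "\<And>x. 0 \<le> h x" "\<And>x. x \<notin> S \<Longrightarrow> h x = 0"
    and S: "S \<in> lmeasurable" and h2: "integrable lebesgue (\<lambda>x. (h x)\<^sup>2)"
  shows "integrable lebesgue h" and "(\<integral>x. h x \<partial>lebesgue) \<le> sqrt (measure lebesgue S * (\<integral>x. (h x)\<^sup>2 \<partial>lebesgue))"
proof -
  have iS: "integrable lebesgue (indicator S :: 'a \<Rightarrow> real)"
    using S by (intro integrable_real_indicator) (auto simp: fmeasurable_def)
  show ih: "integrable lebesgue h"
  proof (rule Bochner_Integration.integrable_bound)
    show "integrable lebesgue (\<lambda>x. (h x)\<^sup>2 + indicator S x)" using h2 iS by simp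
    show "AE x in lebesgue. norm (h x) \<le> norm ((h x)\<^sup>2 + indicator S x)"
    proof (intro AE_I2)
      fix x
      have "0 \<le> (h x - 1)\<^sup>2" by simp
      then have "h x \<le> (h x)\<^sup>2 + 1" using h(2)[of x] unfolding power2_diff by simp
      then show "norm (h x) \<le> norm ((h x)\<^sup>2 + indicator S x)"
        using h(2,3)[of x] by (auto simp: indicator_def)
    qed
  qed fact
  define I where "I = (\<integral>x. h x \<partial>lebesgue)"
  define J where "J = (\<integral>x. (h x)\<^sup>2 \<partial>lebesgue)"
  define s where "s = measure lebesgue S"
  have I: "0 \<le> I" unfolding I_def using h(2) by simp
  \<comment> \<open>Integrate \<open>(h - t)\<^sup>2 \<ge> 0\<close> over \<open>S\<close>; below, \<open>t = I / s\<close> is optimal.\<close>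
  have q: "2 * t * I \<le> J + t\<^sup>2 * s" for t
  proof -
    have "(\<integral>x. 2 * t * h x \<partial>lebesgue) \<le> (\<integral>x. (h x)\<^sup>2 + t\<^sup>2 * indicator S x \<partial>lebesgue)"
    proof (rule integral_mono)
      show "2 * t * h x \<le> (h x)\<^sup>2 + t\<^sup>2 * indicator S x" for x
      proof (cases "x \<in> S")
        case True
        have "0 \<le> (h x - t)\<^sup>2" by simp
        then show ?thesis using True by (simp add: power2_diff mult_ac)
      qed (simp add: h)
    qed (use ih h2 iS in auto)
    also have "\<dots> = J + t\<^sup>2 * s" using h2 iS by (simp add: J_def s_def)
    finally show ?thesis by (simp add: I_def)
  qed
  have "I\<^sup>2 \<le> s * J"
  proof (cases "s = 0")
    case True
    have J: "0 \<le> J" unfolding J_def by simp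
    have "I = 0"
    proof (rule ccontr)
      assume "I \<noteq> 0"
      then show False using q[of "(J + 1) / I"] I J True by simp
    qed
    then show ?thesis using True by simp
  next
    case False
    then have s: "0 < s" by (simp add: s_def zero_less_measure_iff)
    have "2 * (I / s) * I \<le> J + (I / s)\<^sup>2 * s" by (rule q)
    then show ?thesis using s by (simp add: field_simps power2_eq_square)
  qed
  then have "I \<le> sqrt (s * J)" by (rule real_le_rsqrt)
  then show "(\<integral>x. h x \<partial>lebesgue) \<le> sqrt (measure lebesgue S * (\<integral>x. (h x)\<^sup>2 \<partial>lebesgue))"
    by (simp add: I_def s_def J_def)
qed

lemma measurable_vec_nth:
  fixes f :: "'a \<Rightarrow> ('b::topological_space) ^ 'n::finite"
  assumes "f \<in> borel_measurable M"
  shows "(\<lambda>x. f x $ i) \<in> borel_measurable M"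
  by (rule measurable_compose[OF assms])
     (intro borel_measurable_continuous_onI continuous_on_component continuous_on_id)

context bump
begin

text \<open>The interpolation inequality. Its constants depend on \<open>\<Omega>\<close>, \<open>v\<close> and \<open>l\<close>, but not on \<open>lam\<close>.\<close>
lemma elastic_energy_estimate:
  fixes \<Omega> :: "(real ^ 'd::{finite,linorder}) set" and v :: "real ^ 'k::finite"
    and l :: "'d \<Rightarrow> nat"
  assumes \<Omega>: "open \<Omega>" "bounded \<Omega>" "\<Omega> \<noteq> {}" "negligible (frontier \<Omega>)" and v: "v \<noteq> 0"
    and sum_l: "(\<Sum>j\<in>UNIV. l j) = CARD('m::{finite,linorder})"
  shows "\<exists>C \<mu>\<^sub>0. 0 < C \<and> 1 \<le> \<mu>\<^sub>0 \<and>
    (\<forall>lam (A :: ('m, 'd, 'k) tens_rows) B F X u V W \<mu>.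
      0 < lam \<longrightarrow> lam < 1 \<longrightarrow> A - B = row_tensor v (basis_sym_prod l) \<longrightarrow>
      F = lam *\<^sub>R A + (1 - lam) *\<^sub>R B \<longrightarrow>
      set_integrable lebesgue \<Omega> X \<longrightarrow> (\<forall>x\<in>\<Omega>. X x \<in> {A, B}) \<longrightarrow>
      total_variation \<Omega> X \<le> ennreal V \<longrightarrow> 0 \<le> V \<longrightarrow> u \<in> admissible \<Omega> F \<longrightarrow>
      (\<integral>\<^sup>+x\<in>\<Omega>. ennreal ((norm (u x - X x))\<^sup>2) \<partial>lebesgue) = ennreal W \<longrightarrow> 0 \<le> W \<longrightarrow> \<mu>\<^sub>0 \<le> \<mu> \<longrightarrow>
      min lam (1 - lam) \<le> C * (V / \<mu> + \<mu> ^ (CARD('m) - Min (range l)) * sqrt W))"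
proof -
  obtain j where j: "v $ j \<noteq> 0" using v by (auto simp: vec_eq_iff)
  define k where "k = (basis_index l :: 'm \<Rightarrow> 'd)"
  define T where "T = (basis_sym_prod l :: ('m, 'd) tens)"
  define \<kappa> where "\<kappa> = v $ j * T $ k"
  have Tk: "0 < T $ k" unfolding T_def k_def by (rule basis_sym_prod_at_basis_index[OF sum_l])
  have T0: "T $ i = 0" if "mono i" "i \<noteq> k" for i
    unfolding T_def by (rule basis_sym_prod_eq_0[OF sum_l]) (use that in \<open>simp_all add: k_def\<close>)
  have \<kappa>: "0 < \<bar>\<kappa>\<bar>" using j Tk by (simp add: \<kappa>_def)
  obtain x0 r where r: "0 < r" "cball x0 (4 * r) \<subseteq> \<Omega>"
  proof -
    obtain x0 where "x0 \<in> \<Omega>" using \<Omega> by blast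
    then obtain e where e: "0 < e" "cball x0 e \<subseteq> \<Omega>" using \<Omega>(1) open_contains_cball by blast
    show thesis using that[of "e / 4" x0] e by simp
  qed
  define L where "L = CARD('m) - Min (range l)"
  obtain C1 where C1: "0 < C1" and pot:
    "\<forall>\<mu> a. 1 \<le> \<mu> \<longrightarrow> a \<in> borel_measurable borel \<longrightarrow> (\<forall>x. \<bar>a x\<bar> \<le> 1) \<longrightarrow> (\<forall>x. x \<notin> \<Omega> \<longrightarrow> a x = 0) \<longrightarrow>
      (\<exists>\<phi> \<in> test_functions UNIV.
        (\<forall>is. (\<forall>j. count_list is j = l j) \<longrightarrow>
           (\<forall>x\<in>\<Omega>. iter_partial is \<phi> x = (\<integral>y. a y * mollifier \<mu> (x - y) \<partial>lborel))) \<and>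
        (\<forall>is. length is = (\<Sum>j\<in>UNIV. l j) \<longrightarrow>
           (\<forall>x\<in>\<Omega>. \<bar>iter_partial is \<phi> x\<bar> \<le> C1 * \<mu> ^ ((\<Sum>j\<in>UNIV. l j) - Min (range l)))))"
    using ex_potential[OF \<Omega>(2), of l] by (elim exE conjE)
  define Z where "Z = mass TYPE('d)"
  have Z: "0 < Z" unfolding Z_def by (rule mass_pos)
  define q where "q = measure lborel (cball x0 r)"
  have q: "0 < q" unfolding q_def using r by (simp add: content_cball_pos)
  define n where "n = real CARD('d)"
  have n: "0 < n" by (simp add: n_def)
  define K where "K = real (card {i :: 'm \<Rightarrow> 'd. mono i}) * C1 * sqrt (measure lebesgue \<Omega>)"
  have K: "0 \<le> K" using C1 by (simp add: K_def)
  define C where "C = n / (q * \<bar>\<kappa>\<bar>) + K / (\<bar>\<kappa>\<bar> * Z * q)"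
  have C0: "0 < C" unfolding C_def using n q \<kappa> K Z by (intro add_pos_nonneg) auto
  \<comment> \<open>From \<open>\<mu>\<^sub>0\<close> on, the mollifier is supported in the ball of radius \<open>r\<close>.\<close>
  define \<mu>\<^sub>0 where "\<mu>\<^sub>0 = max 1 (n / r)"
  have \<Omega>lm: "\<Omega> \<in> lmeasurable" using \<Omega> by (simp add: lmeasurable_open)
  show ?thesis
  proof (rule exI[of _ C], rule exI[of _ \<mu>\<^sub>0], intro conjI C0 allI impI)
    show "1 \<le> \<mu>\<^sub>0" by (simp add: \<mu>\<^sub>0_def)
    fix lam :: real and A B F :: "('m, 'd, 'k) tens_rows" and X u and V W \<mu> :: real
    assume lam: "0 < lam" "lam < 1" and AB: "A - B = row_tensor v (basis_sym_prod l)"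
      and F: "F = lam *\<^sub>R A + (1 - lam) *\<^sub>R B"
      and X: "set_integrable lebesgue \<Omega> X" "\<forall>x\<in>\<Omega>. X x \<in> {A, B}"
      and V: "total_variation \<Omega> X \<le> ennreal V" "0 \<le> V" and u: "u \<in> admissible \<Omega> F"
      and W: "(\<integral>\<^sup>+x\<in>\<Omega>. ennreal ((norm (u x - X x))\<^sup>2) \<partial>lebesgue) = ennreal W" "0 \<le> W"
      and \<mu>: "\<mu>\<^sub>0 \<le> \<mu>"
    have \<mu>1: "1 \<le> \<mu>" and \<mu>r: "n / \<mu> \<le> r" using \<mu> r n by (auto simp: \<mu>\<^sub>0_def field_simps)
    have ABi: "(A - B) $ j $ i = v $ j * T $ i" for i
      by (simp add: AB row_tensor_def T_def)
    have \<kappa>le: "\<bar>\<kappa>\<bar> \<le> norm (A - B)"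
    proof -
      have "\<bar>\<kappa>\<bar> = norm ((A - B) $ j $ k)" by (simp only: ABi \<kappa>_def real_norm_def)
      also have "\<dots> \<le> norm (A - B)" by (intro order_trans[OF Finite_Cartesian_Product.norm_nth_le Finite_Cartesian_Product.norm_nth_le])
      finally show ?thesis .
    qed
    then have neq: "A \<noteq> B" using \<kappa> by auto
    obtain g a :: "(real, 'd) vec \<Rightarrow> real" where
      g: "g \<in> borel_measurable borel" "\<And>x. \<bar>g x\<bar> \<le> 1" "\<And>x. x \<notin> \<Omega> \<Longrightarrow> g x = 0"
      and gX: "AE x in lebesgue. x \<in> \<Omega> \<longrightarrow> X x - F = g x *\<^sub>R (A - B)"
      and a: "a \<in> borel_measurable borel" "\<And>x. \<bar>a x\<bar> \<le> 1" "\<And>x. x \<notin> cball x0 r \<Longrightarrow> a x = 0"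
      and corr: "\<And>z. norm z \<le> r \<Longrightarrow> min lam (1 - lam) * measure lborel (cball x0 r) - norm z * V / norm (A - B)
       \<le> (\<integral>x. g x * a (x - z) \<partial>lborel)"
      using phase_correlation_ge[OF \<Omega>(1,2) r lam neq F X(1) bspec[OF X(2)] V] by blast
    have a\<Omega>: "a x = 0" if "x \<notin> \<Omega>" for x
    proof (rule a(3))
      have "cball x0 r \<subseteq> cball x0 (4 * r)" using r by (intro subset_cball) simp
      then show "x \<notin> cball x0 r" using that r by blast
    qed
    have a': "\<forall>x. \<bar>a x\<bar> \<le> 1" "\<forall>x. x \<notin> \<Omega> \<longrightarrow> a x = 0" using a(2) a\<Omega> by auto
    obtain \<phi> where \<phi>: "\<phi> \<in> test_functions UNIV"
      and \<phi>': "(\<forall>is. (\<forall>j. count_list is j = l j) \<longrightarrow>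
           (\<forall>x\<in>\<Omega>. iter_partial is \<phi> x = (\<integral>y. a y * mollifier \<mu> (x - y) \<partial>lborel))) \<and>
        (\<forall>is. length is = (\<Sum>j\<in>UNIV. l j) \<longrightarrow>
           (\<forall>x\<in>\<Omega>. \<bar>iter_partial is \<phi> x\<bar> \<le> C1 * \<mu> ^ ((\<Sum>j\<in>UNIV. l j) - Min (range l))))"
      using pot[THEN spec[of _ \<mu>], THEN spec[of _ a], THEN mp, OF \<mu>1, THEN mp, OF a(1),
          THEN mp, OF a'(1), THEN mp, OF a'(2)] by (elim bexE)
    have \<phi>l: "iter_partial is \<phi> x = (\<integral>y. a y * mollifier \<mu> (x - y) \<partial>lborel)"
      if "\<And>j. count_list is j = l j" "x \<in> \<Omega>" for "is" x
      using \<phi>'[THEN conjunct1, rule_format, OF that] .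
    have \<phi>le: "\<bar>iter_partial is \<phi> x\<bar> \<le> C1 * \<mu> ^ L" if "length is = CARD('m)" "x \<in> \<Omega>" for "is" x
      using \<phi>'[THEN conjunct2, rule_format, of "is" x] that by (simp add: sum_l L_def)
    define Q where "Q i = iter_partial (map i (sorted_list_of_set (UNIV :: 'm set))) \<phi>" for i :: "'m \<Rightarrow> 'd"
    have Q: "Q i \<in> test_functions UNIV" for i
      unfolding Q_def by (rule test_function_iter_partial[OF \<phi>])
    have Qc: "continuous_on UNIV (Q i)" for i by (rule test_function_continuous[OF Q])
    have Qm: "Q i \<in> borel_measurable borel" for i by (rule borel_measurable_continuous_onI[OF Qc])
    have Qm': "Q i \<in> borel_measurable lebesgue" for i
      by (rule measurable_completion) (use Qm in simp)
    have Qle: "\<bar>Q i x\<bar> \<le> C1 * \<mu> ^ L" if "x \<in> \<Omega>" for i x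
      unfolding Q_def using that by (intro \<phi>le) simp_all
    have intQ: "(\<integral>x. Q i x \<partial>lebesgue) = 0" and iQ: "integrable lebesgue (Q i)" for i
    proof -
      have "map i (sorted_list_of_set (UNIV :: 'm set)) \<noteq> []"
        by (simp add: sorted_list_of_set_eq_Nil_iff)
      then show "(\<integral>x. Q i x \<partial>lebesgue) = 0"
        using integral_iter_partial_test_function[OF \<phi>] Qm[of i] by (simp add: integral_completion Q_def)
      show "integrable lebesgue (Q i)"
        using test_function_integrable[OF Q] Qm[of i] by (simp add: integrable_completion)
    qed
    \<comment> \<open>\<open>h\<close> is the norm of the misfit \<open>u - X\<close> on \<open>\<Omega>\<close>, and \<open>e i\<close> its component at row \<open>j\<close> and index \<open>i\<close>.\<close>
    define h where "h x = norm (indicator \<Omega> x *\<^sub>R (u x - X x))" for x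
    have um: "u \<in> borel_measurable lebesgue" using u by (simp add: admissible_def L2_loc_def)
    have Xm: "(\<lambda>x. indicator \<Omega> x *\<^sub>R X x) \<in> borel_measurable lebesgue"
      using X(1) unfolding set_integrable_def by auto
    have [measurable]: "\<Omega> \<in> sets lebesgue" using \<Omega>lm by auto
    have dm: "(\<lambda>x. indicator \<Omega> x *\<^sub>R (u x - X x)) \<in> borel_measurable lebesgue"
      unfolding scaleR_diff_right using um Xm by measurable
    have hm: "h \<in> borel_measurable lebesgue" unfolding h_def using dm by measurable
    have nn: "(\<integral>\<^sup>+x. ennreal ((h x)\<^sup>2) \<partial>lebesgue) = ennreal W"
      unfolding W(1)[symmetric] by (intro nn_integral_cong) (simp add: h_def indicator_def)
    have h2: "integrable lebesgue (\<lambda>x. (h x)\<^sup>2)"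
      by (rule integrableI_nn_integral_finite[OF _ _ nn]) (use hm in auto)
    have "ennreal (\<integral>x. (h x)\<^sup>2 \<partial>lebesgue) = ennreal W"
      using nn_integral_eq_integral[OF h2] nn by simp
    then have hW: "(\<integral>x. (h x)\<^sup>2 \<partial>lebesgue) = W" using W(2) by simp
    have h0: "h x = 0" if "x \<notin> \<Omega>" for x using that by (simp add: h_def)
    have hn: "0 \<le> h x" for x by (simp add: h_def)
    have ih: "integrable lebesgue h" and hle: "(\<integral>x. h x \<partial>lebesgue) \<le> sqrt (measure lebesgue \<Omega> * W)"
      using Cauchy_Schwarz_integral_indicator[OF hm hn h0 \<Omega>lm h2] unfolding hW by blast+
    define e where "e i x = (indicator \<Omega> x *\<^sub>R (u x - X x)) $ j $ i" for i x
    have em: "e i \<in> borel_measurable lebesgue" for i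
      unfolding e_def by (intro measurable_vec_nth dm)
    have eh: "\<bar>e i x\<bar> \<le> h x" for i x
      unfolding e_def h_def real_norm_def[symmetric] by (intro order_trans[OF Finite_Cartesian_Product.norm_nth_le Finite_Cartesian_Product.norm_nth_le])
    have e0: "e i x = 0" if "x \<notin> \<Omega>" for i x using that by (simp add: e_def)
    have eQle: "\<bar>e i x * Q i x\<bar> \<le> C1 * \<mu> ^ L * h x" for i x
    proof (cases "x \<in> \<Omega>")
      case True
      have "\<bar>e i x\<bar> * \<bar>Q i x\<bar> \<le> h x * (C1 * \<mu> ^ L)"
        by (intro mult_mono eh Qle True) (simp_all add: h_def)
      then show ?thesis by (simp add: abs_mult mult.commute)
    qed (simp add: e0 h0)
    have ieQ: "integrable lebesgue (\<lambda>x. e i x * Q i x)" for i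
      by (rule Bochner_Integration.integrable_bound[OF integrable_mult_right[OF ih, of "C1 * \<mu> ^ L"]])
         (use em Qm' eQle in \<open>auto intro!: order_trans[OF _ abs_ge_self]\<close>)
    have eQ: "\<bar>\<integral>x. e i x * Q i x \<partial>lebesgue\<bar> \<le> C1 * \<mu> ^ L * sqrt (measure lebesgue \<Omega> * W)" for i
    proof -
      have "\<bar>\<integral>x. e i x * Q i x \<partial>lebesgue\<bar> \<le> (\<integral>x. C1 * \<mu> ^ L * h x \<partial>lebesgue)"
        by (rule abs_integral_le[OF ieQ integrable_mult_right[OF ih] eQle])
      also have "\<dots> \<le> C1 * \<mu> ^ L * sqrt (measure lebesgue \<Omega> * W)"
        using hle C1 \<mu>1 by (simp add: mult_left_mono)
      finally show ?thesis .
    qed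
    have igQ: "integrable lborel (\<lambda>x. g x * Q i x)" for i
    proof -
      have "bounded (range (Q i))" by (rule test_function_gradient(2)[OF Q])
      then obtain BQ where BQ: "\<And>x. \<bar>Q i x\<bar> \<le> BQ" by (auto simp: bounded_iff)
      have "integrable lborel g" by (rule integrable_bounded_support[OF g(1,2) \<Omega>(2) g(3)])
      then show ?thesis by (rule integrable_mult_bounded[OF _ Qm BQ])
    qed
    have gQm: "(\<lambda>x. g x * Q i x) \<in> borel_measurable lborel" for i using igQ by auto
    have igQ': "integrable lebesgue (\<lambda>x. g x * Q i x)" for i
      using igQ by (simp add: integrable_completion[OF gQm])
    have igQ_eq: "(\<integral>x. g x * Q i x \<partial>lebesgue) = (\<integral>x. g x * Q i x \<partial>lborel)" for i
      by (rule integral_completion[OF gQm])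
    have AEu: "AE x in lebesgue. x \<notin> closure \<Omega> \<longrightarrow> u x = F"
      using u by (simp add: admissible_def)
    have "AE x in lebesgue. x \<notin> frontier \<Omega>"
      using \<Omega>(4) by (intro AE_not_in) (simp add: negligible_iff_null_sets)
    then have AEQ: "AE x in lebesgue. u x $ j $ i * Q i x
        = e i x * Q i x + v $ j * T $ i * (g x * Q i x) + F $ j $ i * Q i x" for i
      using AEu gX
    proof eventually_elim
      case (elim x)
      show ?case
      proof (cases "x \<in> \<Omega>")
        case True
        then have "u x $ j $ i = (u x - X x) $ j $ i + (X x - F) $ j $ i + F $ j $ i" by simp
        also have "(X x - F) $ j $ i = g x * (v $ j * T $ i)"
          using elim True ABi[of i] by simp
        finally have "u x $ j $ i = e i x + g x * (v $ j * T $ i) + F $ j $ i"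
          using True by (simp add: e_def)
        then show ?thesis by (simp add: algebra_simps)
      next
        case False
        then have "x \<notin> closure \<Omega>" using elim(1) \<Omega>(1) by (simp add: frontier_def interior_open)
        then show ?thesis using elim False by (simp add: e0 g)
      qed
    qed
    have uQ: "(\<integral>x. u x $ j $ i * Q i x \<partial>lebesgue)
        = (\<integral>x. e i x * Q i x \<partial>lebesgue) + v $ j * T $ i * (\<integral>x. g x * Q i x \<partial>lborel)" for i
    proof -
      have "(\<integral>x. u x $ j $ i * Q i x \<partial>lebesgue)
        = (\<integral>x. e i x * Q i x + v $ j * T $ i * (g x * Q i x) + F $ j $ i * Q i x \<partial>lebesgue)"
      proof (rule integral_cong_AE[OF _ _ AEQ])
        show "(\<lambda>x. u x $ j $ i * Q i x) \<in> borel_measurable lebesgue"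
          by (intro borel_measurable_times measurable_vec_nth um Qm')
        show "(\<lambda>x. e i x * Q i x + v $ j * T $ i * (g x * Q i x) + F $ j $ i * Q i x) \<in> borel_measurable lebesgue"
          using ieQ[of i] igQ'[of i] iQ[of i] by auto
      qed
      then show ?thesis using ieQ[of i] igQ'[of i] iQ[of i] by (simp add: intQ igQ_eq)
    qed
    have km: "mono k" unfolding k_def by (rule mono_basis_index[OF sum_l])
    let ?I = "{i :: 'm \<Rightarrow> 'd. mono i}"
    \<comment> \<open>Of the terms \<open>v $ j * T $ i\<close>, only the one at \<open>k\<close> survives.\<close>
    have "div_m_distr u j \<phi> = 0"
      using u \<phi> by (auto simp: admissible_def div_m_free_def)
    then have "(\<Sum>i\<in>?I. \<integral>x. u x $ j $ i * Q i x \<partial>lebesgue) = 0"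
      by (simp add: div_m_distr_def Q_def)
    then have "(\<Sum>i\<in>?I. \<integral>x. e i x * Q i x \<partial>lebesgue)
        + (\<Sum>i\<in>?I. v $ j * T $ i * (\<integral>x. g x * Q i x \<partial>lborel)) = 0"
      by (simp only: uQ sum.distrib)
    moreover have "(\<Sum>i\<in>?I. v $ j * T $ i * (\<integral>x. g x * Q i x \<partial>lborel)) = \<kappa> * (\<integral>x. g x * Q k x \<partial>lborel)"
      using km T0 by (subst sum.remove[of _ k]) (auto simp: \<kappa>_def intro!: sum.neutral)
    ultimately have "\<bar>\<kappa> * (\<integral>x. g x * Q k x \<partial>lborel)\<bar> = \<bar>\<Sum>i\<in>?I. \<integral>x. e i x * Q i x \<partial>lebesgue\<bar>"
      by linarith
    also have "\<dots> \<le> (\<Sum>i\<in>?I. \<bar>\<integral>x. e i x * Q i x \<partial>lebesgue\<bar>)" by (rule sum_abs)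
    also have "\<dots> \<le> (\<Sum>i\<in>?I. C1 * \<mu> ^ L * sqrt (measure lebesgue \<Omega> * W))"
      by (intro sum_mono eQ)
    also have "\<dots> = K * (\<mu> ^ L * sqrt W)"
      by (simp add: K_def real_sqrt_mult mult_ac)
    finally have upper: "\<bar>\<kappa>\<bar> * \<bar>\<integral>x. g x * Q k x \<partial>lborel\<bar> \<le> K * (\<mu> ^ L * sqrt W)"
      by (simp add: abs_mult)
    have "(\<integral>x. g x * Q k x \<partial>lborel) = (\<integral>x. g x * (\<integral>y. a y * mollifier \<mu> (x - y) \<partial>lborel) \<partial>lborel)"
    proof (rule Bochner_Integration.integral_cong[OF refl])
      fix x
      show "g x * Q k x = g x * (\<integral>y. a y * mollifier \<mu> (x - y) \<partial>lborel)"
      proof (cases "x \<in> \<Omega>")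
        case True
        have "Q k x = (\<integral>y. a y * mollifier \<mu> (x - y) \<partial>lborel)"
          unfolding Q_def
          by (rule \<phi>l[OF _ True]) (simp only: count_map_sorted_list[unfolded count_mset] k_def card_basis_index[OF sum_l])
        then show ?thesis by simp
      qed (simp add: g)
    qed
    also have "\<dots> = (\<integral>z. mollifier \<mu> z * (\<integral>x. g x * a (x - z) \<partial>lborel) \<partial>lborel)"
      using \<mu>1 by (intro integral_mollified_swap[OF g(1,2) \<Omega>(2) g(3) a(1,2)]) auto
    also have "\<dots> \<ge> (\<integral>z. mollifier \<mu> (z :: (real, 'd) vec) * (min lam (1 - lam) * q - n / \<mu> * V / \<bar>\<kappa>\<bar>) \<partial>lborel)"
    proof (rule integral_mono)
      have \<mu>0: "0 < \<mu>" using \<mu>1 by simp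
      have im: "integrable lborel (mollifier \<mu> :: (real, 'd) vec \<Rightarrow> real)" by (rule mollifier_facts[OF \<mu>0])
      then show "integrable lborel (\<lambda>z :: (real, 'd) vec. mollifier \<mu> z * (min lam (1 - lam) * q - n / \<mu> * V / \<bar>\<kappa>\<bar>))"
        by simp
      have ig: "integrable lborel g" by (rule integrable_bounded_support[OF g(1,2) \<Omega>(2) g(3)])
      note [measurable] = g(1) a(1)
      have bd: "\<bar>\<integral>x. g x * a (x - z) \<partial>lborel\<bar> \<le> (\<integral>x. \<bar>g x\<bar> \<partial>lborel)" for z
      proof (rule abs_integral_le)
        show "integrable lborel (\<lambda>x. g x * a (x - z))"
          by (rule integrable_mult_bounded[OF ig _ a(2)]) measurable
        show "\<bar>g x * a (x - z)\<bar> \<le> \<bar>g x\<bar>" for x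
          using a(2)[of "x - z"] by (simp add: abs_mult mult_left_le)
      qed (use ig in simp)
      have meas: "(\<lambda>z. \<integral>x. g x * a (x - z) \<partial>lborel) \<in> borel_measurable borel"
        by (rule lborel.borel_measurable_lebesgue_integral) measurable
      show "integrable lborel (\<lambda>z. mollifier \<mu> z * (\<integral>x. g x * a (x - z) \<partial>lborel))"
        by (rule integrable_mult_bounded[OF im meas bd])
      fix z :: "(real, 'd) vec"
      show "mollifier \<mu> z * (min lam (1 - lam) * q - n / \<mu> * V / \<bar>\<kappa>\<bar>)
          \<le> mollifier \<mu> z * (\<integral>x. g x * a (x - z) \<partial>lborel)"
      proof (cases "norm z \<le> n / \<mu>")
        case True
        have "norm z * V / norm (A - B) \<le> n / \<mu> * V / \<bar>\<kappa>\<bar>"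
          using True V(2) \<kappa> \<kappa>le \<mu>1 n by (intro frac_le mult_right_mono) auto
        then have "min lam (1 - lam) * q - n / \<mu> * V / \<bar>\<kappa>\<bar> \<le> (\<integral>x. g x * a (x - z) \<partial>lborel)"
          using corr[of z] True \<mu>r unfolding q_def by linarith
        then show ?thesis using mollifier_nonneg[OF \<mu>0] by (intro mult_left_mono) auto
      next
        case False
        then have "mollifier \<mu> z = 0"
          using mollifier_facts(4)[OF \<mu>0, of z] by (simp add: n_def)
        then show ?thesis by simp
      qed
    qed
    also have "(\<integral>z. mollifier \<mu> (z :: (real, 'd) vec) * (min lam (1 - lam) * q - n / \<mu> * V / \<bar>\<kappa>\<bar>) \<partial>lborel)
        = Z * (min lam (1 - lam) * q - n / \<mu> * V / \<bar>\<kappa>\<bar>)"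
      using \<mu>1 integral_mollifier[of \<mu>, where 'd='d] by (simp add: Z_def)
    finally have "Z * (min lam (1 - lam) * q - n / \<mu> * V / \<bar>\<kappa>\<bar>) \<le> \<bar>\<integral>x. g x * Q k x \<partial>lborel\<bar>"
      by linarith
    then have fin: "\<bar>\<kappa>\<bar> * (Z * (min lam (1 - lam) * q - n / \<mu> * V / \<bar>\<kappa>\<bar>)) \<le> K * (\<mu> ^ L * sqrt W)"
      using upper \<kappa> by (meson mult_left_mono order_trans less_imp_le)
    have "min lam (1 - lam) \<le> n / (q * \<bar>\<kappa>\<bar>) * (V / \<mu>) + K / (\<bar>\<kappa>\<bar> * Z * q) * (\<mu> ^ L * sqrt W)"
    proof -
      define s where "s = \<bar>\<kappa>\<bar>"
      define mm where "mm = min lam (1 - lam)"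
      define P where "P = \<mu> ^ L * sqrt W"
      have s: "0 < s" using \<kappa> by (simp add: s_def)
      have "s * (Z * (mm * q - n / \<mu> * V / s)) \<le> K * P"
        using fin by (simp add: s_def mm_def P_def)
      then have "mm * q - n / \<mu> * V / s \<le> K * P / (s * Z)"
        using s Z by (simp add: pos_le_divide_eq mult_ac)
      then have "mm * q \<le> n / \<mu> * V / s + K * P / (s * Z)" by linarith
      then have "mm \<le> (n / \<mu> * V / s + K * P / (s * Z)) / q"
        using q by (simp add: pos_le_divide_eq)
      also have "\<dots> = n / (q * s) * (V / \<mu>) + K / (s * Z * q) * P"
        using q s Z by (simp add: add_divide_distrib mult_ac)
      finally show ?thesis by (simp add: s_def mm_def P_def)
    qed
    also have "\<dots> \<le> C * (V / \<mu> + \<mu> ^ L * sqrt W)"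
    proof -
      have "0 \<le> V / \<mu>" "0 \<le> \<mu> ^ L * sqrt W" using V(2) W(2) \<mu>1 by auto
      moreover have "n / (q * \<bar>\<kappa>\<bar>) \<le> C" "K / (\<bar>\<kappa>\<bar> * Z * q) \<le> C"
        using n q \<kappa> K Z by (auto simp: C_def)
      ultimately show ?thesis unfolding distrib_left by (intro add_mono mult_right_mono)
    qed
    finally show "min lam (1 - lam) \<le> C * (V / \<mu> + \<mu> ^ (CARD('m) - Min (range l)) * sqrt W)"
      by (simp add: L_def)
  qed
qed

end

text \<open>With this \<open>\<mu>\<close> one has \<open>\<epsilon> \<mu> = \<mu>\<^sup>-\<^sup>2\<^sup>L = \<epsilon> powr (2 L / (2 L + 1))\<close>. One of the two terms on the right of
  the interpolation inequality is at least \<open>t / 2\<close>, and either alternative bounds the energy below.\<close>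
lemma energy_from_interpolation:
  fixes t C V W \<epsilon> \<mu> :: real and L :: nat
  assumes t: "0 < t" "t \<le> 1" and C: "0 < C" and V: "0 \<le> V" and W: "0 \<le> W" and \<epsilon>: "0 < \<epsilon>"
    and le: "t \<le> C * (V / \<mu> + \<mu> ^ L * sqrt W)" and \<mu>: "\<mu> = \<epsilon> powr (- 1 / (2 * real L + 1))"
  shows "min (1 / (2 * C)) (1 / (4 * C\<^sup>2)) * t\<^sup>2 * \<epsilon> powr (2 * real L / (2 * real L + 1)) \<le> W + \<epsilon> * V"
proof -
  define p where "p = \<epsilon> powr (2 * real L / (2 * real L + 1))"
  have \<mu>0: "0 < \<mu>" using \<epsilon> by (simp add: \<mu>)
  have p0: "0 < p" using \<epsilon> by (simp add: p_def)
  have pV: "\<epsilon> * \<mu> = p"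
  proof -
    have "\<epsilon> * \<mu> = \<epsilon> powr (1 + - 1 / (2 * real L + 1))"
      unfolding powr_add using \<epsilon> by (simp add: \<mu>)
    also have "1 + - 1 / (2 * real L + 1) = 2 * real L / (2 * real L + 1)"
      by (simp add: field_simps)
    finally show ?thesis by (simp add: p_def)
  qed
  have pW: "(\<mu> ^ L)\<^sup>2 * p = 1"
  proof -
    have "(\<mu> ^ L)\<^sup>2 = \<mu> ^ (2 * L)" by (simp add: power_mult[symmetric] mult.commute)
    also have "\<dots> = \<mu> powr (2 * real L)" using powr_realpow[OF \<mu>0, of "2 * L"] by simp
    also have "\<dots> = \<epsilon> powr (- (2 * real L / (2 * real L + 1)))"
      by (simp add: \<mu> powr_powr)
    finally show ?thesis using \<epsilon> by (simp add: p_def powr_minus)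
  qed
  let ?c = "min (1 / (2 * C)) (1 / (4 * C\<^sup>2))"
  show ?thesis
    unfolding p_def[symmetric]
  proof (cases "t / 2 \<le> C * (V / \<mu>)")
    case True
    have "?c * t\<^sup>2 * p \<le> 1 / (2 * C) * t * p"
      using t C p0 by (intro mult_right_mono mult_mono) (auto simp: power2_eq_square mult_left_le)
    also have "\<dots> = (t / 2) / C * (\<epsilon> * \<mu>)" by (simp add: pV)
    also have "\<dots> \<le> V / \<mu> * (\<epsilon> * \<mu>)"
      using True C \<epsilon> \<mu>0 by (intro mult_right_mono) (auto simp: pos_divide_le_eq mult_ac)
    also have "\<dots> = \<epsilon> * V" using \<mu>0 by simp
    finally show "?c * t\<^sup>2 * p \<le> W + \<epsilon> * V" using W by simp
  next
    case False
    then have "t / 2 \<le> C * (\<mu> ^ L * sqrt W)" using le unfolding distrib_left by linarith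
    then have "(t / 2)\<^sup>2 \<le> (C * (\<mu> ^ L * sqrt W))\<^sup>2" using t by (intro power_mono) auto
    then have "t\<^sup>2 / 4 \<le> C\<^sup>2 * (\<mu> ^ L)\<^sup>2 * W"
      using W by (simp add: power_mult_distrib power_divide mult_ac)
    then have "1 / (4 * C\<^sup>2) * t\<^sup>2 \<le> (\<mu> ^ L)\<^sup>2 * W"
      using C by (simp add: field_simps)
    then have "1 / (4 * C\<^sup>2) * t\<^sup>2 * p \<le> (\<mu> ^ L)\<^sup>2 * W * p"
      using p0 by (intro mult_right_mono) auto
    also have "\<dots> = ((\<mu> ^ L)\<^sup>2 * p) * W" by (simp add: mult_ac)
    also have "\<dots> = W" by (simp only: pW mult_1)
    also have "\<dots> \<le> W + \<epsilon> * V" using \<epsilon> V by simp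
    finally have "1 / (4 * C\<^sup>2) * t\<^sup>2 * p \<le> W + \<epsilon> * V" .
    moreover have "?c * t\<^sup>2 * p \<le> 1 / (4 * C\<^sup>2) * t\<^sup>2 * p"
      using p0 by (intro mult_right_mono) auto
    ultimately show "?c * t\<^sup>2 * p \<le> W + \<epsilon> * V" by linarith
  qed
qed

theorem lemma3p7:
  fixes \<Omega> :: "(real ^ 'd::{finite,linorder}) set"
    and v :: "real ^ 'k::finite"
  assumes "CARD('d) \<ge> 2"
    and "open \<Omega>" and "bounded \<Omega>" and "lipschitz_domain \<Omega>"
    and "v \<noteq> 0"
  shows "\<exists>C>0. \<forall>lam. 0 < lam \<and> lam < 1 \<longrightarrow>
    (\<exists>\<epsilon>\<^sub>0>0. \<forall>(l :: 'd \<Rightarrow> nat) (A :: ('m::{finite,linorder}, 'd, 'k) tens_rows) B F L.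
       A \<in> sym_rows \<and> B \<in> sym_rows \<and>
       (\<Sum>j\<in>UNIV. l j) = CARD('m) \<and>
       A - B = row_tensor v (basis_sym_prod l) \<and>
       F = lam *\<^sub>R A + (1 - lam) *\<^sub>R B \<and>
       L = CARD('m) - Min (range l) \<longrightarrow>
       (\<forall>\<epsilon>. 0 < \<epsilon> \<and> \<epsilon> < \<epsilon>\<^sub>0 \<longrightarrow>
          ennreal (C * (min (1 - lam) lam)\<^sup>2 * \<epsilon> powr (2 * real L / (2 * real L + 1)))
            \<le> (INF X \<in> BV_two_valued \<Omega> A B. energy \<epsilon> \<Omega> X F)))"
proof -
  obtain b where b: "derivative_chain b" "\<And>t. 0 \<le> b 0 t" "0 < b 0 0"
    "\<And>n t. 1 \<le> \<bar>t\<bar> \<Longrightarrow> b n t = 0" using ex_bump by blast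
  interpret bump b by unfold_locales (use b in auto)
  have ne: "\<Omega> \<noteq> {}" using assms(4) by (simp add: lipschitz_domain_def)
  have neg: "negligible (frontier \<Omega>)" by (rule negligible_frontier_lipschitz_domain[OF assms(4)])
  let ?S = "{l :: 'd \<Rightarrow> nat. (\<Sum>j\<in>UNIV. l j) = CARD('m)}"
  have finS: "finite ?S"
  proof (rule finite_subset)
    show "finite {l :: 'd \<Rightarrow> nat. \<forall>j. l j \<in> {..CARD('m)}}"
      using finite_PiE[of "UNIV :: 'd set" "\<lambda>_. {..CARD('m)}"] by (simp add: PiE_def Pi_def)
    show "?S \<subseteq> {l. \<forall>j. l j \<in> {..CARD('m)}}"
    proof (intro subsetI CollectI allI)
      fix l :: "'d \<Rightarrow> nat" and j assume "l \<in> ?S"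
      then show "l j \<in> {..CARD('m)}" using member_le_sum[of j UNIV l] by simp
    qed
  qed
  \<comment> \<open>There are only finitely many exponents \<open>l\<close>, so the constants can be chosen uniformly.\<close>
  define est where "est l C \<mu>\<^sub>0 \<longleftrightarrow> 0 < C \<and> 1 \<le> \<mu>\<^sub>0 \<and>
    (\<forall>lam (A :: ('m, 'd, 'k) tens_rows) B F X u V W \<mu>.
      0 < lam \<longrightarrow> lam < 1 \<longrightarrow> A - B = row_tensor v (basis_sym_prod l) \<longrightarrow>
      F = lam *\<^sub>R A + (1 - lam) *\<^sub>R B \<longrightarrow>
      set_integrable lebesgue \<Omega> X \<longrightarrow> (\<forall>x\<in>\<Omega>. X x \<in> {A, B}) \<longrightarrow>
      total_variation \<Omega> X \<le> ennreal V \<longrightarrow> 0 \<le> V \<longrightarrow> u \<in> admissible \<Omega> F \<longrightarrow>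
      (\<integral>\<^sup>+x\<in>\<Omega>. ennreal ((norm (u x - X x))\<^sup>2) \<partial>lebesgue) = ennreal W \<longrightarrow> 0 \<le> W \<longrightarrow> \<mu>\<^sub>0 \<le> \<mu> \<longrightarrow>
      min lam (1 - lam) \<le> C * (V / \<mu> + \<mu> ^ (CARD('m) - Min (range l)) * sqrt W))"
    for l :: "'d \<Rightarrow> nat" and C \<mu>\<^sub>0 :: real
  have "\<forall>l\<in>?S. \<exists>C \<mu>\<^sub>0. est l C \<mu>\<^sub>0"
  proof
    fix l assume "l \<in> ?S"
    then have sum_l: "(\<Sum>j\<in>UNIV. l j) = CARD('m)" by simp
    show "\<exists>C \<mu>\<^sub>0. est l C \<mu>\<^sub>0"
      unfolding est_def by (rule elastic_energy_estimate[OF assms(2,3) ne neg assms(5) sum_l])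
  qed
  then obtain C \<mu>\<^sub>0 where est: "\<And>l. l \<in> ?S \<Longrightarrow> est l (C l) (\<mu>\<^sub>0 l)" by metis
  define c where "c l = min (1 / (2 * C l)) (1 / (4 * (C l)\<^sup>2))" for l
  define \<epsilon>\<^sub>0 where "\<epsilon>\<^sub>0 l = \<mu>\<^sub>0 l powr (- (2 * real (CARD('m) - Min (range l)) + 1))" for l
  define c' where "c' = Min (insert 1 (c ` ?S))"
  define \<epsilon>' where "\<epsilon>' = Min (insert 1 (\<epsilon>\<^sub>0 ` ?S))"
  have pos: "0 < C l" "0 < \<mu>\<^sub>0 l" "1 \<le> \<mu>\<^sub>0 l" if "l \<in> ?S" for l
    using est[OF that] unfolding est_def by auto
  have c'0: "0 < c'"
  proof -
    have "0 < c l" if "l \<in> ?S" for l using pos(1)[OF that] by (simp add: c_def)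
    then show ?thesis unfolding c'_def using finS by (subst Min_gr_iff) auto
  qed
  have \<epsilon>'0: "0 < \<epsilon>'"
  proof -
    have "0 < \<epsilon>\<^sub>0 l" if "l \<in> ?S" for l using pos(2)[OF that] by (simp add: \<epsilon>\<^sub>0_def)
    then show ?thesis unfolding \<epsilon>'_def using finS by (subst Min_gr_iff) auto
  qed
  show ?thesis
  proof (rule exI[of _ c'], intro conjI c'0 allI impI, rule exI[of _ \<epsilon>'], intro conjI \<epsilon>'0 allI impI)
    fix lam \<epsilon> :: real and l :: "'d \<Rightarrow> nat" and A B F :: "('m, 'd, 'k) tens_rows" and L :: nat
    assume lam: "0 < lam \<and> lam < 1"
    assume *: "A \<in> sym_rows \<and> B \<in> sym_rows \<and> (\<Sum>j\<in>UNIV. l j) = CARD('m) \<and>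
       A - B = row_tensor v (basis_sym_prod l :: ('m, 'd) tens) \<and> F = lam *\<^sub>R A + (1 - lam) *\<^sub>R B \<and>
       L = CARD('m) - Min (range l)"
    assume \<epsilon>: "0 < \<epsilon> \<and> \<epsilon> < \<epsilon>'"
    have l: "l \<in> ?S" using * by simp
    have L: "L = CARD('m) - Min (range l)" using * by blast
    have cl: "c' \<le> c l" unfolding c'_def using finS l by (intro Min_le) auto
    have "\<epsilon>' \<le> \<epsilon>\<^sub>0 l" unfolding \<epsilon>'_def using finS l by (intro Min_le) auto
    then have \<epsilon>l: "\<epsilon> < \<epsilon>\<^sub>0 l" using \<epsilon> by linarith
    have Cl: "0 < C l" "1 \<le> \<mu>\<^sub>0 l" using pos[OF l] by auto
    define \<mu> where "\<mu> = \<epsilon> powr (- 1 / (2 * real L + 1))"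
    have \<mu>: "\<mu>\<^sub>0 l \<le> \<mu>"
    proof -
      have "\<mu>\<^sub>0 l = (\<mu>\<^sub>0 l powr (- (2 * real L + 1))) powr (- 1 / (2 * real L + 1))"
      proof -
        have "- y * (- 1 / y) = 1" if "y \<noteq> 0" for y :: real using that by simp
        from this[of "2 * real L + 1"]
        have "- (2 * real L + 1) * (- 1 / (2 * real L + 1)) = 1" by linarith
        then show ?thesis unfolding powr_powr using Cl by simp
      qed
      also have "\<dots> \<le> \<mu>"
        unfolding \<mu>_def using \<epsilon> \<epsilon>l
        by (intro powr_mono2') (auto simp: \<epsilon>\<^sub>0_def L intro: divide_nonpos_nonneg)
      finally show ?thesis .
    qed
    let ?m = "c' * (min (1 - lam) lam)\<^sup>2 * \<epsilon> powr (2 * real L / (2 * real L + 1))"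
    show "ennreal ?m \<le> (INF X \<in> BV_two_valued \<Omega> A B. energy \<epsilon> \<Omega> X F)"
    proof (rule INF_greatest)
      fix X assume X: "X \<in> BV_two_valued \<Omega> A B"
      then have "total_variation \<Omega> X < \<infinity>" by (simp add: BV_two_valued_def)
      then obtain V where V: "0 \<le> V" "total_variation \<Omega> X = ennreal V"
        by (cases "total_variation \<Omega> X") auto
      have "ennreal ?m \<le> (\<integral>\<^sup>+x\<in>\<Omega>. ennreal ((norm (u x - X x))\<^sup>2) \<partial>lebesgue) + ennreal \<epsilon> * total_variation \<Omega> X"
        if u: "u \<in> admissible \<Omega> F" for u
      proof (cases "\<integral>\<^sup>+x\<in>\<Omega>. ennreal ((norm (u x - X x))\<^sup>2) \<partial>lebesgue")
        case (real W)
        have "min lam (1 - lam) \<le> C l * (V / \<mu> + \<mu> ^ L * sqrt W)"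
          using est[OF l] lam * X V u real \<mu> unfolding est_def L BV_two_valued_def by auto
        then have "c l * (min lam (1 - lam))\<^sup>2 * \<epsilon> powr (2 * real L / (2 * real L + 1)) \<le> W + \<epsilon> * V"
          unfolding c_def using lam Cl V real \<epsilon>
          by (intro energy_from_interpolation[where \<mu>=\<mu>]) (auto simp: \<mu>_def)
        moreover have "?m \<le> c l * (min lam (1 - lam))\<^sup>2 * \<epsilon> powr (2 * real L / (2 * real L + 1))"
          using cl by (simp add: min.commute mult_right_mono)
        ultimately have "ennreal ?m \<le> ennreal (W + \<epsilon> * V)" by (intro ennreal_leI) linarith
        then show ?thesis using real V \<epsilon> by (simp add: ennreal_mult)
      qed simp
      then have "ennreal ?m - ennreal \<epsilon> * total_variation \<Omega> X
          \<le> (INF u \<in> admissible \<Omega> F. \<integral>\<^sup>+x\<in>\<Omega>. ennreal ((norm (u x - X x))\<^sup>2) \<partial>lebesgue)"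
        by (intro INF_greatest) (simp add: ennreal_minus_le_iff add.commute)
      then show "ennreal ?m \<le> energy \<epsilon> \<Omega> X F"
        by (simp add: energy_def ennreal_minus_le_iff add.commute)
    qed
  qed
qed

end
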